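(* Let $(\kappa,G)$ be a chain digraph of the family $\mathcal F_3$, that is, $G=(V,E)$ is a rooted tree directed from the leaves to the root and $\kappa$ is almost even: $\kappa_{i,j}$ is even on all directed edges $(v_i,v_j)\in E$ except exactly one, which ends in the root and on which $\kappa$ is odd. Then the Lie algebra $\mathfrak g(\kappa,G)$ is symplectic. Moreover, the 2-form $$\sigma_G=\sum_{(v_i,v_j)\in E}\sigma_{i,j}$$ is a symplectic form on $\mathfrak g(\kappa,G)$, where, if $\kappa_{i,j}$ is even, $$\sigma_{i,j}=\sum_{l=1}^{\kappa_{i,j}/2}(-1)^{l+1}\,(w_{i,j}^{l})^*\wedge (w_{i,j}^{\kappa_{i,j}+1-l})^*,$$ and, if $\kappa_{i,j}$ is odd, with $\kappa_{i,j}'=\kappa_{i,j}-1$, $$\sigma_{i,j}=v_j^*\wedge (w_{i,j}^{\kappa_{i,j}})^*+\sum_{l=1}^{\kappa_{i,j}'/2}(-1)^{l+1}\,(w_{i,j}^{l})^*\wedge (w_{i,j}^{\kappa_{i,j}'+1-l})^*.$$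
   Context: All Lie algebras are finite-dimensional over a field $\mathbb{K}$ of characteristic zero. For a Lie algebra $\mathfrak g$, $d:\mathfrak g^*\to\Lambda^2\mathfrak g^*$ is the dual of the bracket $\Lambda^2\mathfrak g\to\mathfrak g$, extended by $d(\alpha\wedge\beta)=d\alpha\wedge\beta-\alpha\wedge d\beta$ for $\alpha,\beta\in\mathfrak g^*$. A symplectic form on a Lie algebra of dimension $2n$ is $\omega\in\Lambda^2\mathfrak g^*$ with $d\omega=0$ and $\omega^n\neq0$; $\mathfrak g$ is symplectic if it admits one. A digraph is a pair $G=(V,E)$ with $V=\{v_1,\dots,v_m\}$ finite, $E\subseteq V\times V$, such that $(u,v)\in E$ implies $(v,u)\notin E$ (in particular no loops). A tree with chosen root $v$ is directed from the leaves to the root if for every vertex $u\ne v$ there is a directed path from $u$ to $v$ (this orientation is unique). A chain digraph is a pair $(\kappa,G)$ with $G=(V,E)$ a digraph and $\kappa:E\to\mathbb{N}_{\ge2}$ a function; $\kappa_{i,j}=\kappa((v_i,v_j))$ and $k$ is the maximum value of $\kappa$. Let $L_{(k)}(m)$ be the free $k$-step nilpotent Lie algebra on $v_1,\dots,v_m$ and $\mathfrak g(k,G)=L_{(k)}(m)/I$, where $I$ is the ideal generated by all $[v_i,v_j]$ such that neither $(v_i,v_j)$ nor $(v_j,v_i)$ is in $E$. It is graded by $\mathbb{Z}_{\ge0}^m$ with $v_i$ in multidegree $e_i$; $V_d$ denotes the sum of the components of total degree $d$. For $(v_i,v_j)\in E$ and $1\le c\le k$, let $I_{i,j}^{c}$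 be the sum of all multihomogeneous components of $\mathfrak g(k,G)$ whose multidegree is not in $\{e_j\}\cup\{e_i+(l-1)e_j:1\le l\le c\}$; it is an ideal. Put $I_\kappa=\big(\bigcap_{(v_i,v_j)\in E}I_{i,j}^{\kappa_{i,j}}\big)\cap(V_3\oplus\dots\oplus V_k)$ and $\mathfrak g(\kappa,G)=\mathfrak g(k,G)/I_\kappa$. For $(v_i,v_j)\in E$ define $w_{i,j}^1=v_i$, $w_{i,j}^2=[v_i,v_j]$, $w_{i,j}^l=[w_{i,j}^{l-1},v_j]$ for $l\ge3$; the same symbols denote images in $\mathfrak g(\kappa,G)$. The standard basis of $\mathfrak g(\kappa,G)$ is $\{v_1,\dots,v_m\}\cup\{w_{i,j}^l:(v_i,v_j)\in E,\ 2\le l\le\kappa_{i,j}\}$, and the only nonzero brackets of basis elements, up to skew-symmetry, are $[w_{i,j}^l,v_j]=w_{i,j}^{l+1}$ for $(v_i,v_j)\in E$, $1\le l\le\kappa_{i,j}-1$. A superscript ${}^*$ denotes the element of the dual of the standard basis. *)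

theory Defs
  imports
    "HOL-Algebra.QuotRing"
    "Jordan_Normal_Form.VS_Connect"
    "Graph_Theory.Graph_Theory"
begin

hide_const (open) Multiset.mult
hide_const (open) Modules.module

section \<open>Lie algebras\<close>

text \<open>
  An algebra over the field \<open>'k\<close> is a record of type \<open>('k, 'a) module\<close> over \<^term>\<open>class_ring\<close>, whose
  field \<open>mult\<close> (notation \<open>x \<otimes>\<^bsub>L\<^esub> y\<close>) is the bracket. The field \<open>one\<close> of the record has no meaning
  here.
\<close>

abbreviation vs_span :: "('k::field_char_0, 'a) module \<Rightarrow> 'a set \<Rightarrow> 'a set" where
  "vs_span L \<equiv> LinearCombinations.module.span class_ring L"

locale lie_algebra = vectorspace class_ring L
  for L :: "('k::field_char_0, 'a) module" (structure) +
  assumes bracket_closed: "x \<in> carrier L \<Longrightarrow> y \<in> carrier L \<Longrightarrow> x \<otimes> y \<in> carrier L"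
    and bracket_add_left: "x \<in> carrier L \<Longrightarrow> y \<in> carrier L \<Longrightarrow> z \<in> carrier L \<Longrightarrow>
      (x \<oplus> y) \<otimes> z = x \<otimes> z \<oplus> y \<otimes> z"
    and bracket_add_right: "x \<in> carrier L \<Longrightarrow> y \<in> carrier L \<Longrightarrow> z \<in> carrier L \<Longrightarrow>
      z \<otimes> (x \<oplus> y) = z \<otimes> x \<oplus> z \<otimes> y"
    and bracket_smult_left: "x \<in> carrier L \<Longrightarrow> y \<in> carrier L \<Longrightarrow>
      (c \<odot>\<^bsub>L\<^esub> x) \<otimes> y = c \<odot>\<^bsub>L\<^esub> (x \<otimes> y)"
    and bracket_smult_right: "x \<in> carrier L \<Longrightarrow> y \<in> carrier L \<Longrightarrow>
      x \<otimes> (c \<odot>\<^bsub>L\<^esub> y) = c \<odot>\<^bsub>L\<^esub> (x \<otimes> y)"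
    and bracket_self: "x \<in> carrier L \<Longrightarrow> x \<otimes> x = \<zero>"
    and jacobi: "x \<in> carrier L \<Longrightarrow> y \<in> carrier L \<Longrightarrow> z \<in> carrier L \<Longrightarrow>
      (x \<otimes> y) \<otimes> z \<oplus> (y \<otimes> z) \<otimes> x \<oplus> (z \<otimes> x) \<otimes> y = \<zero>"

definition alg_ideal :: "('k::field_char_0, 'a) module \<Rightarrow> 'a set \<Rightarrow> bool" where
  "alg_ideal L I \<longleftrightarrow> LinearCombinations.submodule class_ring I L \<and>
     (\<forall>x\<in>I. \<forall>y\<in>carrier L. x \<otimes>\<^bsub>L\<^esub> y \<in> I \<and> y \<otimes>\<^bsub>L\<^esub> x \<in> I)"

definition gen_ideal :: "('k::field_char_0, 'a) module \<Rightarrow> 'a set \<Rightarrow> 'a set" where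
  "gen_ideal L S = \<Inter> {I. alg_ideal L I \<and> S \<subseteq> I}"

text \<open>The analogue of \<^const>\<open>FactRing\<close> for algebras: the elements are the cosets of \<open>I\<close>.\<close>

definition quot_alg :: "('k::field_char_0, 'a) module \<Rightarrow> 'a set \<Rightarrow> ('k, 'a set) module" where
  "quot_alg L I = \<lparr>carrier = a_rcosets\<^bsub>L\<^esub> I, mult = rcoset_mult L I, one = I, zero = I,
     add = set_add L, smult = (\<lambda>c X. \<Union>x\<in>X. I +>\<^bsub>L\<^esub> (c \<odot>\<^bsub>L\<^esub> x))\<rparr>"

text \<open>\<open>lower_central L n\<close> is the term $L^{n+1}$ of the lower central series, where $L^1 = L$.\<close>

primrec lower_central :: "('k::field_char_0, 'a) module \<Rightarrow> nat \<Rightarrow> 'a set" where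
  "lower_central L 0 = carrier L"
| "lower_central L (Suc n) =
     vs_span L {x \<otimes>\<^bsub>L\<^esub> y | x y. x \<in> lower_central L n \<and> y \<in> carrier L}"

section \<open>Exterior forms\<close>

text \<open>
  In characteristic zero $\Lambda^p L^*$ is identified with the alternating $p$-linear forms on \<open>L\<close>
  by $(\alpha \wedge \beta)(x,y) = \alpha(x)\beta(y) - \alpha(y)\beta(x)$. A form is a function on
  lists of arguments; a $p$-form is zero on lists of length other than $p$, and all forms are zero
  when an argument is not in the carrier. The product is the sum over all shuffles: \<open>S\<close> is the set
  of positions whose arguments go to the first factor.
\<close>

type_synonym ('k, 'a) form = "'a list \<Rightarrow> 'k"

definition shuffle_sign :: "nat \<Rightarrow> nat set \<Rightarrow> 'k::field_char_0" where
  "shuffle_sign n S = (- 1) ^ card {(i, j). i < j \<and> j < n \<and> i \<notin> S \<and> j \<in> S}"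

definition wedge :: "('k::field_char_0, 'a) form \<Rightarrow> ('k, 'a) form \<Rightarrow> ('k, 'a) form"
    (infixl "\<and>\<^sub>f" 70) where
  "(\<phi> \<and>\<^sub>f \<psi>) xs = (\<Sum>S\<in>Pow {..<length xs}.
     shuffle_sign (length xs) S * \<phi> (nths xs S) * \<psi> (nths xs (- S)))"

primrec wedge_power :: "('k::field_char_0, 'a) form \<Rightarrow> nat \<Rightarrow> ('k, 'a) form" where
  "wedge_power \<omega> 0 = (\<lambda>xs. if xs = [] then 1 else 0)"
| "wedge_power \<omega> (Suc n) = \<omega> \<and>\<^sub>f wedge_power \<omega> n"

definition dual_space :: "('k::field_char_0, 'a) module \<Rightarrow> ('a \<Rightarrow> 'k) set" where
  "dual_space L = {\<alpha>. (\<forall>x\<in>carrier L. \<forall>y\<in>carrier L. \<alpha> (x \<oplus>\<^bsub>L\<^esub> y) = \<alpha> x + \<alpha> y) \<and>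
     (\<forall>c. \<forall>x\<in>carrier L. \<alpha> (c \<odot>\<^bsub>L\<^esub> x) = c * \<alpha> x) \<and> (\<forall>x. x \<notin> carrier L \<longrightarrow> \<alpha> x = 0)}"

definition form1 :: "('a \<Rightarrow> 'k::field_char_0) \<Rightarrow> ('k, 'a) form" where
  "form1 \<alpha> xs = (case xs of [x] \<Rightarrow> \<alpha> x | _ \<Rightarrow> 0)"

text \<open>The map $d: L^* \to \Lambda^2 L^*$ dual to the bracket: $(d\alpha)(x,y) = \alpha([x,y])$.\<close>

definition d1 :: "('k::field_char_0, 'a) module \<Rightarrow> ('a \<Rightarrow> 'k) \<Rightarrow> ('k, 'a) form" where
  "d1 L \<alpha> xs = (case xs of
     [x, y] \<Rightarrow> if x \<in> carrier L \<and> y \<in> carrier L then \<alpha> (x \<otimes>\<^bsub>L\<^esub> y) else 0 | _ \<Rightarrow> 0)"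

text \<open>
  \<open>d2_rel L \<omega> \<eta>\<close> says that \<open>\<omega>\<close> is a finite sum $\sum_i \alpha_i \wedge \beta_i$, and that \<open>\<eta>\<close> is the
  corresponding sum of the $d\alpha_i \wedge \beta_i - \alpha_i \wedge d\beta_i$. It is the graph of
  the linear map $d: \Lambda^2 L^* \to \Lambda^3 L^*$; that it is single-valued is proved below.
\<close>

inductive d2_rel :: "('k::field_char_0, 'a) module \<Rightarrow> ('k, 'a) form \<Rightarrow> ('k, 'a) form \<Rightarrow> bool"
  for L where
  zero: "d2_rel L (\<lambda>_. 0) (\<lambda>_. 0)"
| add: "d2_rel L \<omega> \<eta> \<Longrightarrow> \<alpha> \<in> dual_space L \<Longrightarrow> \<beta> \<in> dual_space L \<Longrightarrow>
    d2_rel L (\<lambda>xs. \<omega> xs + (form1 \<alpha> \<and>\<^sub>f form1 \<beta>) xs)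
      (\<lambda>xs. \<eta> xs + ((d1 L \<alpha> \<and>\<^sub>f form1 \<beta>) xs - (form1 \<alpha> \<and>\<^sub>f d1 L \<beta>) xs))"

definition two_forms :: "('k::field_char_0, 'a) module \<Rightarrow> ('k, 'a) form set" where
  "two_forms L = {\<omega>. \<exists>\<eta>. d2_rel L \<omega> \<eta>}"

definition d2 :: "('k::field_char_0, 'a) module \<Rightarrow> ('k, 'a) form \<Rightarrow> ('k, 'a) form" where
  "d2 L \<omega> = (THE \<eta>. d2_rel L \<omega> \<eta>)"

definition symplectic_form :: "('k::field_char_0, 'a) module \<Rightarrow> ('k, 'a) form \<Rightarrow> bool" where
  "symplectic_form L \<omega> \<longleftrightarrow> lie_algebra L \<and> vectorspace.fin_dim class_ring L \<and>
     \<omega> \<in> two_forms L \<and> d2 L \<omega> = (\<lambda>_. 0) \<and>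
     (\<exists>n. vectorspace.dim class_ring L = 2 * n \<and> wedge_power \<omega> n \<noteq> (\<lambda>_. 0))"

definition symplectic :: "('k::field_char_0, 'a) module \<Rightarrow> bool" where
  "symplectic L \<longleftrightarrow> (\<exists>\<omega>. symplectic_form L \<omega>)"

definition dual_basis_elem ::
    "('k::field_char_0, 'a) module \<Rightarrow> 'a set \<Rightarrow> 'a \<Rightarrow> ('a \<Rightarrow> 'k)" where
  "dual_basis_elem L B b =
     (THE \<alpha>. \<alpha> \<in> dual_space L \<and> (\<forall>b'\<in>B. \<alpha> b' = (if b' = b then 1 else 0)))"

lemma wedge_length_neq:
  assumes "\<And>ys. length ys \<noteq> p \<Longrightarrow> \<phi> ys = 0" "\<And>ys. length ys \<noteq> q \<Longrightarrow> \<psi> ys = 0"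
    and "length xs \<noteq> p + q"
  shows "(\<phi> \<and>\<^sub>f \<psi>) xs = 0"
  unfolding wedge_def
proof (rule sum.neutral, intro ballI)
  fix S assume "S \<in> Pow {..<length xs}"
  have "{i. i < length xs \<and> i \<in> S} \<union> {i. i < length xs \<and> i \<in> - S} = {..<length xs}" by auto
  then have "card {i. i < length xs \<and> i \<in> S} + card {i. i < length xs \<and> i \<in> - S} = length xs"
    by (subst card_Un_disjoint[symmetric]) auto
  then have "length (nths xs S) + length (nths xs (- S)) = length xs"
    by (simp add: length_nths)
  then show "shuffle_sign (length xs) S * \<phi> (nths xs S) * \<psi> (nths xs (- S)) = 0"
    using assms by (metis mult_eq_0_iff)
qed

lemma form1_length_neq: "length xs \<noteq> 1 \<Longrightarrow> form1 \<alpha> xs = 0"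
  by (auto simp: form1_def split: list.split)

lemma d1_length_neq: "length xs \<noteq> 2 \<Longrightarrow> d1 L \<alpha> xs = 0"
  by (auto simp: d1_def split: list.split)

lemma sum_Pow_insert:
  assumes "finite A" "a \<notin> A"
  shows "(\<Sum>S\<in>Pow (insert a A). f S) = (\<Sum>S\<in>Pow A. f S + f (insert a S) :: 'k::comm_monoid_add)"
proof -
  have "inj_on (insert a) (Pow A)"
    using assms(2) by (auto simp: inj_on_def)
  moreover have "Pow A \<inter> insert a ` Pow A = {}"
    using assms(2) by auto
  ultimately show ?thesis
    using assms(1) by (simp add: Pow_insert sum.union_disjoint sum.reindex sum.distrib)
qed

lemma card_inversions_3:
  "card {(i, j). i < j \<and> j < Suc (Suc (Suc 0)) \<and> i \<notin> S \<and> j \<in> S} =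
     (if 0 \<notin> S \<and> Suc 0 \<in> S then 1 else 0) + (if 0 \<notin> S \<and> Suc (Suc 0) \<in> S then 1 else 0) +
     (if Suc 0 \<notin> S \<and> Suc (Suc 0) \<in> S then 1 else 0)"
proof -
  have "{(i, j). i < j \<and> j < Suc (Suc (Suc 0)) \<and> i \<notin> S \<and> j \<in> S} =
      (if 0 \<notin> S \<and> Suc 0 \<in> S then {(0, Suc 0)} else {}) \<union>
      ((if 0 \<notin> S \<and> Suc (Suc 0) \<in> S then {(0, Suc (Suc 0))} else {}) \<union>
      (if Suc 0 \<notin> S \<and> Suc (Suc 0) \<in> S then {(Suc 0, Suc (Suc 0))} else {}))"
    by (auto simp: less_Suc_eq)
  then show ?thesis by (simp only:) simp
qed

lemma wedge_form1:
  "(form1 \<alpha> \<and>\<^sub>f form1 \<beta>) [x, y] = \<alpha> x * \<beta> y - \<alpha> y * \<beta> x"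
proof -
  have 1: "{(i, j). i < j \<and> j < Suc (Suc 0) \<and> i \<notin> S \<and> j \<in> S} =
      (if 0 \<notin> S \<and> Suc 0 \<in> S then {(0, Suc 0)} else {})" for S :: "nat set"
    by (auto simp: less_Suc_eq)
  show ?thesis
    unfolding wedge_def shuffle_sign_def
    by (simp add: 1 lessThan_Suc sum_Pow_insert nths_Cons form1_def)
qed

lemma wedge_three:
  "(\<phi> \<and>\<^sub>f \<psi>) [x, y, z] =
    \<phi> [x, y, z] * \<psi> [] + \<phi> [x, y] * \<psi> [z] - \<phi> [x, z] * \<psi> [y] + \<phi> [y, z] * \<psi> [x] +
    \<phi> [x] * \<psi> [y, z] - \<phi> [y] * \<psi> [x, z] + \<phi> [z] * \<psi> [x, y] + \<phi> [] * \<psi> [x, y, z]"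
  unfolding wedge_def shuffle_sign_def
  by (simp add: card_inversions_3 lessThan_Suc sum_Pow_insert nths_Cons)

lemma d2_rel_formula:
  "d2_rel L \<omega> \<eta> \<Longrightarrow> \<eta> = (\<lambda>xs. case xs of
     [x, y, z] \<Rightarrow> if x \<in> carrier L \<and> y \<in> carrier L \<and> z \<in> carrier L
       then \<omega> [x \<otimes>\<^bsub>L\<^esub> y, z] - \<omega> [x \<otimes>\<^bsub>L\<^esub> z, y] + \<omega> [y \<otimes>\<^bsub>L\<^esub> z, x] else 0 | _ \<Rightarrow> 0)"
proof (induction rule: d2_rel.induct)
  case zero
  then show ?case by (auto simp: fun_eq_iff split: list.split)
next
  case (add \<omega> \<eta> \<alpha> \<beta>)
  show ?case
  proof
    fix xs
    show "\<eta> xs + ((d1 L \<alpha> \<and>\<^sub>f form1 \<beta>) xs - (form1 \<alpha> \<and>\<^sub>f d1 L \<beta>) xs) = (case xs of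
      [x, y, z] \<Rightarrow> if x \<in> carrier L \<and> y \<in> carrier L \<and> z \<in> carrier L
        then (\<omega> [x \<otimes>\<^bsub>L\<^esub> y, z] + (form1 \<alpha> \<and>\<^sub>f form1 \<beta>) [x \<otimes>\<^bsub>L\<^esub> y, z])
          - (\<omega> [x \<otimes>\<^bsub>L\<^esub> z, y] + (form1 \<alpha> \<and>\<^sub>f form1 \<beta>) [x \<otimes>\<^bsub>L\<^esub> z, y])
          + (\<omega> [y \<otimes>\<^bsub>L\<^esub> z, x] + (form1 \<alpha> \<and>\<^sub>f form1 \<beta>) [y \<otimes>\<^bsub>L\<^esub> z, x]) else 0 | _ \<Rightarrow> 0)"
    proof (cases "length xs = 3")
      case True
      then obtain x y z where xs: "xs = [x, y, z]"
        by (auto simp: numeral_3_eq_3 length_Suc_conv)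
      have "\<alpha> u = 0 \<and> \<beta> u = 0" if "u \<notin> carrier L" for u
        using that add.hyps by (simp add: dual_space_def)
      then show ?thesis
        unfolding xs add.IH
        by (simp add: wedge_three wedge_form1 form1_def d1_def algebra_simps)
    next
      case False
      then have "\<eta> xs = 0"
        unfolding add.IH by (auto split: list.split)
      moreover have "(d1 L \<alpha> \<and>\<^sub>f form1 \<beta>) xs = 0"
        using False by (intro wedge_length_neq[where p = 2 and q = 1])
          (auto simp: form1_length_neq d1_length_neq)
      moreover have "(form1 \<alpha> \<and>\<^sub>f d1 L \<beta>) xs = 0"
        using False by (intro wedge_length_neq[where p = 1 and q = 2])
          (auto simp: form1_length_neq d1_length_neq)
      ultimately show ?thesis
        using False by (auto split: list.split)
    qed
  qed
qed

lemma d2_eqI: "d2_rel L \<omega> \<eta> \<Longrightarrow> d2 L \<omega> = \<eta>"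
  unfolding d2_def by (rule the_equality) (auto dest: d2_rel_formula)

section \<open>Free nilpotent Lie algebras\<close>

text \<open>
  The free nonassociative algebra on \<open>V\<close> has as a basis the bracketings with letters in \<open>V\<close>; the
  free Lie algebra is its quotient by the ideal of the Lie identities.
\<close>

datatype 'v bracketing = Letter 'v | Brack "'v bracketing" "'v bracketing"

primrec letters :: "'v bracketing \<Rightarrow> 'v multiset" where
  "letters (Letter v) = {#v#}"
| "letters (Brack s t) = letters s + letters t"

definition free_nonassoc :: "'v set \<Rightarrow> ('k::field_char_0, 'v bracketing \<Rightarrow> 'k) module" where
  "free_nonassoc V = \<lparr>
     carrier = {f. finite {t. f t \<noteq> 0} \<and> (\<forall>t. f t \<noteq> 0 \<longrightarrow> set_mset (letters t) \<subseteq> V)},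
     mult = (\<lambda>f g t. case t of Letter v \<Rightarrow> 0 | Brack s u \<Rightarrow> f s * g u),
     one = (\<lambda>t. 0), zero = (\<lambda>t. 0), add = (\<lambda>f g t. f t + g t), smult = (\<lambda>c f t. c * f t)\<rparr>"

definition lie_identities :: "('k::field_char_0, 'a) module \<Rightarrow> 'a set" where
  "lie_identities A = {x \<otimes>\<^bsub>A\<^esub> x | x. x \<in> carrier A} \<union>
     {(x \<otimes>\<^bsub>A\<^esub> y) \<otimes>\<^bsub>A\<^esub> z \<oplus>\<^bsub>A\<^esub> (y \<otimes>\<^bsub>A\<^esub> z) \<otimes>\<^bsub>A\<^esub> x \<oplus>\<^bsub>A\<^esub> (z \<otimes>\<^bsub>A\<^esub> x) \<otimes>\<^bsub>A\<^esub> y | x y z.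
       x \<in> carrier A \<and> y \<in> carrier A \<and> z \<in> carrier A}"

definition free_lie :: "'v set \<Rightarrow> ('k::field_char_0, ('v bracketing \<Rightarrow> 'k) set) module" where
  "free_lie V = quot_alg (free_nonassoc V) (gen_ideal (free_nonassoc V) (lie_identities (free_nonassoc V)))"

definition free_lie_gen :: "'v set \<Rightarrow> 'v \<Rightarrow> ('v bracketing \<Rightarrow> 'k::field_char_0) set" where
  "free_lie_gen V v = gen_ideal (free_nonassoc V) (lie_identities (free_nonassoc V))
     +>\<^bsub>free_nonassoc V :: ('k, _) module\<^esub> (\<lambda>t. if t = Letter v then 1 else 0)"

definition free_nilp ::
    "nat \<Rightarrow> 'v set \<Rightarrow> ('k::field_char_0, ('v bracketing \<Rightarrow> 'k) set set) module" where
  "free_nilp k V = quot_alg (free_lie V) (lower_central (free_lie V) k)"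

definition free_nilp_gen ::
    "nat \<Rightarrow> 'v set \<Rightarrow> 'v \<Rightarrow> ('v bracketing \<Rightarrow> 'k::field_char_0) set set" where
  "free_nilp_gen k V v =
     lower_central (free_lie V) k +>\<^bsub>free_lie V :: ('k, _) module\<^esub> free_lie_gen V v"

section \<open>The Lie algebra of a chain digraph\<close>

text \<open>
  \<open>graph_lie k G\<close> is $\mathfrak g(k, G)$, and \<open>chain_lie \<kappa> G\<close> is $\mathfrak g(\kappa, G)$. Both are
  quotients by cosets; \<open>graph_lie_gen\<close> and \<open>chain_gen\<close> give the images of the vertices.
\<close>

definition chain_digraph :: "('v \<times> 'v \<Rightarrow> nat) \<Rightarrow> 'v pair_pre_digraph \<Rightarrow> bool" where
  "chain_digraph \<kappa> G \<longleftrightarrow> pair_fin_digraph G \<and>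
     (\<forall>u v. (u, v) \<in> parcs G \<longrightarrow> (v, u) \<notin> parcs G) \<and> (\<forall>e\<in>parcs G. 2 \<le> \<kappa> e)"

text \<open>
  The underlying undirected graph of \<open>G\<close> is connected and has no cycle. The cycles of length 2 of
  the symmetric digraph \<^term>\<open>mk_symmetric G\<close> run through one edge back and forth and do not count.
  The predicate \<^const>\<open>tree\<close> of the library is not suitable, since it only forbids directed cycles.
\<close>

definition undirected_tree :: "'v pair_pre_digraph \<Rightarrow> bool" where
  "undirected_tree G \<longleftrightarrow> Digraph_Component.connected (with_proj G) \<and>
     (\<forall>p. pre_digraph.cycle (with_proj (mk_symmetric (with_proj G))) p \<longrightarrow> length p \<le> 2)"

definition directed_to_root :: "'v pair_pre_digraph \<Rightarrow> 'v \<Rightarrow> bool" where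
  "directed_to_root G r \<longleftrightarrow> r \<in> pverts G \<and> undirected_tree G \<and>
     (\<forall>u\<in>pverts G. u \<noteq> r \<longrightarrow> u \<rightarrow>\<^sup>*\<^bsub>with_proj G\<^esub> r)"

definition almost_even :: "('v \<times> 'v \<Rightarrow> nat) \<Rightarrow> 'v pair_pre_digraph \<Rightarrow> 'v \<Rightarrow> bool" where
  "almost_even \<kappa> G r \<longleftrightarrow>
     (\<exists>e\<in>parcs G. odd (\<kappa> e) \<and> snd e = r \<and> (\<forall>e'\<in>parcs G. e' \<noteq> e \<longrightarrow> even (\<kappa> e')))"

definition family_F3 :: "('v \<times> 'v \<Rightarrow> nat) \<Rightarrow> 'v pair_pre_digraph \<Rightarrow> bool" where
  "family_F3 \<kappa> G \<longleftrightarrow> chain_digraph \<kappa> G \<and> (\<exists>r. directed_to_root G r \<and> almost_even \<kappa> G r)"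

definition nonadjacent_brackets ::
    "nat \<Rightarrow> 'v pair_pre_digraph \<Rightarrow> ('v bracketing \<Rightarrow> 'k::field_char_0) set set set" where
  "nonadjacent_brackets k G =
     {free_nilp_gen k (pverts G) u \<otimes>\<^bsub>free_nilp k (pverts G) :: ('k, _) module\<^esub> free_nilp_gen k (pverts G) v
       | u v. u \<in> pverts G \<and> v \<in> pverts G \<and> (u, v) \<notin> parcs G \<and> (v, u) \<notin> parcs G}"

definition graph_lie :: "nat \<Rightarrow> 'v pair_pre_digraph \<Rightarrow>
    ('k::field_char_0, ('v bracketing \<Rightarrow> 'k) set set set) module" where
  "graph_lie k G = quot_alg (free_nilp k (pverts G))
     (gen_ideal (free_nilp k (pverts G)) (nonadjacent_brackets k G))"

definition graph_lie_gen :: "nat \<Rightarrow> 'v pair_pre_digraph \<Rightarrow> 'v \<Rightarrow>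
    ('v bracketing \<Rightarrow> 'k::field_char_0) set set set" where
  "graph_lie_gen k G v = gen_ideal (free_nilp k (pverts G)) (nonadjacent_brackets k G)
     +>\<^bsub>free_nilp k (pverts G) :: ('k, _) module\<^esub> free_nilp_gen k (pverts G) v"

primrec eval_bracketing :: "('k::field_char_0, 'a) module \<Rightarrow> ('v \<Rightarrow> 'a) \<Rightarrow> 'v bracketing \<Rightarrow> 'a" where
  "eval_bracketing L \<gamma> (Letter v) = \<gamma> v"
| "eval_bracketing L \<gamma> (Brack s t) = eval_bracketing L \<gamma> s \<otimes>\<^bsub>L\<^esub> eval_bracketing L \<gamma> t"

text \<open>
  Multidegrees are multisets of vertices. The component of multidegree \<open>D\<close> is spanned by the
  iterated brackets of the vertices with the multiset of letters \<open>D\<close>.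
\<close>

definition multihom :: "nat \<Rightarrow> 'v pair_pre_digraph \<Rightarrow> 'v multiset \<Rightarrow>
    ('v bracketing \<Rightarrow> 'k::field_char_0) set set set set" where
  "multihom k G D = vs_span (graph_lie k G) {eval_bracketing (graph_lie k G) (graph_lie_gen k G) t | t.
     set_mset (letters t) \<subseteq> pverts G \<and> letters t = D}"

definition total_degree_part :: "nat \<Rightarrow> 'v pair_pre_digraph \<Rightarrow> nat \<Rightarrow>
    ('v bracketing \<Rightarrow> 'k::field_char_0) set set set set" where
  "total_degree_part k G d =
     vs_span (graph_lie k G) (\<Union>D\<in>{D. set_mset D \<subseteq> pverts G \<and> size D = d}. multihom k G D)"

definition edge_ideal :: "nat \<Rightarrow> 'v pair_pre_digraph \<Rightarrow> nat \<Rightarrow> 'v \<Rightarrow> 'v \<Rightarrow>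
    ('v bracketing \<Rightarrow> 'k::field_char_0) set set set set" where
  "edge_ideal k G c i j = vs_span (graph_lie k G)
     (\<Union>D\<in>{D. set_mset D \<subseteq> pverts G \<and>
            D \<notin> {{#j#}} \<union> {{#i#} + replicate_mset (l - 1) j | l. 1 \<le> l \<and> l \<le> c}}. multihom k G D)"

definition max_chain :: "('v \<times> 'v \<Rightarrow> nat) \<Rightarrow> 'v pair_pre_digraph \<Rightarrow> nat" where
  "max_chain \<kappa> G = Max (\<kappa> ` parcs G)"

definition chain_ideal :: "('v \<times> 'v \<Rightarrow> nat) \<Rightarrow> 'v pair_pre_digraph \<Rightarrow>
    ('v bracketing \<Rightarrow> 'k::field_char_0) set set set set" where
  "chain_ideal \<kappa> G = (let k = max_chain \<kappa> G in
     (\<Inter>(i, j)\<in>parcs G. edge_ideal k G (\<kappa> (i, j)) i j) \<inter>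
     vs_span (graph_lie k G) (\<Union>d\<in>{3..k}. total_degree_part k G d))"

definition chain_lie :: "('v \<times> 'v \<Rightarrow> nat) \<Rightarrow> 'v pair_pre_digraph \<Rightarrow>
    ('k::field_char_0, ('v bracketing \<Rightarrow> 'k) set set set set) module" where
  "chain_lie \<kappa> G = quot_alg (graph_lie (max_chain \<kappa> G) G) (chain_ideal \<kappa> G)"

definition chain_gen :: "('v \<times> 'v \<Rightarrow> nat) \<Rightarrow> 'v pair_pre_digraph \<Rightarrow> 'v \<Rightarrow>
    ('v bracketing \<Rightarrow> 'k::field_char_0) set set set set" where
  "chain_gen \<kappa> G v = chain_ideal \<kappa> G
     +>\<^bsub>graph_lie (max_chain \<kappa> G) G :: ('k, _) module\<^esub> graph_lie_gen (max_chain \<kappa> G) G v"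

text \<open>The elements $w_{i,j}^l$ for \<open>l \<ge> 1\<close>; the value at \<open>l = 0\<close> is not used.\<close>

fun chain_w :: "('v \<times> 'v \<Rightarrow> nat) \<Rightarrow> 'v pair_pre_digraph \<Rightarrow> 'v \<times> 'v \<Rightarrow> nat \<Rightarrow>
    ('v bracketing \<Rightarrow> 'k::field_char_0) set set set set" where
  "chain_w \<kappa> G (i, j) 0 = \<zero>\<^bsub>chain_lie \<kappa> G :: ('k, _) module\<^esub>"
| "chain_w \<kappa> G (i, j) (Suc 0) = chain_gen \<kappa> G i"
| "chain_w \<kappa> G (i, j) (Suc (Suc l)) =
     chain_w \<kappa> G (i, j) (Suc l) \<otimes>\<^bsub>chain_lie \<kappa> G :: ('k, _) module\<^esub> chain_gen \<kappa> G j"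

definition std_basis :: "('v \<times> 'v \<Rightarrow> nat) \<Rightarrow> 'v pair_pre_digraph \<Rightarrow>
    ('v bracketing \<Rightarrow> 'k::field_char_0) set set set set set" where
  "std_basis \<kappa> G = chain_gen \<kappa> G ` pverts G \<union>
     {chain_w \<kappa> G e l | e l. e \<in> parcs G \<and> 2 \<le> l \<and> l \<le> \<kappa> e}"

definition std_dual :: "('v \<times> 'v \<Rightarrow> nat) \<Rightarrow> 'v pair_pre_digraph \<Rightarrow>
    ('v bracketing \<Rightarrow> 'k) set set set set \<Rightarrow>
    ('k::field_char_0, ('v bracketing \<Rightarrow> 'k) set set set set) form" where
  "std_dual \<kappa> G x = form1 (dual_basis_elem (chain_lie \<kappa> G) (std_basis \<kappa> G) x)"

definition alternating_chain :: "('v \<times> 'v \<Rightarrow> nat) \<Rightarrow> 'v pair_pre_digraph \<Rightarrow> 'v \<times> 'v \<Rightarrow> nat \<Rightarrow>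
    ('k::field_char_0, ('v bracketing \<Rightarrow> 'k) set set set set) form" where
  "alternating_chain \<kappa> G e n xs = (\<Sum>l = 1..n div 2. (- 1) ^ (l + 1) *
     (std_dual \<kappa> G (chain_w \<kappa> G e l) \<and>\<^sub>f std_dual \<kappa> G (chain_w \<kappa> G e (n + 1 - l))) xs)"

definition sigma_edge :: "('v \<times> 'v \<Rightarrow> nat) \<Rightarrow> 'v pair_pre_digraph \<Rightarrow> 'v \<times> 'v \<Rightarrow>
    ('k::field_char_0, ('v bracketing \<Rightarrow> 'k) set set set set) form" where
  "sigma_edge \<kappa> G e xs = (if even (\<kappa> e) then alternating_chain \<kappa> G e (\<kappa> e) xs
     else (std_dual \<kappa> G (chain_gen \<kappa> G (snd e)) \<and>\<^sub>f std_dual \<kappa> G (chain_w \<kappa> G e (\<kappa> e))) xs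
       + alternating_chain \<kappa> G e (\<kappa> e - 1) xs)"

definition sigma_form :: "('v \<times> 'v \<Rightarrow> nat) \<Rightarrow> 'v pair_pre_digraph \<Rightarrow>
    ('k::field_char_0, ('v bracketing \<Rightarrow> 'k) set set set set) form" where
  "sigma_form \<kappa> G xs = (\<Sum>e\<in>parcs G. sigma_edge \<kappa> G e xs)"

end

theory Submission
  imports Defs
begin

text \<open>
  The proof attaches to every edge \<open>e\<close> $= (v_i, v_j)$ the small Lie algebra \<open>chain_model (\<kappa> e)\<close>
  with basis $v_j, w^1, \dots, w^{\kappa_{i,j}}$ and brackets $[w^l, v_j] = w^{l+1}$. Sending $v_i$ to
  $w^1$, $v_j$ to itself and all other vertices to zero respects the relations of
  $\mathfrak g(k, G)$, since the only noncommuting images belong to adjacent vertices and the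
  nilpotency step $\kappa_{i,j}$ is at most $k$. So it extends to a homomorphism $\Phi_e$ on
  $\mathfrak g(k, G)$ (\<open>graph_lie_chain_hom\<close>).

  These homomorphisms determine $\mathfrak g(\kappa, G)$. Each $\Phi_e$ respects multidegrees, so it
  kills $I_{i,j}^{\kappa_{i,j}}$ and hence $I_\kappa$. Conversely, a bracketing in multidegree
  $e_i + (l - 1) e_j$ is a multiple of $w_{i,j}^l$ in every Lie algebra, and therefore
  $\mathfrak g(k, G)$ is spanned by the standard elements and a part of $I_\kappa$
  (\<open>bracketing_decomposition\<close>). As the coordinates of the $\Phi_e$ are dual to the standard
  elements, $I_\kappa$ is the joint kernel of the $\Phi_e$ (\<open>chain_ideal_eq\<close>), and the standard
  elements form a basis of the quotient whose dual basis consists of the coordinates of the induced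
  maps, again called $\Phi_e$ (\<open>chain_lie_dual_basis\<close>, \<open>std_basis_eq\<close>). In a tree that is directed to
  the root, each vertex but the root has exactly one outgoing edge and the root has none
  (\<open>unique_exit\<close>, \<open>root_no_exit\<close>), because an edge of a tree is a bridge. So this basis is the
  disjoint union of the root and of one chain $w_e^1, \dots, w_e^{\kappa(e)}$ for each edge $e$.

  The form $\sigma_e$ is the pullback along $\Phi_e$ of a 2-form on the chain model, which is closed by
  a short computation: the alternating signs make it skew-adjoint for the shift
  $w^l \mapsto w^{l+1}$ (\<open>alternating_pairing_closed\<close>, \<open>edge_pairing_closed\<close>). Hence
  $\sigma_G$ is closed, and no interaction between different edges has to be examined.

  For nondegeneracy, $\sigma_G$ pairs the standard basis off: $w_e^l$ with $w_e^{\kappa(e)+1-l}$ on an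
  even edge, $w_e^l$ with $w_e^{\kappa(e)-l}$ on the odd edge, and the element $w_e^{\kappa(e)}$ that remains
  there with the root. All values on pairs are $\pm 1$ and all other values vanish, so the top power
  on the list of all basis vectors is $\pm n!$ (\<open>wedge_power_pairs\<close>, \<open>total_form_symplectic\<close>).
\<close>

(* Otherwise this symbol is ambiguous between addition in a ring and the join of vertex walks. *)
no_notation vwalk_join (infixr \<open>\<oplus>\<close> 65)

section \<open>Algebras with a bilinear bracket\<close>

text \<open>
  The Lie axioms without antisymmetry and the Jacobi identity. The free nonassociative algebra, from
  which all the algebras below are obtained by quotients, satisfies only these, so the theory of
  ideals, quotients and homomorphisms is developed at this level.
\<close>

locale bilinear_algebra = vectorspace class_ring L
  for L :: "('k::field_char_0, 'a) module" (structure) +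
  assumes bracket_closed: "x \<in> carrier L \<Longrightarrow> y \<in> carrier L \<Longrightarrow> x \<otimes> y \<in> carrier L"
    and bracket_add_left: "x \<in> carrier L \<Longrightarrow> y \<in> carrier L \<Longrightarrow> z \<in> carrier L \<Longrightarrow>
      (x \<oplus> y) \<otimes> z = x \<otimes> z \<oplus> y \<otimes> z"
    and bracket_add_right: "x \<in> carrier L \<Longrightarrow> y \<in> carrier L \<Longrightarrow> z \<in> carrier L \<Longrightarrow>
      z \<otimes> (x \<oplus> y) = z \<otimes> x \<oplus> z \<otimes> y"
    and bracket_smult_left: "x \<in> carrier L \<Longrightarrow> y \<in> carrier L \<Longrightarrow>
      (c \<odot>\<^bsub>L\<^esub> x) \<otimes> y = c \<odot>\<^bsub>L\<^esub> (x \<otimes> y)"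
    and bracket_smult_right: "x \<in> carrier L \<Longrightarrow> y \<in> carrier L \<Longrightarrow>
      x \<otimes> (c \<odot>\<^bsub>L\<^esub> y) = c \<odot>\<^bsub>L\<^esub> (x \<otimes> y)"
begin

lemma scale_closed: "x \<in> carrier L \<Longrightarrow> c \<odot>\<^bsub>L\<^esub> x \<in> carrier L"
  using smult_closed[of c x] by simp

lemma scale_zero: "x \<in> carrier L \<Longrightarrow> 0 \<odot>\<^bsub>L\<^esub> x = \<zero>"
  using smult_l_null[of x] by simp

lemma scale_one: "x \<in> carrier L \<Longrightarrow> 1 \<odot>\<^bsub>L\<^esub> x = x"
  using smult_one[of x] by simp

lemma scale_zero_right: "c \<odot>\<^bsub>L\<^esub> \<zero> = \<zero>"
  using smult_r_null[of c] by simp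

lemma scale_scale: "x \<in> carrier L \<Longrightarrow> a \<odot>\<^bsub>L\<^esub> (b \<odot>\<^bsub>L\<^esub> x) = (a * b) \<odot>\<^bsub>L\<^esub> x"
  using smult_assoc1[of a b x] by simp

lemma scale_add_left: "x \<in> carrier L \<Longrightarrow> (a + b) \<odot>\<^bsub>L\<^esub> x = a \<odot>\<^bsub>L\<^esub> x \<oplus> b \<odot>\<^bsub>L\<^esub> x"
  using smult_l_distr[of a b x] by simp

lemma scale_add_right:
  "x \<in> carrier L \<Longrightarrow> y \<in> carrier L \<Longrightarrow> a \<odot>\<^bsub>L\<^esub> (x \<oplus> y) = a \<odot>\<^bsub>L\<^esub> x \<oplus> a \<odot>\<^bsub>L\<^esub> y"
  using smult_r_distr[of a x y] by simp

lemma scale_minus_one: "x \<in> carrier L \<Longrightarrow> (- 1) \<odot>\<^bsub>L\<^esub> x = \<ominus> x"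
  using smult_minus_1[of x] by (simp add: class_ring_simps)

lemma bracket_zero_left: "y \<in> carrier L \<Longrightarrow> \<zero> \<otimes> y = \<zero>"
  using bracket_smult_left[of \<zero> y 0] by (simp add: bracket_closed scale_zero)

lemma bracket_zero_right: "y \<in> carrier L \<Longrightarrow> y \<otimes> \<zero> = \<zero>"
  using bracket_smult_right[of y \<zero> 0] by (simp add: bracket_closed scale_zero)

lemma submodule_classI:
  assumes "N \<subseteq> carrier L" "\<zero> \<in> N" "\<And>x y. x \<in> N \<Longrightarrow> y \<in> N \<Longrightarrow> x \<oplus> y \<in> N"
    "\<And>c x. x \<in> N \<Longrightarrow> c \<odot>\<^bsub>L\<^esub> x \<in> N"
  shows "LinearCombinations.submodule class_ring N L"
  using assms by unfold_locales auto

lemma submodule_carrier: "LinearCombinations.submodule class_ring (carrier L) L"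
  by (rule submodule_classI) (auto intro: scale_closed)

lemma span_minimal:
  assumes "LinearCombinations.submodule class_ring N L" "S \<subseteq> N"
  shows "vs_span L S \<subseteq> N"
  using span_is_subset assms by blast

lemma span_induct:
  assumes "x \<in> vs_span L S" "LinearCombinations.submodule class_ring N L" "S \<subseteq> N"
  shows "x \<in> N"
  using span_minimal assms by blast

lemma eval_closed:
  assumes "\<And>v. v \<in># letters t \<Longrightarrow> \<gamma> v \<in> carrier L"
  shows "eval_bracketing L \<gamma> t \<in> carrier L"
  using assms by (induction t) (auto intro: bracket_closed)

end

sublocale lie_algebra \<subseteq> bilinear_algebra
  by unfold_locales (fact bracket_closed bracket_add_left bracket_add_right
    bracket_smult_left bracket_smult_right)+

context lie_algebra
begin

lemma bracket_anticomm:
  assumes x: "x \<in> carrier L" and y: "y \<in> carrier L"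
  shows "y \<otimes> x = (- 1) \<odot>\<^bsub>L\<^esub> (x \<otimes> y)"
proof -
  have c: "x \<otimes> y \<in> carrier L" "y \<otimes> x \<in> carrier L"
    using x y by (auto intro: bracket_closed)
  have "\<zero> = (x \<oplus> y) \<otimes> (x \<oplus> y)"
    using x y by (simp add: bracket_self)
  also have "\<dots> = x \<otimes> y \<oplus> y \<otimes> x"
    using x y c by (simp add: bracket_add_left bracket_add_right bracket_self[OF x] bracket_self[OF y]
        a_comm[OF c])
  finally have "y \<otimes> x \<oplus> x \<otimes> y = \<zero>"
    using c by (simp add: a_comm)
  then have "y \<otimes> x = \<ominus> (x \<otimes> y)"
    using c by (simp add: minus_equality)
  then show ?thesis
    using c by (simp add: scale_minus_one)
qed

text \<open>
  The Jacobi identity in the form that moves a bracket out of the second argument; this is what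
  the induction for \<open>lower_central_bracket\<close> needs.
\<close>

lemma jacobi_right:
  assumes x: "x \<in> carrier L" and y: "y \<in> carrier L" and z: "z \<in> carrier L"
  shows "x \<otimes> (y \<otimes> z) = (x \<otimes> y) \<otimes> z \<oplus> (- 1) \<odot>\<^bsub>L\<^esub> ((x \<otimes> z) \<otimes> y)"
proof -
  note b = bracket_closed[OF x y] bracket_closed[OF y z] bracket_closed[OF x z] bracket_closed[OF z x]
  note c = bracket_closed[OF b(1) z] bracket_closed[OF b(2) x] bracket_closed[OF b(3) y]
    bracket_closed[OF x b(2)]
  have "(x \<otimes> y) \<otimes> z \<oplus> (y \<otimes> z) \<otimes> x \<oplus> (z \<otimes> x) \<otimes> y = \<zero>"
    using jacobi[OF x y z] .
  moreover have "(y \<otimes> z) \<otimes> x = \<ominus> (x \<otimes> (y \<otimes> z))"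
    using bracket_anticomm[OF x b(2)] c by (simp add: scale_minus_one)
  moreover have "(z \<otimes> x) \<otimes> y = (- 1) \<odot>\<^bsub>L\<^esub> ((x \<otimes> z) \<otimes> y)"
    using bracket_anticomm[OF x z] b y by (simp add: bracket_smult_left)
  ultimately have "((x \<otimes> y) \<otimes> z \<oplus> (- 1) \<odot>\<^bsub>L\<^esub> ((x \<otimes> z) \<otimes> y)) \<oplus> \<ominus> (x \<otimes> (y \<otimes> z)) = \<zero>"
    using c scale_closed[OF c(3), of "-1"] by (simp add: a_ac)
  then have "\<ominus> (\<ominus> (x \<otimes> (y \<otimes> z))) = (x \<otimes> y) \<otimes> z \<oplus> (- 1) \<odot>\<^bsub>L\<^esub> ((x \<otimes> z) \<otimes> y)"
    using c scale_closed[OF c(3), of "-1"] by (intro minus_equality) auto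
  then show ?thesis
    using c by simp
qed

end

section \<open>Homomorphisms, ideals and quotients\<close>

definition alg_hom :: "('k::field_char_0, 'a) module \<Rightarrow> ('k, 'b) module \<Rightarrow> ('a \<Rightarrow> 'b) \<Rightarrow> bool" where
  "alg_hom A B h \<longleftrightarrow> (\<forall>x\<in>carrier A. h x \<in> carrier B) \<and>
     (\<forall>x\<in>carrier A. \<forall>y\<in>carrier A. h (x \<oplus>\<^bsub>A\<^esub> y) = h x \<oplus>\<^bsub>B\<^esub> h y) \<and>
     (\<forall>c. \<forall>x\<in>carrier A. h (c \<odot>\<^bsub>A\<^esub> x) = c \<odot>\<^bsub>B\<^esub> h x) \<and>
     (\<forall>x\<in>carrier A. \<forall>y\<in>carrier A. h (x \<otimes>\<^bsub>A\<^esub> y) = h x \<otimes>\<^bsub>B\<^esub> h y)"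

lemma alg_homD:
  assumes "alg_hom A B h"
  shows "x \<in> carrier A \<Longrightarrow> h x \<in> carrier B"
    and "x \<in> carrier A \<Longrightarrow> y \<in> carrier A \<Longrightarrow> h (x \<oplus>\<^bsub>A\<^esub> y) = h x \<oplus>\<^bsub>B\<^esub> h y"
    and "x \<in> carrier A \<Longrightarrow> h (c \<odot>\<^bsub>A\<^esub> x) = c \<odot>\<^bsub>B\<^esub> h x"
    and "x \<in> carrier A \<Longrightarrow> y \<in> carrier A \<Longrightarrow> h (x \<otimes>\<^bsub>A\<^esub> y) = h x \<otimes>\<^bsub>B\<^esub> h y"
  using assms by (auto simp: alg_hom_def)

lemma alg_hom_zero:
  assumes "bilinear_algebra A" "bilinear_algebra B" "alg_hom A B h"
  shows "h \<zero>\<^bsub>A\<^esub> = \<zero>\<^bsub>B\<^esub>"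
proof -
  interpret A: bilinear_algebra A by fact
  interpret B: bilinear_algebra B by fact
  have "h \<zero>\<^bsub>A\<^esub> = h (0 \<odot>\<^bsub>A\<^esub> \<zero>\<^bsub>A\<^esub>)"
    by (simp add: A.scale_zero)
  also have "\<dots> = \<zero>\<^bsub>B\<^esub>"
    using alg_homD(1)[OF assms(3), of "\<zero>\<^bsub>A\<^esub>"] alg_homD(3)[OF assms(3), of "\<zero>\<^bsub>A\<^esub>" 0]
    by (simp add: B.scale_zero)
  finally show ?thesis .
qed

text \<open>
  Homomorphisms are determined by the images of the generators: this transports every later
  computation with brackets from the quotients to an explicit algebra.
\<close>

lemma alg_hom_eval:
  assumes "bilinear_algebra A" "alg_hom A B h" "\<And>v. v \<in># letters t \<Longrightarrow> \<gamma> v \<in> carrier A"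
    "\<And>v. v \<in># letters t \<Longrightarrow> h (\<gamma> v) = \<gamma>' v"
  shows "h (eval_bracketing A \<gamma> t) = eval_bracketing B \<gamma>' t"
  using assms(3,4)
proof (induction t)
  case (Brack s t)
  have "eval_bracketing A \<gamma> s \<in> carrier A" "eval_bracketing A \<gamma> t \<in> carrier A"
    using Brack.prems by (auto intro!: bilinear_algebra.eval_closed[OF assms(1)])
  then show ?case
    using Brack alg_homD(4)[OF assms(2)] by simp
qed simp

text \<open>
  Together with \<open>span_minimal\<close> this replaces explicit linear combinations: to control a
  homomorphism on a span it suffices to control it on the spanning elements.
\<close>

lemma preimage_submodule:
  assumes "bilinear_algebra A" "bilinear_algebra B" "alg_hom A B h"
    and "LinearCombinations.submodule class_ring N B"
  shows "LinearCombinations.submodule class_ring {x \<in> carrier A. h x \<in> N} A"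
proof -
  interpret A: bilinear_algebra A by fact
  interpret B: bilinear_algebra B by fact
  interpret N: LinearCombinations.submodule class_ring N B by fact
  have "c \<odot>\<^bsub>B\<^esub> x \<in> N" if "x \<in> N" for c x
    using that by (intro N.smult_closed) auto
  then show ?thesis
    using alg_homD[OF assms(3)] alg_hom_zero[OF assms(1-3)]
    by (intro A.submodule_classI) (auto simp: A.scale_closed)
qed

lemma alg_hom_kernel_submodule:
  assumes "bilinear_algebra A" "bilinear_algebra B" "alg_hom A B h"
  shows "LinearCombinations.submodule class_ring {x \<in> carrier A. h x = \<zero>\<^bsub>B\<^esub>} A"
proof -
  interpret B: bilinear_algebra B by fact
  have "LinearCombinations.submodule class_ring {\<zero>\<^bsub>B\<^esub>} B"
    by (rule B.submodule_classI) (auto simp: B.scale_zero_right)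
  from preimage_submodule[OF assms this] show ?thesis
    by simp
qed

lemma alg_hom_kernel_ideal:
  assumes "bilinear_algebra A" "bilinear_algebra B" "alg_hom A B h"
  shows "alg_ideal A {x \<in> carrier A. h x = \<zero>\<^bsub>B\<^esub>}"
proof -
  interpret A: bilinear_algebra A by fact
  interpret B: bilinear_algebra B by fact
  show ?thesis
    unfolding alg_ideal_def using alg_hom_kernel_submodule[OF assms] alg_homD[OF assms(3)]
    by (auto simp: A.bracket_closed B.bracket_zero_left B.bracket_zero_right)
qed

lemma gen_ideal_minimal: "alg_ideal L I \<Longrightarrow> S \<subseteq> I \<Longrightarrow> gen_ideal L S \<subseteq> I"
  by (auto simp: gen_ideal_def)

lemma gen_ideal_superset: "S \<subseteq> gen_ideal L S"
  by (auto simp: gen_ideal_def)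

lemma alg_ideal_carrier: "bilinear_algebra L \<Longrightarrow> alg_ideal L (carrier L)"
  by (simp add: alg_ideal_def bilinear_algebra.submodule_carrier bilinear_algebra.bracket_closed)

lemma gen_ideal_ideal:
  assumes "bilinear_algebra L" "S \<subseteq> carrier L"
  shows "alg_ideal L (gen_ideal L S)"
proof -
  interpret bilinear_algebra L by fact
  have sub: "gen_ideal L S \<subseteq> carrier L"
    using gen_ideal_minimal[OF alg_ideal_carrier[OF assms(1)] assms(2)] .
  have mem: "x \<in> gen_ideal L S \<longleftrightarrow> (\<forall>I. alg_ideal L I \<longrightarrow> S \<subseteq> I \<longrightarrow> x \<in> I)" for x
    by (auto simp: gen_ideal_def)
  have sm: "LinearCombinations.submodule class_ring I L" if "alg_ideal L I" for I
    using that by (simp add: alg_ideal_def)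
  have "LinearCombinations.submodule class_ring (gen_ideal L S) L"
  proof (rule submodule_classI[OF sub])
    show "\<zero>\<^bsub>L\<^esub> \<in> gen_ideal L S"
      unfolding mem using LinearCombinations.submodule.zero_closed[OF sm] by blast
  next
    fix x y assume "x \<in> gen_ideal L S" "y \<in> gen_ideal L S"
    then show "x \<oplus>\<^bsub>L\<^esub> y \<in> gen_ideal L S"
      unfolding mem using LinearCombinations.submodule.m_closed[OF sm] by blast
  next
    fix c x assume "x \<in> gen_ideal L S"
    then show "c \<odot>\<^bsub>L\<^esub> x \<in> gen_ideal L S"
      unfolding mem using LinearCombinations.submodule.smult_closed[OF sm] by simp
  qed
  moreover have "x \<otimes>\<^bsub>L\<^esub> y \<in> gen_ideal L S \<and> y \<otimes>\<^bsub>L\<^esub> x \<in> gen_ideal L S"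
    if "x \<in> gen_ideal L S" "y \<in> carrier L" for x y
    using that unfolding mem by (auto simp: alg_ideal_def)
  ultimately show ?thesis
    by (simp add: alg_ideal_def)
qed

lemma alg_ideal_subset: "alg_ideal L I \<Longrightarrow> I \<subseteq> carrier L"
  unfolding alg_ideal_def by (blast dest: LinearCombinations.submodule.subset)

context bilinear_algebra
begin

lemma ideal_abelian_subgroup:
  assumes "alg_ideal L I"
  shows "abelian_subgroup I L"
proof -
  interpret I: LinearCombinations.submodule class_ring I L
    using assms by (simp add: alg_ideal_def)
  have "\<ominus> x \<in> I" if x: "x \<in> I" for x
  proof -
    have "(- 1) \<odot>\<^bsub>L\<^esub> x \<in> I"
      using x by (intro I.smult_closed) auto
    moreover have "x \<in> carrier L"
      using x I.subset by blast
    ultimately show ?thesis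
      by (simp add: scale_minus_one)
  qed
  moreover have "I \<noteq> {}"
    using I.zero_closed by blast
  ultimately have "subgroup I (add_monoid L)"
    using I.subset I.m_closed by (intro add.subgroupI) blast+
  moreover have "abelian_group L"
    by unfold_locales
  ultimately show ?thesis
    by (intro abelian_subgroupI3 additive_subgroupI)
qed

lemma coset_mem_iff:
  assumes "alg_ideal L I" "x \<in> carrier L"
  shows "x' \<in> I +> x \<longleftrightarrow> (\<exists>i\<in>I. x' = i \<oplus> x)"
  by (auto simp: a_r_coset_def')

lemma coset_absorb:
  assumes I: "alg_ideal L I" and i: "i \<in> I" and x: "x \<in> carrier L"
  shows "I +> (i \<oplus> x) = I +> x"
proof -
  interpret I: abelian_subgroup I L using I by (rule ideal_abelian_subgroup)
  have "i \<oplus> x \<in> I +> x"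
    using i by (auto simp: coset_mem_iff[OF I x])
  then show ?thesis
    using a_repr_independence[OF _ x] I.a_subgroup by simp
qed

lemma coset_zero:
  assumes I: "alg_ideal L I" and i: "i \<in> I"
  shows "I +> i = I"
proof -
  interpret I: abelian_subgroup I L using I by (rule ideal_abelian_subgroup)
  show ?thesis using I.a_rcos_const[OF i] .
qed

lemma quot_carrier: "carrier (quot_alg L I) = (\<lambda>x. I +> x) ` carrier L"
  by (auto simp: quot_alg_def A_RCOSETS_def')

lemma quot_zero: "\<zero>\<^bsub>quot_alg L I\<^esub> = I"
  by (simp add: quot_alg_def)

lemma quot_add:
  assumes I: "alg_ideal L I" and "x \<in> carrier L" "y \<in> carrier L"
  shows "(I +> x) \<oplus>\<^bsub>quot_alg L I\<^esub> (I +> y) = I +> (x \<oplus> y)"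
proof -
  interpret I: abelian_subgroup I L using I by (rule ideal_abelian_subgroup)
  show ?thesis using I.a_rcos_sum assms by (simp add: quot_alg_def)
qed

lemma quot_smult:
  assumes I: "alg_ideal L I" and x: "x \<in> carrier L"
  shows "c \<odot>\<^bsub>quot_alg L I\<^esub> (I +> x) = I +> (c \<odot>\<^bsub>L\<^esub> x)"
proof -
  interpret I: abelian_subgroup I L using I by (rule ideal_abelian_subgroup)
  interpret S: LinearCombinations.submodule class_ring I L
    using I by (simp add: alg_ideal_def)
  have "I +> (c \<odot>\<^bsub>L\<^esub> y) = I +> (c \<odot>\<^bsub>L\<^esub> x)" if y: "y \<in> I +> x" for y
  proof -
    obtain i where i: "i \<in> I" "y = i \<oplus> x"
      using y by (auto simp: coset_mem_iff[OF I x])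
    have "i \<in> carrier L"
      using i S.subset by blast
    then have "c \<odot>\<^bsub>L\<^esub> y = c \<odot>\<^bsub>L\<^esub> i \<oplus> c \<odot>\<^bsub>L\<^esub> x"
      unfolding i(2) by (intro scale_add_right x)
    moreover have "c \<odot>\<^bsub>L\<^esub> i \<in> I"
      using S.smult_closed[of c i] i by simp
    ultimately show ?thesis
      using coset_absorb[OF I _ scale_closed[OF x]] by simp
  qed
  moreover have "x \<in> I +> x"
    using I.a_rcos_self[OF x] .
  ultimately have "(\<Union>y\<in>I +> x. I +> (c \<odot>\<^bsub>L\<^esub> y)) = I +> (c \<odot>\<^bsub>L\<^esub> x)"
    by blast
  then show ?thesis
    by (simp add: quot_alg_def)
qed

text \<open>
  Both factors may be changed by elements \<open>i, j\<close> of the ideal, because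
  $(i + x)(j + y) = i (j + y) + x j + x y$ and the first two summands are in the ideal.
\<close>

lemma quot_bracket:
  assumes I: "alg_ideal L I" and x: "x \<in> carrier L" and y: "y \<in> carrier L"
  shows "(I +> x) \<otimes>\<^bsub>quot_alg L I\<^esub> (I +> y) = I +> (x \<otimes> y)"
proof -
  interpret I: abelian_subgroup I L using I by (rule ideal_abelian_subgroup)
  have *: "I +> (a \<otimes> b) = I +> (x \<otimes> y)" if a: "a \<in> I +> x" and b: "b \<in> I +> y" for a b
  proof -
    obtain i where i: "i \<in> I" "a = i \<oplus> x"
      using a by (auto simp: coset_mem_iff[OF I x])
    obtain j where j: "j \<in> I" "b = j \<oplus> y"
      using b by (auto simp: coset_mem_iff[OF I y])
    have ij: "i \<in> carrier L" "j \<in> carrier L" "b \<in> carrier L"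
      using i j y I.a_subset by auto
    have ib: "i \<otimes> b \<in> I" and xj: "x \<otimes> j \<in> I"
      using I i(1) j(1) ij x by (auto simp: alg_ideal_def)
    have "a \<otimes> b = i \<otimes> b \<oplus> x \<otimes> b"
      using i ij x by (simp add: bracket_add_left)
    also have "x \<otimes> b = x \<otimes> j \<oplus> x \<otimes> y"
      using j ij x y by (simp add: bracket_add_right)
    finally have "a \<otimes> b = i \<otimes> b \<oplus> (x \<otimes> j \<oplus> x \<otimes> y)" .
    moreover have "x \<otimes> j \<oplus> x \<otimes> y \<in> carrier L" "x \<otimes> y \<in> carrier L"
      using ij x y by (auto intro: bracket_closed)
    ultimately show ?thesis
      by (simp only: coset_absorb[OF I ib] coset_absorb[OF I xj])
  qed
  have self: "x \<in> I +> x" "y \<in> I +> y"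
    using I.a_rcos_self x y by auto
  have "(\<Union>a\<in>I +> x. \<Union>b\<in>I +> y. I +> (a \<otimes> b)) = I +> (x \<otimes> y)"
    using * self by blast
  then show ?thesis
    by (simp add: quot_alg_def rcoset_mult_def)
qed

lemma quot_bilinear_algebra:
  assumes I: "alg_ideal L I"
  shows "bilinear_algebra (quot_alg L I)"
proof -
  interpret I: abelian_subgroup I L using I by (rule ideal_abelian_subgroup)
  have I0: "I +> \<zero> = I"
    using coset_zero[OF I, of \<zero>] by simp
  note quot = quot_add[OF I] quot_smult[OF I] quot_bracket[OF I]
  have "vectorspace class_ring (quot_alg L I)"
  proof (rule vs_criteria)
    show "Ring.field (class_ring :: 'k ring)"
      by (rule class_field)
    show "\<zero>\<^bsub>quot_alg L I\<^esub> \<in> carrier (quot_alg L I)"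
      unfolding quot_zero quot_carrier using I0 by blast
    show "\<forall>v\<in>carrier (quot_alg L I). \<exists>w\<in>carrier (quot_alg L I).
        v \<oplus>\<^bsub>quot_alg L I\<^esub> w = \<zero>\<^bsub>quot_alg L I\<^esub>"
    proof
      fix v assume "v \<in> carrier (quot_alg L I)"
      then obtain x where x: "x \<in> carrier L" "v = I +> x" by (auto simp: quot_carrier)
      then have "v \<oplus>\<^bsub>quot_alg L I\<^esub> (I +> \<ominus> x) = \<zero>\<^bsub>quot_alg L I\<^esub>"
        using I0 by (simp add: quot quot_zero r_neg)
      then show "\<exists>w\<in>carrier (quot_alg L I). v \<oplus>\<^bsub>quot_alg L I\<^esub> w = \<zero>\<^bsub>quot_alg L I\<^esub>"
        using x by (auto simp: quot_carrier)
    qed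
    show "\<forall>v\<in>carrier (quot_alg L I). v \<oplus>\<^bsub>quot_alg L I\<^esub> \<zero>\<^bsub>quot_alg L I\<^esub> = v"
    proof
      fix v assume "v \<in> carrier (quot_alg L I)"
      then obtain x where x: "x \<in> carrier L" "v = I +> x" by (auto simp: quot_carrier)
      have "v \<oplus>\<^bsub>quot_alg L I\<^esub> (I +> \<zero>) = v"
        using x by (simp add: quot)
      then show "v \<oplus>\<^bsub>quot_alg L I\<^esub> \<zero>\<^bsub>quot_alg L I\<^esub> = v"
        using I0 by (simp add: quot_zero)
    qed
  qed (auto simp: quot_carrier quot scale_closed scale_scale scale_one scale_add_left
      scale_add_right a_ac)
  moreover have "bilinear_algebra_axioms (quot_alg L I)"
    by unfold_locales (auto simp: quot_carrier quot scale_closed bracket_closed bracket_add_left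
        bracket_add_right bracket_smult_left bracket_smult_right)
  ultimately show ?thesis
    by (rule bilinear_algebra.intro)
qed

text \<open>
  This is how the free Lie algebra arises from the free nonassociative one, and it also shows that
  quotients of Lie algebras are Lie algebras.
\<close>

lemma quot_lie_algebra:
  assumes I: "alg_ideal L I" and lie: "lie_identities L \<subseteq> I"
  shows "lie_algebra (quot_alg L I)"
proof -
  interpret Q: bilinear_algebra "quot_alg L I" by (rule quot_bilinear_algebra[OF I])
  note quot = quot_add[OF I] quot_smult[OF I] quot_bracket[OF I]
  have "I +> z = I" if "z \<in> lie_identities L" for z
    using that lie coset_zero[OF I] by blast
  then have self: "I +> (x \<otimes> x) = I" if "x \<in> carrier L" for x
    using that by (auto simp: lie_identities_def)
  have jacobi: "I +> ((x \<otimes> y) \<otimes> z \<oplus> (y \<otimes> z) \<otimes> x \<oplus> (z \<otimes> x) \<otimes> y) = I"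
    if "x \<in> carrier L" "y \<in> carrier L" "z \<in> carrier L" for x y z
    using that \<open>\<And>z. z \<in> lie_identities L \<Longrightarrow> I +> z = I\<close> unfolding lie_identities_def by blast
  have "lie_algebra_axioms (quot_alg L I)"
  proof
    fix X assume "X \<in> carrier (quot_alg L I)"
    then show "X \<otimes>\<^bsub>quot_alg L I\<^esub> X = \<zero>\<^bsub>quot_alg L I\<^esub>"
      by (auto simp: quot_carrier quot quot_zero self)
  next
    fix X Y Z
    assume "X \<in> carrier (quot_alg L I)" "Y \<in> carrier (quot_alg L I)" "Z \<in> carrier (quot_alg L I)"
    then obtain x y z where *: "x \<in> carrier L" "y \<in> carrier L" "z \<in> carrier L"
      "X = I +> x" "Y = I +> y" "Z = I +> z"
      by (auto simp: quot_carrier)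
    then show "(X \<otimes>\<^bsub>quot_alg L I\<^esub> Y) \<otimes>\<^bsub>quot_alg L I\<^esub> Z \<oplus>\<^bsub>quot_alg L I\<^esub>
        (Y \<otimes>\<^bsub>quot_alg L I\<^esub> Z) \<otimes>\<^bsub>quot_alg L I\<^esub> X \<oplus>\<^bsub>quot_alg L I\<^esub>
        (Z \<otimes>\<^bsub>quot_alg L I\<^esub> X) \<otimes>\<^bsub>quot_alg L I\<^esub> Y = \<zero>\<^bsub>quot_alg L I\<^esub>"
      by (simp add: quot bracket_closed quot_zero jacobi)
  qed (fact Q.bracket_closed Q.bracket_add_left Q.bracket_add_right
      Q.bracket_smult_left Q.bracket_smult_right)+
  then show ?thesis
    by (intro lie_algebra.intro Q.vectorspace_axioms)
qed

lemma coset_hom: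
  assumes "alg_ideal L I"
  shows "alg_hom L (quot_alg L I) (\<lambda>x. I +> x)"
  using assms by (auto simp: alg_hom_def quot_carrier quot_add quot_smult quot_bracket)

end

lemma lie_identities_zero:
  assumes "lie_algebra L"
  shows "lie_identities L \<subseteq> {\<zero>\<^bsub>L\<^esub>}"
  using lie_algebra.bracket_self[OF assms] lie_algebra.jacobi[OF assms]
  by (auto simp: lie_identities_def)

lemma lie_quot_lie_algebra:
  assumes "lie_algebra L" "alg_ideal L I"
  shows "lie_algebra (quot_alg L I)"
proof -
  interpret lie_algebra L by fact
  have "\<zero>\<^bsub>L\<^esub> \<in> I"
    using assms(2) LinearCombinations.submodule.zero_closed unfolding alg_ideal_def by blast
  then show ?thesis
    using quot_lie_algebra assms(2) lie_identities_zero[OF assms(1)] by blast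
qed

text \<open>
  The map induced on cosets by a map \<open>h\<close> that is constant on each of them.
\<close>

definition coset_lift :: "('a \<Rightarrow> 'b) \<Rightarrow> 'a set \<Rightarrow> 'b" where
  "coset_lift h X = h (SOME x. x \<in> X)"

lemma
  assumes A: "bilinear_algebra A" and B: "bilinear_algebra B" and h: "alg_hom A B h"
    and I: "alg_ideal A I" and vanish: "\<And>x. x \<in> I \<Longrightarrow> h x = \<zero>\<^bsub>B\<^esub>"
  shows coset_lift_coset: "x \<in> carrier A \<Longrightarrow> coset_lift h (I +>\<^bsub>A\<^esub> x) = h x"
    and coset_lift_hom: "alg_hom (quot_alg A I) B (coset_lift h)"
proof -
  interpret A: bilinear_algebra A by fact
  interpret B: bilinear_algebra B by fact
  interpret I: abelian_subgroup I A using I by (rule A.ideal_abelian_subgroup)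
  note hom = alg_homD[OF h]
  show coset: "coset_lift h (I +>\<^bsub>A\<^esub> x) = h x" if x: "x \<in> carrier A" for x
  proof -
    have "(SOME y. y \<in> I +>\<^bsub>A\<^esub> x) \<in> I +>\<^bsub>A\<^esub> x"
      using I.a_rcos_self[OF x] by (rule someI)
    then obtain i where i: "i \<in> I" "(SOME y. y \<in> I +>\<^bsub>A\<^esub> x) = i \<oplus>\<^bsub>A\<^esub> x"
      unfolding A.coset_mem_iff[OF I x] by blast
    then show ?thesis
      using hom(1)[OF x] hom(2)[OF _ x, of i] vanish[OF i(1)] I.a_subset
      by (auto simp: coset_lift_def)
  qed
  show "alg_hom (quot_alg A I) B (coset_lift h)"
    unfolding alg_hom_def A.quot_carrier
    by (auto simp: A.quot_add[OF I] A.quot_smult[OF I] A.quot_bracket[OF I] coset hom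
        A.scale_closed A.bracket_closed)
qed

section \<open>Algebras generated by brackets\<close>

text \<open>
  The iterated brackets of the elements \<open>\<gamma> v\<close> span \<open>L\<close>. Quantifying over submodules gives
  an induction principle directly and makes the passage to quotients a matter of preimages.
\<close>

definition bracket_generated :: "('k::field_char_0, 'a) module \<Rightarrow> 'v set \<Rightarrow> ('v \<Rightarrow> 'a) \<Rightarrow> bool" where
  "bracket_generated L V \<gamma> \<longleftrightarrow> \<gamma> ` V \<subseteq> carrier L \<and>
     (\<forall>N. LinearCombinations.submodule class_ring N L \<longrightarrow>
       (\<forall>t. set_mset (letters t) \<subseteq> V \<longrightarrow> eval_bracketing L \<gamma> t \<in> N) \<longrightarrow> carrier L \<subseteq> N)"

lemma bracket_generated_induct:
  assumes "bracket_generated L V \<gamma>" "LinearCombinations.submodule class_ring N L"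
    "\<And>t. set_mset (letters t) \<subseteq> V \<Longrightarrow> eval_bracketing L \<gamma> t \<in> N"
  shows "carrier L \<subseteq> N"
  using assms unfolding bracket_generated_def by blast

lemma bracket_generated_closed: "bracket_generated L V \<gamma> \<Longrightarrow> v \<in> V \<Longrightarrow> \<gamma> v \<in> carrier L"
  unfolding bracket_generated_def by blast

lemma eval_quot:
  assumes "bilinear_algebra L" "alg_ideal L I" "\<And>v. v \<in># letters t \<Longrightarrow> \<gamma> v \<in> carrier L"
  shows "eval_bracketing (quot_alg L I) (\<lambda>v. I +>\<^bsub>L\<^esub> \<gamma> v) t = I +>\<^bsub>L\<^esub> eval_bracketing L \<gamma> t"
  using alg_hom_eval[OF assms(1) bilinear_algebra.coset_hom[OF assms(1,2)], of t \<gamma>] assms(3) by simp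

lemma bracket_generated_quot:
  assumes L: "bilinear_algebra L" and I: "alg_ideal L I" and gen: "bracket_generated L V \<gamma>"
  shows "bracket_generated (quot_alg L I) V (\<lambda>v. I +>\<^bsub>L\<^esub> \<gamma> v)"
  unfolding bracket_generated_def
proof (intro conjI allI impI)
  interpret bilinear_algebra L by fact
  show "(\<lambda>v. I +>\<^bsub>L\<^esub> \<gamma> v) ` V \<subseteq> carrier (quot_alg L I)"
    using gen by (auto simp: quot_carrier bracket_generated_def)
  fix N
  assume N: "LinearCombinations.submodule class_ring N (quot_alg L I)"
    and ev: "\<forall>t. set_mset (letters t) \<subseteq> V \<longrightarrow>
      eval_bracketing (quot_alg L I) (\<lambda>v. I +>\<^bsub>L\<^esub> \<gamma> v) t \<in> N"
  have "carrier L \<subseteq> {x \<in> carrier L. I +>\<^bsub>L\<^esub> x \<in> N}"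
  proof (rule bracket_generated_induct[OF gen])
    show "LinearCombinations.submodule class_ring {x \<in> carrier L. I +>\<^bsub>L\<^esub> x \<in> N} L"
      by (rule preimage_submodule[OF L quot_bilinear_algebra[OF I] coset_hom[OF I] N])
  next
    fix t assume t: "set_mset (letters t) \<subseteq> V"
    then have g: "\<And>v. v \<in># letters t \<Longrightarrow> \<gamma> v \<in> carrier L"
      using bracket_generated_closed[OF gen] by auto
    then show "eval_bracketing L \<gamma> t \<in> {x \<in> carrier L. I +>\<^bsub>L\<^esub> x \<in> N}"
    proof (intro CollectI conjI)
      have "eval_bracketing (quot_alg L I) (\<lambda>v. I +>\<^bsub>L\<^esub> \<gamma> v) t \<in> N"
        using ev t by blast
      then show "I +>\<^bsub>L\<^esub> eval_bracketing L \<gamma> t \<in> N"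
        by (simp only: eval_quot[OF L I g])
      show "eval_bracketing L \<gamma> t \<in> carrier L"
        by (rule eval_closed[OF g])
    qed
  qed
  then show "carrier (quot_alg L I) \<subseteq> N"
    by (auto simp: quot_carrier)
qed

section \<open>The lower central series\<close>

lemma size_letters_pos: "0 < size (letters t)"
  by (induction t) auto

context lie_algebra
begin

lemma lower_central_submodule: "LinearCombinations.submodule class_ring (lower_central L n) L"
proof (induction n)
  case (Suc n)
  then have "lower_central L n \<subseteq> carrier L"
    by (rule LinearCombinations.submodule.subset)
  then have "{x \<otimes> y | x y. x \<in> lower_central L n \<and> y \<in> carrier L} \<subseteq> carrier L"
    by (auto intro: bracket_closed)
  then show ?case
    using span_is_submodule by simp
qed (simp add: submodule_carrier)

lemma lower_central_subset: "lower_central L n \<subseteq> carrier L"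
  using lower_central_submodule by (rule LinearCombinations.submodule.subset)

lemma lower_central_bracket_carrier:
  assumes "x \<in> lower_central L n" "y \<in> carrier L"
  shows "x \<otimes> y \<in> lower_central L (Suc n)"
proof -
  have "{x \<otimes> y | x y. x \<in> lower_central L n \<and> y \<in> carrier L} \<subseteq> carrier L"
    using lower_central_subset by (auto intro: bracket_closed)
  from in_own_span[OF this] show ?thesis
    unfolding lower_central.simps using assms by blast
qed

lemma lower_central_decreasing_Suc: "lower_central L (Suc n) \<subseteq> lower_central L n"
proof (induction n)
  case 0
  show ?case unfolding lower_central.simps(1) by (rule lower_central_subset)
next
  case (Suc n)
  have "{x \<otimes> y | x y. x \<in> lower_central L (Suc n) \<and> y \<in> carrier L} \<subseteq> lower_central L (Suc n)"
  proof clarify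
    fix x y assume "x \<in> lower_central L (Suc n)" "y \<in> carrier L"
    then show "x \<otimes> y \<in> lower_central L (Suc n)"
      using lower_central_bracket_carrier[of x n y] Suc by blast
  qed
  from span_minimal[OF lower_central_submodule this] show ?case
    by (simp only: lower_central.simps)
qed

lemma lower_central_decreasing: "m \<le> n \<Longrightarrow> lower_central L n \<subseteq> lower_central L m"
  by (rule lift_Suc_antimono_le[of "lower_central L", OF lower_central_decreasing_Suc])

lemma lower_central_scale: "x \<in> lower_central L n \<Longrightarrow> c \<odot>\<^bsub>L\<^esub> x \<in> lower_central L n"
  using LinearCombinations.submodule.smult_closed[OF lower_central_submodule, of c x n] by simp

text \<open>
  The inclusion $[L^{a+1}, L^{b+1}] \subseteq L^{a+b+2}$. The second argument is peeled off by the
  Jacobi identity, which is why \<open>a\<close> has to vary in the induction on \<open>b\<close>.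
\<close>

lemma lower_central_bracket:
  assumes "x \<in> lower_central L a" "y \<in> lower_central L b"
  shows "x \<otimes> y \<in> lower_central L (Suc (a + b))"
  using assms
proof (induction b arbitrary: a x y)
  case 0
  then show ?case
    using lower_central_bracket_carrier[of x a y] by (simp only: lower_central.simps(1) add_0_right)
next
  case (Suc b)
  let ?N = "{y \<in> carrier L. x \<otimes> y \<in> lower_central L (Suc (a + Suc b))}"
  have x: "x \<in> carrier L"
    using Suc.prems(1) lower_central_subset by blast
  interpret S: LinearCombinations.submodule class_ring "lower_central L (Suc (a + Suc b))" L
    by (rule lower_central_submodule)
  have "LinearCombinations.submodule class_ring ?N L"
    using S.zero_closed S.m_closed lower_central_scale x
    by (intro submodule_classI)
      (auto simp del: lower_central.simps
        simp: bracket_zero_right bracket_add_right bracket_smult_right scale_closed)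
  moreover have "{u \<otimes> z | u z. u \<in> lower_central L b \<and> z \<in> carrier L} \<subseteq> ?N"
  proof clarify
    fix u z assume u: "u \<in> lower_central L b" and z: "z \<in> carrier L"
    have uc: "u \<in> carrier L"
      using u lower_central_subset by blast
    have "(x \<otimes> u) \<otimes> z \<in> lower_central L (Suc (a + Suc b))"
      using lower_central_bracket_carrier[OF Suc.IH[OF Suc.prems(1) u] z] by (simp only: add_Suc_right)
    moreover have "(x \<otimes> z) \<otimes> u \<in> lower_central L (Suc (a + Suc b))"
      using Suc.IH[OF lower_central_bracket_carrier[OF Suc.prems(1) z] u]
      by (simp only: add_Suc_right add_Suc)
    ultimately show "u \<otimes> z \<in> carrier L \<and> x \<otimes> (u \<otimes> z) \<in> lower_central L (Suc (a + Suc b))"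
      unfolding jacobi_right[OF x uc z]
      using S.m_closed lower_central_scale bracket_closed[OF uc z] by blast
  qed
  ultimately have "lower_central L (Suc b) \<subseteq> ?N"
    unfolding lower_central.simps by (rule span_minimal)
  then show ?case
    using Suc.prems(2) by blast
qed

lemma lower_central_ideal: "alg_ideal L (lower_central L n)"
  unfolding alg_ideal_def
proof (intro conjI ballI lower_central_submodule)
  fix x y assume x: "x \<in> lower_central L n" and y: "y \<in> carrier L"
  show "x \<otimes> y \<in> lower_central L n"
    using lower_central_bracket_carrier[OF x y] lower_central_decreasing_Suc by blast
  then have "(- 1) \<odot>\<^bsub>L\<^esub> (x \<otimes> y) \<in> lower_central L n"
    by (rule lower_central_scale)
  then show "y \<otimes> x \<in> lower_central L n"
    using bracket_anticomm[OF subsetD[OF lower_central_subset x] y] by simp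
qed

text \<open>
  An iterated bracket of $n$ letters lies in $L^n$, however it is bracketed. Hence brackets of more
  than \<open>k\<close> letters vanish in a \<open>k\<close>-step nilpotent algebra.
\<close>

lemma eval_in_lower_central:
  assumes "\<And>v. v \<in># letters t \<Longrightarrow> \<gamma> v \<in> carrier L"
  shows "eval_bracketing L \<gamma> t \<in> lower_central L (size (letters t) - 1)"
  using assms
proof (induction t)
  case (Brack s t)
  then have "eval_bracketing L \<gamma> s \<otimes> eval_bracketing L \<gamma> t
      \<in> lower_central L (Suc (size (letters s) - 1 + (size (letters t) - 1)))"
    by (intro lower_central_bracket) auto
  moreover have "Suc (size (letters s) - 1 + (size (letters t) - 1)) = size (letters (Brack s t)) - 1"
    using size_letters_pos[of s] size_letters_pos[of t] by simp
  ultimately show ?case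
    by (simp only: eval_bracketing.simps)
qed simp

end

lemma alg_hom_lower_central:
  assumes A: "lie_algebra A" and B: "lie_algebra B" and h: "alg_hom A B h"
  shows "x \<in> lower_central A n \<Longrightarrow> h x \<in> lower_central B n"
proof (induction n arbitrary: x)
  case 0
  then show ?case using alg_homD(1)[OF h] by simp
next
  case (Suc n)
  interpret A: lie_algebra A by fact
  interpret B: lie_algebra B by fact
  let ?N = "{x \<in> carrier A. h x \<in> lower_central B (Suc n)}"
  have "LinearCombinations.submodule class_ring ?N A"
    by (rule preimage_submodule[OF A.bilinear_algebra_axioms B.bilinear_algebra_axioms h
          B.lower_central_submodule])
  moreover have "{u \<otimes>\<^bsub>A\<^esub> z | u z. u \<in> lower_central A n \<and> z \<in> carrier A} \<subseteq> ?N"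
  proof clarify
    fix u z assume u: "u \<in> lower_central A n" and z: "z \<in> carrier A"
    have uc: "u \<in> carrier A"
      using u A.lower_central_subset by blast
    show "u \<otimes>\<^bsub>A\<^esub> z \<in> carrier A \<and> h (u \<otimes>\<^bsub>A\<^esub> z) \<in> lower_central B (Suc n)"
      using A.bracket_closed[OF uc z] alg_homD(4)[OF h uc z]
        B.lower_central_bracket_carrier[OF Suc.IH[OF u] alg_homD(1)[OF h z]] by simp
  qed
  ultimately show ?case
    using A.span_induct Suc.prems unfolding lower_central.simps by blast
qed

section \<open>The free algebras\<close>

lemma finite_support_bracket:
  assumes "finite {t. f t \<noteq> (0::'k::field_char_0)}" "finite {t. g t \<noteq> 0}"
  shows "finite {t. (case t of Letter v \<Rightarrow> 0 | Brack s u \<Rightarrow> f s * g u) \<noteq> 0}"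
proof (rule finite_subset)
  show "{t. (case t of Letter v \<Rightarrow> 0 | Brack s u \<Rightarrow> f s * g u) \<noteq> 0}
      \<subseteq> (\<lambda>(s, u). Brack s u) ` ({t. f t \<noteq> 0} \<times> {t. g t \<noteq> 0})"
  proof
    fix t assume "t \<in> {t. (case t of Letter v \<Rightarrow> 0 | Brack s u \<Rightarrow> f s * g u) \<noteq> 0}"
    then show "t \<in> (\<lambda>(s, u). Brack s u) ` ({t. f t \<noteq> 0} \<times> {t. g t \<noteq> 0})"
      by (cases t) auto
  qed
qed (use assms in auto)

lemma free_nonassoc_bilinear_algebra: "bilinear_algebra (free_nonassoc V :: ('k::field_char_0, _) module)"
proof -
  let ?A = "free_nonassoc V :: ('k, _) module"
  have fin_add: "finite {t. f t + g t \<noteq> 0}"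
    if "finite {t. f t \<noteq> 0}" "finite {t. g t \<noteq> 0}" for f g :: "'v bracketing \<Rightarrow> 'k"
    by (rule finite_subset[OF _ finite_UnI[OF that]]) auto
  have fin_scale: "finite {t. c * f t \<noteq> 0}" if "finite {t. f t \<noteq> 0}" for c and f :: "'v bracketing \<Rightarrow> 'k"
    by (rule finite_subset[OF _ that]) auto
  have vs: "vectorspace class_ring ?A"
  proof (rule vs_criteria)
    show "Ring.field (class_ring :: 'k ring)"
      by (rule class_field)
    show "\<forall>v\<in>carrier ?A. \<exists>w\<in>carrier ?A. v \<oplus>\<^bsub>?A\<^esub> w = \<zero>\<^bsub>?A\<^esub>"
    proof
      fix v assume "v \<in> carrier ?A"
      then show "\<exists>w\<in>carrier ?A. v \<oplus>\<^bsub>?A\<^esub> w = \<zero>\<^bsub>?A\<^esub>"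
        by (intro bexI[of _ "\<lambda>t. - v t"]) (auto simp: free_nonassoc_def)
    qed
    show "\<forall>v w. v \<in> carrier ?A \<and> w \<in> carrier ?A \<longrightarrow> v \<oplus>\<^bsub>?A\<^esub> w \<in> carrier ?A"
      using fin_add by (auto simp: free_nonassoc_def) (metis add.right_neutral subsetD)
    show "\<forall>c v. c \<in> carrier class_ring \<and> v \<in> carrier ?A \<longrightarrow> c \<odot>\<^bsub>?A\<^esub> v \<in> carrier ?A"
      using fin_scale by (auto simp: free_nonassoc_def)
  qed (auto simp: free_nonassoc_def algebra_simps)
  moreover have "bilinear_algebra_axioms ?A"
  proof
    fix f g assume "f \<in> carrier ?A" "g \<in> carrier ?A"
    then show "f \<otimes>\<^bsub>?A\<^esub> g \<in> carrier ?A"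
      using finite_support_bracket[of f g]
      by (auto simp: free_nonassoc_def split: bracketing.splits)
  qed (auto simp: free_nonassoc_def fun_eq_iff algebra_simps split: bracketing.splits)
  ultimately show ?thesis
    by (rule bilinear_algebra.intro)
qed

lemma eval_free_nonassoc:
  "eval_bracketing (free_nonassoc V :: ('k::field_char_0, _) module)
     (\<lambda>v s. if s = Letter v then 1 else 0) t = (\<lambda>s. if s = t then 1 else 0)"
  by (induction t) (auto simp: free_nonassoc_def fun_eq_iff split: bracketing.splits)

text \<open>
  A finitely supported function is the sum of the multiples of the bracketings in its support;
  the induction removes one bracketing at a time.
\<close>

lemma free_nonassoc_generated:
  "bracket_generated (free_nonassoc V :: ('k::field_char_0, _) module) V
     (\<lambda>v s. if s = Letter v then 1 else 0)"
  unfolding bracket_generated_def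
proof (intro conjI allI impI)
  let ?A = "free_nonassoc V :: ('k, _) module"
  show "(\<lambda>v s. if s = Letter v then 1 else 0) ` V \<subseteq> carrier ?A"
    by (auto simp: free_nonassoc_def split: if_splits)
  fix N
  assume N: "LinearCombinations.submodule class_ring N ?A"
    and ev: "\<forall>t. set_mset (letters t) \<subseteq> V \<longrightarrow>
      eval_bracketing ?A (\<lambda>v s. if s = Letter v then 1 else 0) t \<in> N"
  interpret N: LinearCombinations.submodule class_ring N ?A by fact
  show "carrier ?A \<subseteq> N"
  proof
    fix f assume f: "f \<in> carrier ?A"
    then have "finite {t. f t \<noteq> 0}"
      by (simp add: free_nonassoc_def)
    from this f show "f \<in> N"
    proof (induction "{t. f t \<noteq> 0}" arbitrary: f rule: finite_induct)
      case empty
      then have "f = \<zero>\<^bsub>?A\<^esub>"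
        by (auto simp: free_nonassoc_def)
      then show ?case
        using N.zero_closed by simp
    next
      case (insert t T)
      define g where "g = f(t := 0)"
      have T: "T = {s. g s \<noteq> 0}"
        using insert.hyps(2,4) by (auto simp: g_def)
      have "set_mset (letters t) \<subseteq> V"
        using insert.hyps(4) insert.prems by (auto simp: free_nonassoc_def)
      then have "(\<lambda>s. if s = t then 1 else 0) \<in> N"
        using ev by (simp add: eval_free_nonassoc)
      then have "f t \<odot>\<^bsub>?A\<^esub> (\<lambda>s. if s = t then 1 else 0) \<in> N"
        by (intro N.smult_closed) auto
      moreover have "g \<in> carrier ?A"
        using insert.hyps(1) T insert.prems by (auto simp: free_nonassoc_def g_def)
      then have "g \<in> N"
        using insert.hyps(3)[OF T] by simp
      ultimately have "f t \<odot>\<^bsub>?A\<^esub> (\<lambda>s. if s = t then 1 else 0) \<oplus>\<^bsub>?A\<^esub> g \<in> N"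
        by (rule N.m_closed)
      also have "f t \<odot>\<^bsub>?A\<^esub> (\<lambda>s. if s = t then 1 else 0) \<oplus>\<^bsub>?A\<^esub> g = f"
        by (auto simp: free_nonassoc_def g_def)
      finally show ?case .
    qed
  qed
qed

lemma lie_identities_subset:
  assumes "bilinear_algebra A"
  shows "lie_identities A \<subseteq> carrier A"
proof -
  interpret bilinear_algebra A by fact
  show ?thesis by (auto simp: lie_identities_def bracket_closed)
qed

lemma lie_identities_ideal:
  "alg_ideal (free_nonassoc V) (gen_ideal (free_nonassoc V) (lie_identities (free_nonassoc V)))"
  by (intro gen_ideal_ideal lie_identities_subset free_nonassoc_bilinear_algebra)

lemma free_lie_lie_algebra: "lie_algebra (free_lie V)"
  unfolding free_lie_def
  by (intro bilinear_algebra.quot_lie_algebra free_nonassoc_bilinear_algebra lie_identities_ideal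
      gen_ideal_superset)

lemma free_lie_generated: "bracket_generated (free_lie V) V (free_lie_gen V)"
  using bracket_generated_quot[OF free_nonassoc_bilinear_algebra lie_identities_ideal
      free_nonassoc_generated, of V]
  unfolding free_lie_def free_lie_gen_def by simp

lemma free_nilp_ideal: "alg_ideal (free_lie V) (lower_central (free_lie V) k)"
  using lie_algebra.lower_central_ideal[OF free_lie_lie_algebra] .

lemma lie_bilinear: "lie_algebra L \<Longrightarrow> bilinear_algebra L"
  unfolding lie_algebra_def
  by (simp add: bilinear_algebra_def bilinear_algebra_axioms_def lie_algebra_axioms_def)

lemma free_nilp_lie_algebra: "lie_algebra (free_nilp k V)"
  unfolding free_nilp_def by (intro lie_quot_lie_algebra free_lie_lie_algebra free_nilp_ideal)

lemma free_nilp_generated: "bracket_generated (free_nilp k V) V (free_nilp_gen k V)"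
  using bracket_generated_quot[OF lie_bilinear[OF free_lie_lie_algebra] free_nilp_ideal
      free_lie_generated, of V k]
  unfolding free_nilp_def free_nilp_gen_def by simp

lemma nonadjacent_ideal:
  "alg_ideal (free_nilp k (pverts G)) (gen_ideal (free_nilp k (pverts G)) (nonadjacent_brackets k G))"
proof (rule gen_ideal_ideal[OF lie_bilinear[OF free_nilp_lie_algebra]])
  show "nonadjacent_brackets k G \<subseteq> carrier (free_nilp k (pverts G))"
    unfolding nonadjacent_brackets_def
    by (auto intro!: lie_algebra.bracket_closed[OF free_nilp_lie_algebra]
        bracket_generated_closed[OF free_nilp_generated])
qed

lemma graph_lie_lie_algebra: "lie_algebra (graph_lie k G)"
  unfolding graph_lie_def by (intro lie_quot_lie_algebra free_nilp_lie_algebra nonadjacent_ideal)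

lemma graph_lie_generated: "bracket_generated (graph_lie k G) (pverts G) (graph_lie_gen k G)"
  using bracket_generated_quot[OF lie_bilinear[OF free_nilp_lie_algebra] nonadjacent_ideal
      free_nilp_generated, of k G]
  unfolding graph_lie_def graph_lie_gen_def by simp

lemma free_nilp_eval_zero:
  assumes t: "set_mset (letters t) \<subseteq> V" and k: "k < size (letters t)"
  shows "eval_bracketing (free_nilp k V) (free_nilp_gen k V) t = \<zero>\<^bsub>free_nilp k V\<^esub>"
proof -
  interpret F: lie_algebra "free_lie V" by (rule free_lie_lie_algebra)
  have g: "\<And>v. v \<in># letters t \<Longrightarrow> free_lie_gen V v \<in> carrier (free_lie V)"
    by (rule bracket_generated_closed[OF free_lie_generated]) (use t in auto)
  have "eval_bracketing (free_lie V) (free_lie_gen V) t \<in> lower_central (free_lie V) k"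
  proof (rule subsetD[OF F.lower_central_decreasing F.eval_in_lower_central[OF g]])
    show "k \<le> size (letters t) - 1"
      using k by simp
  qed
  from F.coset_zero[OF free_nilp_ideal this] show ?thesis
    unfolding free_nilp_def free_nilp_gen_def F.quot_zero
    by (simp only: eval_quot[OF F.bilinear_algebra_axioms free_nilp_ideal g])
qed

lemma graph_lie_eval:
  assumes "set_mset (letters t) \<subseteq> pverts G"
  shows "eval_bracketing (graph_lie k G) (graph_lie_gen k G) t =
    gen_ideal (free_nilp k (pverts G)) (nonadjacent_brackets k G)
      +>\<^bsub>free_nilp k (pverts G)\<^esub> eval_bracketing (free_nilp k (pverts G)) (free_nilp_gen k (pverts G)) t"
  unfolding graph_lie_def graph_lie_gen_def
proof (rule eval_quot[OF lie_bilinear[OF free_nilp_lie_algebra] nonadjacent_ideal])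
  show "free_nilp_gen k (pverts G) v \<in> carrier (free_nilp k (pverts G))" if "v \<in># letters t" for v
    by (rule bracket_generated_closed[OF free_nilp_generated]) (use assms that in auto)
qed

lemma graph_lie_zero:
  "\<zero>\<^bsub>graph_lie k G\<^esub> = gen_ideal (free_nilp k (pverts G)) (nonadjacent_brackets k G)"
  by (simp add: graph_lie_def quot_alg_def)

lemma graph_lie_eval_zero:
  assumes t: "set_mset (letters t) \<subseteq> pverts G" and k: "k < size (letters t)"
  shows "eval_bracketing (graph_lie k G) (graph_lie_gen k G) t = \<zero>\<^bsub>graph_lie k G\<^esub>"
proof -
  interpret N: lie_algebra "free_nilp k (pverts G)" by (rule free_nilp_lie_algebra)
  interpret S: LinearCombinations.submodule class_ring
    "gen_ideal (free_nilp k (pverts G)) (nonadjacent_brackets k G)" "free_nilp k (pverts G)"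
    using nonadjacent_ideal unfolding alg_ideal_def by blast
  show ?thesis
    unfolding graph_lie_eval[OF t] free_nilp_eval_zero[OF t k] graph_lie_zero
    by (rule N.coset_zero[OF nonadjacent_ideal S.zero_closed])
qed

lemma graph_lie_nonadjacent:
  assumes "u \<in> pverts G" "v \<in> pverts G" "(u, v) \<notin> parcs G" "(v, u) \<notin> parcs G"
  shows "graph_lie_gen k G u \<otimes>\<^bsub>graph_lie k G :: ('k::field_char_0, _) module\<^esub> graph_lie_gen k G v =
    \<zero>\<^bsub>graph_lie k G\<^esub>"
proof -
  let ?N = "free_nilp k (pverts G) :: ('k, _) module"
  interpret N: lie_algebra ?N by (rule free_nilp_lie_algebra)
  let ?b = "free_nilp_gen k (pverts G) u \<otimes>\<^bsub>?N\<^esub> free_nilp_gen k (pverts G) v"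
  have "?b \<in> nonadjacent_brackets k G"
    unfolding nonadjacent_brackets_def using assms by blast
  then have "?b \<in> gen_ideal (free_nilp k (pverts G)) (nonadjacent_brackets k G)"
    by (rule subsetD[OF gen_ideal_superset])
  note this [THEN N.coset_zero[OF nonadjacent_ideal]]
  moreover have "eval_bracketing (graph_lie k G :: ('k, _) module) (graph_lie_gen k G)
      (Brack (Letter u) (Letter v)) = gen_ideal ?N (nonadjacent_brackets k G) +>\<^bsub>?N\<^esub>
      eval_bracketing ?N (free_nilp_gen k (pverts G)) (Brack (Letter u) (Letter v))"
    using assms by (intro graph_lie_eval) auto
  ultimately show ?thesis
    by (simp add: graph_lie_zero)
qed

section \<open>The Lie algebra of a single chain\<close>

text \<open>
  The Lie algebra spanned by the elements that belong to one edge $(v_i, v_j)$ with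
  $\kappa_{i,j} = c$. An element is the function of its coefficients: index \<open>0\<close> stands for $v_j$ and
  index \<open>l\<close> for $w^l_{i,j}$, so that the bracket encodes $[w^l, v_j] = w^{l+1}$ for $l < c$. The
  carrier contains functions with entries beyond \<open>c\<close>; they never occur in brackets, and allowing
  them keeps the carrier equal to the whole type.
\<close>

definition chain_model :: "nat \<Rightarrow> ('k::field_char_0, nat \<Rightarrow> 'k) module" where
  "chain_model c = \<lparr>carrier = UNIV,
     mult = (\<lambda>x y n. if 2 \<le> n \<and> n \<le> c then x (n - 1) * y 0 - x 0 * y (n - 1) else 0),
     one = (\<lambda>n. 0), zero = (\<lambda>n. 0), add = (\<lambda>x y n. x n + y n), smult = (\<lambda>a x n. a * x n)\<rparr>"

lemma chain_model_simps [simp]: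
  "carrier (chain_model c) = UNIV"
  "x \<otimes>\<^bsub>chain_model c\<^esub> y = (\<lambda>n. if 2 \<le> n \<and> n \<le> c then x (n - 1) * y 0 - x 0 * y (n - 1) else 0)"
  "\<zero>\<^bsub>chain_model c\<^esub> = (\<lambda>n. 0)"
  "x \<oplus>\<^bsub>chain_model c\<^esub> y = (\<lambda>n. x n + y n)"
  "a \<odot>\<^bsub>chain_model c\<^esub> x = (\<lambda>n. a * x n)"
  by (simp_all add: chain_model_def)

lemma chain_model_lie_algebra: "lie_algebra (chain_model c :: ('k::field_char_0, _) module)"
proof -
  let ?M = "chain_model c :: ('k, _) module"
  have "vectorspace class_ring ?M"
  proof (rule vs_criteria)
    show "Ring.field (class_ring :: 'k ring)"
      by (rule class_field)
    show "\<forall>v\<in>carrier ?M. \<exists>w\<in>carrier ?M. v \<oplus>\<^bsub>?M\<^esub> w = \<zero>\<^bsub>?M\<^esub>"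
    proof
      fix v :: "nat \<Rightarrow> 'k"
      show "\<exists>w\<in>carrier ?M. v \<oplus>\<^bsub>?M\<^esub> w = \<zero>\<^bsub>?M\<^esub>"
        by (intro bexI[of _ "\<lambda>n. - v n"]) auto
    qed
  qed (auto simp: algebra_simps)
  moreover have "lie_algebra_axioms ?M"
    by unfold_locales (auto simp: fun_eq_iff algebra_simps)
  ultimately show ?thesis
    by (rule lie_algebra.intro)
qed

text \<open>
  Each bracket moves the support up by one place: the coefficient of $w^l$ in a bracket comes from
  that of $w^{l-1}$. So the term $L^{n+2}$ lives on the indices from \<open>n + 2\<close> to \<open>c\<close>.
\<close>

lemma chain_model_lower_central:
  assumes "x \<in> lower_central (chain_model c) (Suc n)" "m \<le> Suc n \<or> c < m"
  shows "x m = (0::'k::field_char_0)"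
  using assms
proof (induction n arbitrary: x m)
  case 0
  interpret lie_algebra "chain_model c :: ('k, _) module" by (rule chain_model_lie_algebra)
  let ?N = "{x. \<forall>m. m \<le> Suc 0 \<or> c < m \<longrightarrow> x m = (0::'k)}"
  have "LinearCombinations.submodule class_ring ?N (chain_model c)"
    by (rule submodule_classI) auto
  moreover have "{x \<otimes>\<^bsub>chain_model c\<^esub> y | x y. x \<in> lower_central (chain_model c) 0 \<and>
      y \<in> carrier (chain_model c)} \<subseteq> ?N"
    by auto
  ultimately have "lower_central (chain_model c) (Suc 0) \<subseteq> ?N"
    unfolding lower_central.simps(2) by (rule span_minimal)
  then show ?case
    using "0.prems" by blast
next
  case (Suc n)
  interpret lie_algebra "chain_model c :: ('k, _) module" by (rule chain_model_lie_algebra)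
  let ?N = "{x. \<forall>m. m \<le> Suc (Suc n) \<or> c < m \<longrightarrow> x m = (0::'k)}"
  have "LinearCombinations.submodule class_ring ?N (chain_model c)"
    by (rule submodule_classI) auto
  moreover have "{x \<otimes>\<^bsub>chain_model c\<^esub> y | x y. x \<in> lower_central (chain_model c) (Suc n) \<and>
      y \<in> carrier (chain_model c)} \<subseteq> ?N"
  proof clarify
    fix x y :: "nat \<Rightarrow> 'k" and m
    assume x: "x \<in> lower_central (chain_model c) (Suc n)" and m: "m \<le> Suc (Suc n) \<or> c < m"
    have "x 0 = 0"
      using Suc.IH[OF x, of 0] by simp
    moreover have "x (m - 1) = 0" if "m \<le> c"
    proof (rule Suc.IH[OF x])
      show "m - 1 \<le> Suc n \<or> c < m - 1"
        using m that by linarith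
    qed
    ultimately show "(x \<otimes>\<^bsub>chain_model c\<^esub> y) m = 0"
      by simp
  qed
  ultimately have "lower_central (chain_model c) (Suc (Suc n)) \<subseteq> ?N"
    unfolding lower_central.simps(2)[of _ "Suc n"] by (rule span_minimal)
  then show ?case
    using Suc.prems by blast
qed

lemma chain_model_nilpotent:
  assumes "x \<in> lower_central (chain_model c) k" "1 \<le> c" "c \<le> k"
  shows "x = (\<lambda>n. 0::'k::field_char_0)"
proof
  fix m
  obtain n where n: "k = Suc n"
    using assms(2,3) by (cases k) auto
  show "x m = 0"
  proof (rule chain_model_lower_central)
    show "x \<in> lower_central (chain_model c) (Suc n)"
      using assms(1) by (simp only: n)
    show "m \<le> Suc n \<or> c < m"
      using assms(3) n by linarith
  qed
qed

text \<open>
  The universal property of the free nonassociative algebra: extend the values on the bracketings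
  linearly.
\<close>

lemma free_nonassoc_chain_hom:
  fixes \<gamma> :: "'v \<Rightarrow> nat \<Rightarrow> 'k::field_char_0"
  obtains h where "alg_hom (free_nonassoc V) (chain_model c) h"
    "\<And>v. h (\<lambda>s. if s = Letter v then 1 else 0) = \<gamma> v"
proof -
  let ?A = "free_nonassoc V :: ('k, _) module"
  define e where "e = (eval_bracketing (chain_model c) \<gamma> :: 'v bracketing \<Rightarrow> nat \<Rightarrow> 'k)"
  define h where "h = (\<lambda>(f :: 'v bracketing \<Rightarrow> 'k) n. \<Sum>t | f t \<noteq> 0. f t * e t n)"
  have h_eq: "h f n = (\<Sum>t\<in>T. f t * e t n)" if "finite T" "{t. f t \<noteq> 0} \<subseteq> T" for f T n
    unfolding h_def using that by (intro sum.mono_neutral_left) auto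
  have fin: "finite {t. f t \<noteq> 0}" if "f \<in> carrier ?A" for f
    using that by (simp add: free_nonassoc_def)
  have "h (f \<oplus>\<^bsub>?A\<^esub> g) = h f \<oplus>\<^bsub>chain_model c\<^esub> h g"
    if f: "f \<in> carrier ?A" and g: "g \<in> carrier ?A" for f g
  proof
    fix n
    let ?T = "{t. f t \<noteq> 0} \<union> {t. g t \<noteq> 0}"
    have T: "finite ?T"
      using fin f g by simp
    have "{t. f t + g t \<noteq> 0} \<subseteq> ?T"
      by auto
    from h_eq[OF T this] have "h (f \<oplus>\<^bsub>?A\<^esub> g) n = (\<Sum>t\<in>?T. (f t + g t) * e t n)"
      by (simp add: free_nonassoc_def)
    then show "h (f \<oplus>\<^bsub>?A\<^esub> g) n = (h f \<oplus>\<^bsub>chain_model c\<^esub> h g) n"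
      using h_eq[of ?T f n] h_eq[of ?T g n] T by (simp add: sum.distrib distrib_right)
  qed
  moreover have "h (a \<odot>\<^bsub>?A\<^esub> f) = a \<odot>\<^bsub>chain_model c\<^esub> h f" if f: "f \<in> carrier ?A" for a f
  proof
    fix n
    have "h (a \<odot>\<^bsub>?A\<^esub> f) n = (\<Sum>t | f t \<noteq> 0. a * f t * e t n)"
      using h_eq[of "{t. f t \<noteq> 0}" "\<lambda>t. a * f t" n] fin[OF f] by (auto simp: free_nonassoc_def)
    then show "h (a \<odot>\<^bsub>?A\<^esub> f) n = (a \<odot>\<^bsub>chain_model c\<^esub> h f) n"
      by (simp add: h_def sum_distrib_left mult.assoc)
  qed
  moreover have "h (f \<otimes>\<^bsub>?A\<^esub> g) = h f \<otimes>\<^bsub>chain_model c\<^esub> h g"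
    if f: "f \<in> carrier ?A" and g: "g \<in> carrier ?A" for f g
  proof
    fix n
    let ?F = "{t. f t \<noteq> 0}" and ?G = "{t. g t \<noteq> 0}"
    let ?B = "\<lambda>(s, u). Brack s u"
    have "{t. (f \<otimes>\<^bsub>?A\<^esub> g) t \<noteq> 0} \<subseteq> ?B ` (?F \<times> ?G)"
    proof
      fix t assume "t \<in> {t. (f \<otimes>\<^bsub>?A\<^esub> g) t \<noteq> 0}"
      then show "t \<in> ?B ` (?F \<times> ?G)"
        by (cases t) (auto simp: free_nonassoc_def)
    qed
    moreover have "finite (?B ` (?F \<times> ?G))"
      using fin[OF f] fin[OF g] by simp
    ultimately have "h (f \<otimes>\<^bsub>?A\<^esub> g) n = (\<Sum>t\<in>?B ` (?F \<times> ?G). (f \<otimes>\<^bsub>?A\<^esub> g) t * e t n)"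
      by (intro h_eq) auto
    also have "\<dots> = (\<Sum>p\<in>?F \<times> ?G. (f \<otimes>\<^bsub>?A\<^esub> g) (?B p) * e (?B p) n)"
      by (subst sum.reindex) (auto simp: inj_on_def)
    also have "\<dots> = (\<Sum>(s, u)\<in>?F \<times> ?G. f s * g u *
        (if 2 \<le> n \<and> n \<le> c then e s (n - 1) * e u 0 - e s 0 * e u (n - 1) else 0))"
      by (intro sum.cong) (auto simp: free_nonassoc_def e_def)
    also have "\<dots> = (h f \<otimes>\<^bsub>chain_model c\<^esub> h g) n"
    proof (cases "2 \<le> n \<and> n \<le> c")
      case True
      have prod: "h f a * h g b = (\<Sum>(s, u)\<in>?F \<times> ?G. f s * g u * (e s a * e u b))" for a b
        unfolding h_def sum_product sum.cartesian_product by (rule sum.cong) (auto simp: mult_ac)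
      show ?thesis
        using True by (simp add: prod split_def right_diff_distrib flip: sum_subtractf)
    qed auto
    finally show "h (f \<otimes>\<^bsub>?A\<^esub> g) n = (h f \<otimes>\<^bsub>chain_model c\<^esub> h g) n" .
  qed
  ultimately have "alg_hom ?A (chain_model c) h"
    by (simp add: alg_hom_def del: chain_model_simps(2-))
  moreover have "h (\<lambda>s. if s = Letter v then 1 else 0) = \<gamma> v" for v
  proof
    fix n
    show "h (\<lambda>s. if s = Letter v then 1 else 0) n = \<gamma> v n"
      by (subst h_eq[of "{Letter v}"]) (auto simp: e_def)
  qed
  ultimately show thesis
    using that by blast
qed

text \<open>
  The universal property of $\mathfrak g(k, G)$ with respect to the chain model. The map on the free
  nonassociative algebra descends through the three quotients in turn: it kills the Lie identities
  since the model is a Lie algebra, the term $L^{k+1}$ since the model is nilpotent of step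
  $c \le k$, and the brackets of nonadjacent vertices by hypothesis.
\<close>

lemma graph_lie_chain_hom:
  fixes \<gamma> :: "'v \<Rightarrow> nat \<Rightarrow> 'k::field_char_0"
  assumes c: "1 \<le> c" "c \<le> k"
    and nonadj: "\<And>u v. u \<in> pverts G \<Longrightarrow> v \<in> pverts G \<Longrightarrow> (u, v) \<notin> parcs G \<Longrightarrow> (v, u) \<notin> parcs G \<Longrightarrow>
      \<gamma> u \<otimes>\<^bsub>chain_model c\<^esub> \<gamma> v = \<zero>\<^bsub>chain_model c\<^esub>"
  obtains h where "alg_hom (graph_lie k G) (chain_model c) h"
    "\<And>v. v \<in> pverts G \<Longrightarrow> h (graph_lie_gen k G v) = \<gamma> v"
proof -
  let ?V = "pverts G"
  let ?A = "free_nonassoc ?V :: ('k, _) module" and ?L = "free_lie ?V :: ('k, _) module"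
    and ?N = "free_nilp k ?V :: ('k, _) module" and ?M = "chain_model c :: ('k, _) module"
  have lieM: "lie_algebra ?M" and lieL: "lie_algebra ?L" and lieN: "lie_algebra ?N"
    and bilA: "bilinear_algebra ?A"
    by (rule chain_model_lie_algebra free_lie_lie_algebra free_nilp_lie_algebra
        free_nonassoc_bilinear_algebra)+
  interpret M: lie_algebra ?M by (rule lieM)
  note bilM = M.bilinear_algebra_axioms
  obtain h0 where h0: "alg_hom ?A ?M h0" "\<And>v. h0 (\<lambda>s. if s = Letter v then 1 else 0) = \<gamma> v"
    using free_nonassoc_chain_hom[of ?V c \<gamma>] by blast
  have hom0: "h0 x \<in> carrier ?M" "h0 (x \<oplus>\<^bsub>?A\<^esub> y) = h0 x \<oplus>\<^bsub>?M\<^esub> h0 y" "h0 (x \<otimes>\<^bsub>?A\<^esub> y) = h0 x \<otimes>\<^bsub>?M\<^esub> h0 y"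
    if "x \<in> carrier ?A" "y \<in> carrier ?A" for x y
    using alg_homD[OF h0(1)] that by blast+
  interpret A: bilinear_algebra ?A by (rule bilA)
  have "h0 z = \<zero>\<^bsub>?M\<^esub>" if "z \<in> lie_identities ?A" for z
    using that unfolding lie_identities_def
  proof (elim UnE CollectE exE conjE)
    fix x assume "z = x \<otimes>\<^bsub>?A\<^esub> x" "x \<in> carrier ?A"
    then show ?thesis
      using hom0[of x x] M.bracket_self[of "h0 x"] by (simp only:)
  next
    fix x y w assume "z = (x \<otimes>\<^bsub>?A\<^esub> y) \<otimes>\<^bsub>?A\<^esub> w \<oplus>\<^bsub>?A\<^esub> (y \<otimes>\<^bsub>?A\<^esub> w) \<otimes>\<^bsub>?A\<^esub> x \<oplus>\<^bsub>?A\<^esub> (w \<otimes>\<^bsub>?A\<^esub> x) \<otimes>\<^bsub>?A\<^esub> y"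
      "x \<in> carrier ?A" "y \<in> carrier ?A" "w \<in> carrier ?A"
    then show ?thesis
      using M.jacobi[of "h0 x" "h0 y" "h0 w"]
      by (simp add: hom0 A.bracket_closed del: chain_model_simps)
  qed
  then have "lie_identities ?A \<subseteq> {x \<in> carrier ?A. h0 x = \<zero>\<^bsub>?M\<^esub>}"
    using lie_identities_subset[OF bilA] by blast
  from gen_ideal_minimal[OF alg_hom_kernel_ideal[OF bilA bilM h0(1)] this]
  have kill0: "h0 x = \<zero>\<^bsub>?M\<^esub>" if "x \<in> gen_ideal ?A (lie_identities ?A)" for x
    using that by blast
  define h1 where "h1 = coset_lift h0"
  have h1: "alg_hom ?L ?M h1"
    unfolding h1_def free_lie_def
    by (rule coset_lift_hom[OF bilA bilM h0(1) lie_identities_ideal kill0])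
  have gen1: "h1 (free_lie_gen ?V v) = \<gamma> v" if "v \<in> ?V" for v
    unfolding h1_def free_lie_gen_def
  proof -
    have "(\<lambda>s. if s = Letter v then 1 else 0) \<in> carrier ?A"
      using that by (auto simp: free_nonassoc_def split: if_splits)
    from coset_lift_coset[OF bilA bilM h0(1) lie_identities_ideal kill0 this]
    show "coset_lift h0 (gen_ideal ?A (lie_identities ?A) +>\<^bsub>?A\<^esub>
        (\<lambda>s. if s = Letter v then 1 else 0)) = \<gamma> v"
      by (simp only: h0(2))
  qed
  have kill1: "h1 x = \<zero>\<^bsub>?M\<^esub>" if "x \<in> lower_central ?L k" for x
    using chain_model_nilpotent[OF alg_hom_lower_central[OF lieL lieM h1 that] c] by simp
  define h2 where "h2 = coset_lift h1"
  have h2: "alg_hom ?N ?M h2"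
    unfolding h2_def free_nilp_def
    by (rule coset_lift_hom[OF lie_bilinear[OF lieL] bilM h1 free_nilp_ideal kill1])
  have gen2: "h2 (free_nilp_gen k ?V v) = \<gamma> v" if "v \<in> ?V" for v
  proof -
    have "free_lie_gen ?V v \<in> carrier ?L"
      by (rule bracket_generated_closed[OF free_lie_generated that])
    from coset_lift_coset[OF lie_bilinear[OF lieL] bilM h1 free_nilp_ideal kill1 this]
    show ?thesis
      unfolding h2_def free_nilp_gen_def by (simp only: gen1[OF that])
  qed
  have "nonadjacent_brackets k G \<subseteq> {x \<in> carrier ?N. h2 x = \<zero>\<^bsub>?M\<^esub>}"
  proof
    fix x assume "x \<in> (nonadjacent_brackets k G :: ('v bracketing \<Rightarrow> 'k) set set set)"
    then obtain u v where uv: "x = free_nilp_gen k ?V u \<otimes>\<^bsub>?N\<^esub> free_nilp_gen k ?V v"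
      "u \<in> ?V" "v \<in> ?V" "(u, v) \<notin> parcs G" "(v, u) \<notin> parcs G"
      unfolding nonadjacent_brackets_def by blast
    note g = bracket_generated_closed[OF free_nilp_generated uv(2)]
      bracket_generated_closed[OF free_nilp_generated uv(3)]
    show "x \<in> {x \<in> carrier ?N. h2 x = \<zero>\<^bsub>?M\<^esub>}"
      using lie_algebra.bracket_closed[OF lieN g] alg_homD(4)[OF h2 g] nonadj[OF uv(2-5)]
        gen2[OF uv(2)] gen2[OF uv(3)]
      unfolding uv(1) by (simp del: chain_model_simps)
  qed
  from gen_ideal_minimal[OF alg_hom_kernel_ideal[OF lie_bilinear[OF lieN] bilM h2] this]
  have kill2: "h2 x = \<zero>\<^bsub>?M\<^esub>" if "x \<in> gen_ideal ?N (nonadjacent_brackets k G)" for x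
    using that by blast
  have "alg_hom (graph_lie k G) ?M (coset_lift h2)"
    unfolding graph_lie_def
    by (rule coset_lift_hom[OF lie_bilinear[OF lieN] bilM h2 nonadjacent_ideal kill2])
  moreover have "coset_lift h2 (graph_lie_gen k G v) = \<gamma> v" if "v \<in> ?V" for v
  proof -
    have "free_nilp_gen k ?V v \<in> carrier ?N"
      by (rule bracket_generated_closed[OF free_nilp_generated that])
    from coset_lift_coset[OF lie_bilinear[OF lieN] bilM h2 nonadjacent_ideal kill2 this]
    show ?thesis
      unfolding graph_lie_gen_def by (simp only: gen2[OF that])
  qed
  ultimately show thesis
    using that by blast
qed

section \<open>Multidegrees in the chain model\<close>

text \<open>
  The homomorphism of an edge respects multidegrees: with $v_i$ sent to $w^1$, $v_j$ to itself and
  the other vertices to \<open>0\<close>, the coefficient of $w^n$ only sees multidegree $e_i + (n - 1) e_j$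
  and the coefficient of $v_j$ only sees $e_j$.
\<close>

lemma chain_model_eval_degree:
  fixes i j :: 'v and c :: nat
  assumes "1 \<le> c" "i \<noteq> j"
    and \<gamma>: "\<gamma> = (\<lambda>v n. if v = i then (if n = 1 then 1 else 0)
      else if v = j then (if n = 0 then 1 else 0) else (0::'k::field_char_0))"
    and nz: "eval_bracketing (chain_model c) \<gamma> t n \<noteq> 0"
  shows "n = 0 \<and> letters t = {#j#} \<or>
    1 \<le> n \<and> n \<le> c \<and> letters t = {#i#} + replicate_mset (n - 1) j"
  using nz
proof (induction t arbitrary: n)
  case (Letter v)
  then show ?case
    using assms(1,2) by (auto simp: \<gamma> split: if_splits)
next
  case (Brack s u)
  let ?e = "eval_bracketing (chain_model c) \<gamma>"
  have n: "2 \<le> n" "n \<le> c" and "?e s (n - 1) * ?e u 0 - ?e s 0 * ?e u (n - 1) \<noteq> 0"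
    using Brack.prems by (auto split: if_splits)
  then have "?e s (n - 1) \<noteq> 0 \<and> ?e u 0 \<noteq> 0 \<or> ?e s 0 \<noteq> 0 \<and> ?e u (n - 1) \<noteq> 0"
    by auto
  moreover have "replicate_mset (n - 1) j = add_mset j (replicate_mset (n - 1 - 1) j)"
    using n by (cases "n - 1") auto
  ultimately show ?case
    using Brack.IH(1)[of "n - 1"] Brack.IH(1)[of 0] Brack.IH(2)[of "n - 1"] Brack.IH(2)[of 0] n
    by auto
qed

text \<open>
  The bracketing whose value is $w^{l+1}$ for the edge \<open>e\<close>; the index is shifted because
  $w^1$ is a single letter.
\<close>

primrec chain_bracketing :: "'v \<times> 'v \<Rightarrow> nat \<Rightarrow> 'v bracketing" where
  "chain_bracketing e 0 = Letter (fst e)"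
| "chain_bracketing e (Suc l) = Brack (chain_bracketing e l) (Letter (snd e))"

lemma letters_chain_bracketing:
  "letters (chain_bracketing e l) = {#fst e#} + replicate_mset l (snd e)"
  by (induction l) auto

lemma chain_model_eval_chain:
  assumes "l < c" "i \<noteq> j"
    and \<gamma>: "\<gamma> = (\<lambda>v n. if v = i then (if n = 1 then 1 else 0)
      else if v = j then (if n = 0 then 1 else 0) else (0::'k::field_char_0))"
  shows "eval_bracketing (chain_model c) \<gamma> (chain_bracketing (i, j) l) =
    (\<lambda>n. if n = Suc l then 1 else 0)"
  using assms(1)
proof (induction l)
  case (Suc l)
  then show ?case
    using assms(2) by (auto simp: \<gamma> fun_eq_iff)
qed (auto simp: \<gamma>)

lemma letters_ne_empty: "letters t \<noteq> {#}"
  using size_letters_pos[of t] by auto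

lemma letters_singleton: "letters t = {#v#} \<Longrightarrow> t = Letter v"
  using letters_ne_empty by (cases t) (auto simp: union_is_single)

context lie_algebra
begin

text \<open>
  Somewhere in the bracketing two single letters \<open>j\<close> meet, and $[v_j, v_j] = 0$.
\<close>

lemma eval_replicate_zero:
  assumes "\<gamma> j \<in> carrier L" "letters t = replicate_mset m j" "2 \<le> m"
  shows "eval_bracketing L \<gamma> t = \<zero>"
  using assms(2,3)
proof (induction t arbitrary: m)
  case (Letter v)
  then have "size {#v#} = m" by simp
  then show ?case using Letter by simp
next
  case (Brack s u)
  have sub: "letters s \<subseteq># replicate_mset m j" "letters u \<subseteq># replicate_mset m j"
    using Brack.prems(1) by (auto simp flip: Brack.prems(1))
  obtain a where a: "letters s = replicate_mset a j"
    using sub(1) by (rule msubseteq_replicate_msetE)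
  obtain b where b: "letters u = replicate_mset b j"
    using sub(2) by (rule msubseteq_replicate_msetE)
  have pos: "1 \<le> a" "1 \<le> b"
    using letters_ne_empty[of s] letters_ne_empty[of u] a b by (auto simp: Suc_le_eq)
  have c: "eval_bracketing L \<gamma> s \<in> carrier L" "eval_bracketing L \<gamma> u \<in> carrier L"
    using assms(1) a b by (auto intro!: eval_closed split: if_splits)
  show ?case
  proof (cases "a = 1 \<and> b = 1")
    case True
    then have "s = Letter j" "u = Letter j"
      using a b by (auto intro: letters_singleton)
    then show ?thesis
      using assms(1) by (simp add: bracket_self)
  next
    case False
    then have "eval_bracketing L \<gamma> s = \<zero> \<or> eval_bracketing L \<gamma> u = \<zero>"
      using Brack.IH(1)[OF a] Brack.IH(2)[OF b] pos by force
    then show ?thesis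
      using c by (auto simp: bracket_zero_left bracket_zero_right)
  qed
qed

text \<open>
  In multidegree $e_i + m e_j$ every Lie algebra has at most the one element $w^{m+1}$, up to scalars:
  of the two factors of a bracket one contains no $v_i$, so by \<open>eval_replicate_zero\<close> it
  vanishes or is the single letter $v_j$.
\<close>

lemma eval_chain_degree:
  assumes \<gamma>: "\<gamma> i \<in> carrier L" "\<gamma> j \<in> carrier L" and "i \<noteq> j"
    and "letters t = {#i#} + replicate_mset m j"
  shows "\<exists>a. eval_bracketing L \<gamma> t = a \<odot>\<^bsub>L\<^esub> eval_bracketing L \<gamma> (chain_bracketing (i, j) m)"
  using assms(4)
proof (induction t arbitrary: m)
  case (Letter v)
  then have "m = 0" "v = i"
    by (auto simp: single_is_union)
  then show ?case
    using \<gamma> by (intro exI[of _ 1]) (simp add: scale_one)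
next
  case (Brack s u)
  have closed: "eval_bracketing L \<gamma> t \<in> carrier L" if "set_mset (letters t) \<subseteq> {i, j}" for t
    using \<gamma> that by (intro eval_closed) auto
  have *: "\<exists>a. eval_bracketing L \<gamma> x \<otimes> eval_bracketing L \<gamma> y =
      a \<odot>\<^bsub>L\<^esub> eval_bracketing L \<gamma> (chain_bracketing (i, j) m)"
    if xy: "letters x + letters y = {#i#} + replicate_mset m j" and ix: "i \<in># letters x"
      and IH: "\<And>m. letters x = {#i#} + replicate_mset m j \<Longrightarrow>
        \<exists>a. eval_bracketing L \<gamma> x = a \<odot>\<^bsub>L\<^esub> eval_bracketing L \<gamma> (chain_bracketing (i, j) m)" for x y
  proof -
    obtain X where X: "letters x = add_mset i X"
      using ix by (metis multi_member_split)
    then have XY: "X + letters y = replicate_mset m j"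
      using xy by simp
    then have sub: "X \<subseteq># replicate_mset m j" "letters y \<subseteq># replicate_mset m j"
      by (auto simp flip: XY)
    obtain a where a: "X = replicate_mset a j"
      using sub(1) by (rule msubseteq_replicate_msetE)
    obtain b where b: "letters y = replicate_mset b j"
      using sub(2) by (rule msubseteq_replicate_msetE)
    have "size (X + letters y) = m"
      unfolding XY by simp
    then have m: "m = a + b"
      using a b by simp
    have "1 \<le> b"
      using letters_ne_empty[of y] b by (auto simp: Suc_le_eq)
    obtain r where r: "eval_bracketing L \<gamma> x =
        r \<odot>\<^bsub>L\<^esub> eval_bracketing L \<gamma> (chain_bracketing (i, j) a)"
      using IH[of a] X a by auto
    have c: "eval_bracketing L \<gamma> x \<in> carrier L"
      "eval_bracketing L \<gamma> (chain_bracketing (i, j) l) \<in> carrier L" for l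
      using X a by (auto intro!: closed simp: letters_chain_bracketing split: if_splits)
    show ?thesis
    proof (cases "b = 1")
      case True
      then have "y = Letter j"
        using b by (intro letters_singleton) simp
      then show ?thesis
        using r c \<gamma> True m by (intro exI[of _ r]) (simp add: bracket_smult_left)
    next
      case False
      then have "2 \<le> b"
        using \<open>1 \<le> b\<close> by simp
      with \<gamma>(2) b have "eval_bracketing L \<gamma> y = \<zero>"
        by (rule eval_replicate_zero)
      then show ?thesis
        using c by (intro exI[of _ 0]) (simp add: bracket_zero_right scale_zero)
    qed
  qed
  have c: "eval_bracketing L \<gamma> s \<in> carrier L" "eval_bracketing L \<gamma> u \<in> carrier L"
    "eval_bracketing L \<gamma> (chain_bracketing (i, j) m) \<in> carrier L"
  proof -
    have "set_mset (letters s + letters u) \<subseteq> {i, j}"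
      using Brack.prems by auto
    then show "eval_bracketing L \<gamma> s \<in> carrier L" "eval_bracketing L \<gamma> u \<in> carrier L"
      by (auto intro!: closed)
  qed (auto intro!: closed simp: letters_chain_bracketing split: if_splits)
  have "i \<in># letters s + letters u"
    using Brack.prems by simp
  then consider "i \<in># letters s" | "i \<in># letters u"
    by auto
  then show ?case
  proof cases
    case 1
    then show ?thesis
      using *[of s u] Brack.prems Brack.IH(1) by simp
  next
    case 2
    then obtain a where a: "eval_bracketing L \<gamma> u \<otimes> eval_bracketing L \<gamma> s =
        a \<odot>\<^bsub>L\<^esub> eval_bracketing L \<gamma> (chain_bracketing (i, j) m)"
      using *[of u s] Brack.prems Brack.IH(2) by (auto simp: add.commute)
    then show ?thesis
      using bracket_anticomm[OF c(2,1)] c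
      by (intro exI[of _ "- 1 * a"]) (simp only: eval_bracketing.simps scale_scale)
  qed
qed

end

section \<open>Trees directed to the root\<close>

lemma pcas_snoc: "pcas u p b \<Longrightarrow> pcas u (p @ [(b, x)]) x"
  by (induction p arbitrary: u) auto

lemma pawalk_verts_snoc: "pcas u p b \<Longrightarrow> pawalk_verts u (p @ [(b, x)]) = pawalk_verts u p @ [x]"
  by (induction p arbitrary: u) auto

lemma pawalk_verts_Cons: "pcas u p b \<Longrightarrow> pawalk_verts u p = u # tl (pawalk_verts u p)"
  by (cases p) auto

text \<open>
  If the ends of an edge remained connected after deleting it, a simple path between them together
  with the edge would be a cycle. It has length at least 3: a path consisting of one arc would
  be the deleted arc itself or its reverse, and the reverse is not an arc of \<open>G\<close>.
\<close>

lemma tree_edge_is_bridge: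
  fixes G :: "'v pair_pre_digraph"
  assumes wf: "pair_wf_digraph G"
    and antisym: "\<And>u v. (u, v) \<in> parcs G \<Longrightarrow> (v, u) \<notin> parcs G"
    and cycles: "\<And>p. pre_digraph.cycle (with_proj (mk_symmetric (with_proj G))) p \<Longrightarrow> length p \<le> 2"
    and e: "(u, b) \<in> parcs G"
  shows "(u, b) \<notin> ((parcs G - {(u, b)}) \<union> (parcs G - {(u, b)})\<inverse>)\<^sup>*"
proof
  let ?S = "(parcs G - {(u, b)}) \<union> (parcs G - {(u, b)})\<inverse>"
  assume path: "(u, b) \<in> ?S\<^sup>*"
  interpret G: pair_wf_digraph G by fact
  define H where "H = \<lparr>pverts = pverts G, parcs = ?S\<rparr>"
  have H [simp]: "pverts H = pverts G" "parcs H = ?S"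
    by (simp_all add: H_def)
  interpret H: pair_wf_digraph H
    by unfold_locales (auto dest: G.arc_fst_in_verts G.arc_snd_in_verts G.wellformed')
  have "(u, y) \<in> rtrancl_on (pverts G) ?S" if "(u, y) \<in> ?S\<^sup>*" for y
    using that
  proof (induction rule: rtrancl_induct)
    case base
    show ?case using e G.wellformed' by auto
  next
    case (step y z)
    then have "z \<in> pverts G"
      using G.wellformed' by auto
    with step show ?case
      by (blast intro: rtrancl_on_into_rtrancl_on)
  qed
  from this[OF path] have "(u, b) \<in> rtrancl_on (pverts G) ?S" .
  then have "u \<rightarrow>\<^sup>*\<^bsub>with_proj H\<^esub> b"
    by (simp add: reachable_def)
  then obtain p where "H.apath u p b"
    using H.reachable_apath by blast
  then have p: "set p \<subseteq> ?S" "pcas u p b" "distinct (pawalk_verts u p)"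
    by (auto simp: H.apath_def H.awalk_def)
  have uv: "u \<in> pverts G"
    using e G.wellformed' by blast
  interpret S: pair_wf_digraph "mk_symmetric (with_proj G)"
    by unfold_locales (auto simp: mk_symmetric_def dest: G.arc_fst_in_verts G.arc_snd_in_verts)
  have parcs_sym: "parcs (mk_symmetric (with_proj G)) = parcs G \<union> (parcs G)\<inverse>"
    by (force simp: mk_symmetric_def)
  have "S.cycle (p @ [(b, u)])"
    unfolding S.cycle_def
  proof (intro exI[of _ u] conjI)
    show "S.awalk u (p @ [(b, u)]) u"
      unfolding S.awalk_def using uv p(1) e pcas_snoc[OF p(2), of u]
      by (auto simp: parcs_sym)
    show "distinct (tl (pawalk_verts u (p @ [(b, u)])))"
      using p(3) pawalk_verts_Cons[OF p(2)] unfolding pawalk_verts_snoc[OF p(2)]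
      by (metis distinct.simps(2) distinct1_rotate list.sel(3) rotate1.simps(2) append_Cons)
  qed simp
  then have "length (p @ [(b, u)]) \<le> 2"
    by (rule cycles)
  then have "length p \<le> 1"
    by simp
  then consider "p = []" | a where "p = [a]"
    by (cases p) auto
  then show False
  proof cases
    case 1
    then show False using p(2) e antisym by auto
  next
    case 2
    then have "a = (u, b)"
      using p(2) by (cases a) auto
    then show False
      using 2 p(1) e antisym by auto
  qed
qed

text \<open>
  A path that starts at \<open>b\<close> may be shortened to begin at its last visit of \<open>b\<close>, so it
  can avoid any given arc into \<open>b\<close>.
\<close>

lemma rtrancl_avoid_entry: "(b, y) \<in> E\<^sup>* \<Longrightarrow> (b, y) \<in> (E - {(u, b)})\<^sup>*"
proof (induction rule: rtrancl_induct)
  case (step y z)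
  show ?case
  proof (cases "z = b")
    case False
    then have "(y, z) \<in> E - {(u, b)}"
      using step.hyps(2) by simp
    with step.IH show ?thesis by (rule rtrancl_into_rtrancl)
  qed simp
qed simp

text \<open>
  Cut the path at its last departure from \<open>u\<close>, if there is one.
\<close>

lemma rtrancl_last_exit:
  "(x, r) \<in> E\<^sup>* \<Longrightarrow> (x, r) \<in> (E - {u} \<times> UNIV)\<^sup>* \<or> (\<exists>a. (u, a) \<in> E \<and> (a, r) \<in> (E - {u} \<times> UNIV)\<^sup>*)"
proof (induction rule: converse_rtrancl_induct)
  case (step x y)
  show ?case
  proof (cases "x = u")
    case False
    then have "(x, y) \<in> E - {u} \<times> UNIV"
      using step.hyps(1) by simp
    then show ?thesis
      using step.IH by (auto intro: converse_rtrancl_into_rtrancl)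
  qed (use step in auto)
qed simp

context
  fixes \<kappa> :: "'v \<times> 'v \<Rightarrow> nat" and G :: "'v pair_pre_digraph" and r :: 'v
  assumes chain: "chain_digraph \<kappa> G" and root: "directed_to_root G r"
begin

lemma rooted_bridge:
  assumes "(u, b) \<in> parcs G"
  shows "(u, b) \<notin> ((parcs G - {(u, b)}) \<union> (parcs G - {(u, b)})\<inverse>)\<^sup>*"
proof (rule tree_edge_is_bridge)
  show "pair_wf_digraph G"
    using chain by (simp add: chain_digraph_def pair_fin_digraph_def)
qed (use chain root assms in \<open>auto simp: chain_digraph_def directed_to_root_def undirected_tree_def\<close>)

lemma rooted_reach: "u \<in> pverts G \<Longrightarrow> (u, r) \<in> (parcs G)\<^sup>*"
  using root rtrancl_on_rtranclI[of u r "pverts G" "parcs G"]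
  by (cases "u = r") (auto simp: directed_to_root_def reachable_def)

lemma rooted_verts: "(u, v) \<in> parcs G \<Longrightarrow> u \<in> pverts G \<and> v \<in> pverts G"
  using chain pair_wf_digraph.wellformed'[of G u v] by (auto simp: chain_digraph_def pair_fin_digraph_def)

text \<open>
  The head \<open>b\<close> of the edge reaches the root without using the edge. If the tail did so as well, the
  two would still be connected after deleting the edge.
\<close>

lemma rooted_no_bypass:
  assumes e: "(u, b) \<in> parcs G" and u: "(u, r) \<in> (parcs G - {(u, b)})\<^sup>*"
  shows False
proof -
  let ?R = "parcs G - {(u, b)}"
  have "(b, r) \<in> ?R\<^sup>*"
    using rooted_reach rooted_verts[OF e] by (intro rtrancl_avoid_entry) auto
  then have "(r, b) \<in> (?R\<inverse>)\<^sup>*"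
    by (simp add: rtrancl_converse)
  then have "(r, b) \<in> (?R \<union> ?R\<inverse>)\<^sup>*"
    by (rule rtrancl_mono[THEN subsetD, rotated]) auto
  moreover have "(u, r) \<in> (?R \<union> ?R\<inverse>)\<^sup>*"
    using u by (rule rtrancl_mono[THEN subsetD, rotated]) auto
  ultimately show False
    using rooted_bridge[OF e] by (meson rtrancl_trans)
qed

lemma root_no_exit: "(r, b) \<notin> parcs G"
  using rooted_no_bypass[of r b] by auto

text \<open>
  Let \<open>c\<close> be the vertex after the last departure from \<open>u\<close> on a path to the root. An edge from
  \<open>u\<close> to a vertex other than \<open>c\<close> would be bypassed by the continuation through \<open>c\<close>.
\<close>

lemma unique_exit:
  assumes "(u, a) \<in> parcs G" "(u, b) \<in> parcs G"
  shows "a = b"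
proof -
  let ?R = "parcs G - {u} \<times> UNIV"
  have "u \<noteq> r"
    using assms(1) root_no_exit by auto
  then have "(u, r) \<notin> ?R\<^sup>*"
    by (auto elim: converse_rtranclE)
  then obtain c where c: "(u, c) \<in> parcs G" "(c, r) \<in> ?R\<^sup>*"
    using rtrancl_last_exit[OF rooted_reach] rooted_verts[OF assms(1)] by blast
  have "x = c" if x: "(u, x) \<in> parcs G" for x
  proof (rule ccontr)
    assume "x \<noteq> c"
    then have "(u, c) \<in> parcs G - {(u, x)}"
      using c(1) by simp
    moreover have "(c, r) \<in> (parcs G - {(u, x)})\<^sup>*"
      using c(2) by (rule rtrancl_mono[THEN subsetD, rotated]) auto
    ultimately have "(u, r) \<in> (parcs G - {(u, x)})\<^sup>*"
      by (rule converse_rtrancl_into_rtrancl)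
    then show False
      by (rule rooted_no_bypass[OF x])
  qed
  then show ?thesis
    using assms by blast
qed

lemma exit_exists:
  assumes "u \<in> pverts G" "u \<noteq> r"
  shows "\<exists>v. (u, v) \<in> parcs G"
  using rooted_reach[OF assms(1)] assms(2) by (auto elim: converse_rtranclE)

end

section \<open>Families with dual functionals\<close>

definition linear_functional :: "('k::field_char_0, 'a) module \<Rightarrow> ('a \<Rightarrow> 'k) \<Rightarrow> bool" where
  "linear_functional L \<phi> \<longleftrightarrow> (\<forall>x\<in>carrier L. \<forall>y\<in>carrier L. \<phi> (x \<oplus>\<^bsub>L\<^esub> y) = \<phi> x + \<phi> y) \<and>
     (\<forall>c. \<forall>x\<in>carrier L. \<phi> (c \<odot>\<^bsub>L\<^esub> x) = c * \<phi> x)"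

lemma chain_hom_functional: "alg_hom L (chain_model c) h \<Longrightarrow> linear_functional L (\<lambda>x. h x n)"
  by (auto simp: linear_functional_def alg_hom_def)

text \<open>
  Indexing the family by \<open>J\<close>, and not by its elements, lets linear independence be read off from
  the functionals, including the fact that different indices give different elements.
\<close>

locale dual_family = bilinear_algebra L
  for L :: "('k::field_char_0, 'a) module" (structure) +
  fixes J :: "'i set" and b :: "'i \<Rightarrow> 'a" and \<phi> :: "'i \<Rightarrow> 'a \<Rightarrow> 'k"
  assumes family_finite: "finite J"
    and family_closed: "i \<in> J \<Longrightarrow> b i \<in> carrier L"
    and family_linear: "i \<in> J \<Longrightarrow> linear_functional L (\<phi> i)"
    and family_dual: "i \<in> J \<Longrightarrow> j \<in> J \<Longrightarrow> \<phi> i (b j) = (if i = j then 1 else 0)"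
begin

lemma family_inj: "inj_on b J"
  by (rule inj_onI) (metis family_dual zero_neq_one)

lemma functional_zero: "i \<in> J \<Longrightarrow> \<phi> i \<zero> = 0"
  using family_linear[of i] scale_zero[of \<zero>] unfolding linear_functional_def
  by (metis mult_zero_left zero_closed)

lemma functional_finsum:
  assumes i: "i \<in> J" and "finite A" "\<And>x. x \<in> A \<Longrightarrow> f x \<in> carrier L"
  shows "\<phi> i (finsum L f A) = (\<Sum>x\<in>A. \<phi> i (f x))"
  using assms(2,3)
proof (induction A rule: finite_induct)
  case empty
  then show ?case using functional_zero[OF i] by simp
next
  case (insert x A)
  then have "finsum L f (insert x A) = f x \<oplus> finsum L f A"
    by (intro finsum_insert) auto
  moreover have "finsum L f A \<in> carrier L"
    using insert.prems by (intro finsum_closed) auto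
  ultimately show ?case
    using insert family_linear[OF i] by (simp add: linear_functional_def)
qed

lemma functional_lincomb:
  assumes i: "i \<in> J" "b i \<in> A" and A: "finite A" "A \<subseteq> b ` J"
  shows "\<phi> i (lincomb a A) = a (b i)"
proof -
  have c: "x \<in> carrier L" if "x \<in> A" for x
    using A(2) that family_closed by auto
  have "\<phi> i (lincomb a A) = (\<Sum>x\<in>A. \<phi> i (a x \<odot>\<^bsub>L\<^esub> x))"
    unfolding lincomb_def using c A(1) by (intro functional_finsum[OF i(1)]) (auto intro: scale_closed)
  also have "\<dots> = (\<Sum>x\<in>A. if x = b i then a x else 0)"
  proof (rule sum.cong)
    fix x assume x: "x \<in> A"
    then obtain j where j: "j \<in> J" "x = b j"
      using A(2) by auto
    have "\<phi> i (a x \<odot>\<^bsub>L\<^esub> x) = a x * \<phi> i x"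
      using family_linear[OF i(1)] c[OF x] by (simp add: linear_functional_def)
    then show "\<phi> i (a x \<odot>\<^bsub>L\<^esub> x) = (if x = b i then a x else 0)"
      using family_dual[OF i(1) j(1)] inj_onD[OF family_inj _ i(1) j(1)] j(2) by auto
  qed simp
  also have "\<dots> = a (b i)"
    using A(1) i(2) by simp
  finally show ?thesis .
qed

lemma family_independent: "lin_indpt (b ` J)"
proof
  assume "lin_dep (b ` J)"
  then obtain A a v where A: "finite A" "A \<subseteq> b ` J" "lincomb a A = \<zero>" "v \<in> A" "a v \<noteq> 0"
    unfolding lin_dep_def by auto
  have "v \<in> b ` J"
    using A(2,4) by (rule subsetD)
  then obtain i where i: "i \<in> J" "v = b i"
    by blast
  then show False
    using functional_lincomb[of i A a] A functional_zero[of i] by simp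
qed

lemma span_zero:
  assumes "x \<in> vs_span L (b ` J)" and "\<And>i. i \<in> J \<Longrightarrow> \<phi> i x = 0"
  shows "x = \<zero>"
proof -
  obtain a A where A: "finite A" "A \<subseteq> b ` J" "x = lincomb a A"
    using assms(1) unfolding span_def by auto
  have "a v \<odot>\<^bsub>L\<^esub> v = \<zero>" if "v \<in> A" for v
  proof -
    have "v \<in> b ` J"
      using A(2) \<open>v \<in> A\<close> by (rule subsetD)
    then obtain i where i: "i \<in> J" "v = b i"
      by blast
    then have "a v = 0"
      using functional_lincomb[OF i(1) _ A(1,2), of a] assms(2)[OF i(1)] A(3) \<open>v \<in> A\<close> by simp
    then show ?thesis
      using scale_zero[OF family_closed[OF i(1)]] i(2) by simp
  qed
  then show ?thesis
    unfolding A(3) lincomb_def by (intro add.finprod_one_eqI)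
qed

end

locale dual_basis = dual_family +
  assumes family_span: "vs_span L (b ` J) = carrier L"
begin

lemma family_basis: "basis (b ` J)"
  unfolding basis_def using family_independent family_span family_closed by auto

lemma family_fin_dim: fin_dim
  unfolding fin_dim_def using family_finite family_span family_closed by blast

lemma family_dim: "dim = card J"
  using dim_basis[OF _ family_basis] family_finite card_image[OF family_inj] by simp

lemma dual_space_eqI:
  assumes "\<alpha> \<in> dual_space L" "\<beta> \<in> dual_space L" "\<And>i. i \<in> J \<Longrightarrow> \<alpha> (b i) = \<beta> (b i)"
  shows "\<alpha> = \<beta>"
proof
  fix x
  show "\<alpha> x = \<beta> x"
  proof (cases "x \<in> carrier L")
    case True
    let ?N = "{x \<in> carrier L. \<alpha> x = \<beta> x}"
    have "\<delta> \<zero> = 0" if "\<delta> \<in> dual_space L" for \<delta>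
    proof -
      have "\<delta> (0 \<odot>\<^bsub>L\<^esub> \<zero>) = 0 * \<delta> \<zero>"
        using that zero_closed unfolding dual_space_def by blast
      then show ?thesis
        by (simp add: scale_zero)
    qed
    from this[OF assms(1)] this[OF assms(2)]
    have "LinearCombinations.submodule class_ring ?N L"
      using assms(1,2) by (intro submodule_classI) (auto simp: dual_space_def scale_closed)
    moreover have "b ` J \<subseteq> ?N"
      using assms(3) family_closed by auto
    ultimately have "vs_span L (b ` J) \<subseteq> ?N"
      by (rule span_minimal)
    then show ?thesis
      using True family_span by auto
  qed (use assms(1,2) in \<open>simp add: dual_space_def\<close>)
qed

lemma functional_dual_space: "i \<in> J \<Longrightarrow> (\<lambda>x. if x \<in> carrier L then \<phi> i x else 0) \<in> dual_space L"
  using family_linear[of i] by (auto simp: dual_space_def linear_functional_def scale_closed)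

lemma dual_basis_elem_eq:
  assumes i: "i \<in> J"
  shows "dual_basis_elem L (b ` J) (b i) = (\<lambda>x. if x \<in> carrier L then \<phi> i x else 0)"
  unfolding dual_basis_elem_def
proof (rule the_equality)
  have v: "(if b j \<in> carrier L then \<phi> i (b j) else 0) = (if b j = b i then 1 else 0)" if "j \<in> J" for j
    using family_dual[OF i that] inj_onD[OF family_inj _ that i] family_closed[OF that] by auto
  then show "(\<lambda>x. if x \<in> carrier L then \<phi> i x else 0) \<in> dual_space L \<and>
      (\<forall>b'\<in>b ` J. (if b' \<in> carrier L then \<phi> i b' else 0) = (if b' = b i then 1 else 0))"
    using functional_dual_space[OF i] by blast
  fix \<alpha> assume "\<alpha> \<in> dual_space L \<and> (\<forall>b'\<in>b ` J. \<alpha> b' = (if b' = b i then 1 else 0))"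
  then show "\<alpha> = (\<lambda>x. if x \<in> carrier L then \<phi> i x else 0)"
    using v by (intro dual_space_eqI functional_dual_space i) auto
qed

end

section \<open>The coordinates of an edge\<close>

text \<open>
  The images of the vertices in the chain model of the edge \<open>e\<close>: its tail is $w^1$, its head
  is $v_j$, and the other vertices vanish.
\<close>

definition edge_gen :: "'v \<times> 'v \<Rightarrow> 'v \<Rightarrow> nat \<Rightarrow> 'k::field_char_0" where
  "edge_gen e = (\<lambda>v n. if v = fst e then (if n = 1 then 1 else 0)
     else if v = snd e then (if n = 0 then 1 else 0) else 0)"

lemma chain_digraph_edge:
  assumes "chain_digraph \<kappa> G" "e \<in> parcs G"
  shows "fst e \<in> pverts G" "snd e \<in> pverts G" "fst e \<noteq> snd e" "2 \<le> \<kappa> e" "\<kappa> e \<le> max_chain \<kappa> G"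
proof -
  interpret pair_fin_digraph G
    using assms(1) by (simp add: chain_digraph_def)
  show "fst e \<in> pverts G" "snd e \<in> pverts G"
    using assms(2) arc_fst_in_verts arc_snd_in_verts by auto
  show "fst e \<noteq> snd e"
    using assms by (cases e) (auto simp: chain_digraph_def)
  show "2 \<le> \<kappa> e"
    using assms by (simp add: chain_digraph_def)
  show "\<kappa> e \<le> max_chain \<kappa> G"
    unfolding max_chain_def using assms(2) pair_finite_arcs by (intro Max_ge) auto
qed

text \<open>
  If the images of \<open>u\<close> and \<open>v\<close> do not commute, then \<open>u\<close> and \<open>v\<close> are the two ends of
  \<open>e\<close>. So the relations between nonadjacent vertices are respected.
\<close>

lemma edge_hom_exists:
  assumes chain: "chain_digraph \<kappa> G" and e: "e \<in> parcs G"
  shows "\<exists>h. alg_hom (graph_lie (max_chain \<kappa> G) G :: ('k::field_char_0, _) module) (chain_model (\<kappa> e)) h \<and>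
    (\<forall>t. set_mset (letters t) \<subseteq> pverts G \<longrightarrow>
      h (eval_bracketing (graph_lie (max_chain \<kappa> G) G) (graph_lie_gen (max_chain \<kappa> G) G) t) =
      eval_bracketing (chain_model (\<kappa> e)) (edge_gen e) t)"
proof -
  let ?k = "max_chain \<kappa> G" and ?\<gamma> = "edge_gen e :: 'a \<Rightarrow> nat \<Rightarrow> 'k"
  note edge = chain_digraph_edge[OF chain e]
  have nonadj: "?\<gamma> u \<otimes>\<^bsub>chain_model (\<kappa> e)\<^esub> ?\<gamma> v = \<zero>\<^bsub>chain_model (\<kappa> e)\<^esub>"
    if "(u, v) \<notin> parcs G" "(v, u) \<notin> parcs G" for u v
    using that e edge(3) by (cases e) (auto simp: edge_gen_def fun_eq_iff)
  have "1 \<le> \<kappa> e"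
    using edge(4) by simp
  then obtain h where h: "alg_hom (graph_lie ?k G) (chain_model (\<kappa> e)) h"
    "\<And>v. v \<in> pverts G \<Longrightarrow> h (graph_lie_gen ?k G v) = ?\<gamma> v"
    using graph_lie_chain_hom[of "\<kappa> e" ?k G ?\<gamma>] edge(5) nonadj by blast
  have "h (eval_bracketing (graph_lie ?k G) (graph_lie_gen ?k G) t) =
      eval_bracketing (chain_model (\<kappa> e)) ?\<gamma> t" if t: "set_mset (letters t) \<subseteq> pverts G" for t
  proof (rule alg_hom_eval[OF lie_bilinear[OF graph_lie_lie_algebra] h(1)])
    fix v assume "v \<in># letters t"
    then have v: "v \<in> pverts G"
      using t by auto
    show "graph_lie_gen ?k G v \<in> carrier (graph_lie ?k G)"
      by (rule bracket_generated_closed[OF graph_lie_generated v])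
    show "h (graph_lie_gen ?k G v) = ?\<gamma> v"
      by (rule h(2)[OF v])
  qed
  then show ?thesis
    using h(1) by blast
qed

definition edge_coords ::
    "('v \<times> 'v \<Rightarrow> nat) \<Rightarrow> 'v pair_pre_digraph \<Rightarrow> 'v \<times> 'v \<Rightarrow>
     ('v bracketing \<Rightarrow> 'k::field_char_0) set set set \<Rightarrow> nat \<Rightarrow> 'k" where
  "edge_coords \<kappa> G e = (SOME h. alg_hom (graph_lie (max_chain \<kappa> G) G) (chain_model (\<kappa> e)) h \<and>
    (\<forall>t. set_mset (letters t) \<subseteq> pverts G \<longrightarrow>
      h (eval_bracketing (graph_lie (max_chain \<kappa> G) G) (graph_lie_gen (max_chain \<kappa> G) G) t) =
      eval_bracketing (chain_model (\<kappa> e)) (edge_gen e) t))"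

lemma
  assumes "chain_digraph \<kappa> G" "e \<in> parcs G"
  shows edge_coords_hom: "alg_hom (graph_lie (max_chain \<kappa> G) G :: ('k::field_char_0, _) module)
      (chain_model (\<kappa> e)) (edge_coords \<kappa> G e)"
    and edge_coords_eval: "set_mset (letters t) \<subseteq> pverts G \<Longrightarrow>
      edge_coords \<kappa> G e (eval_bracketing (graph_lie (max_chain \<kappa> G) G :: ('k, _) module)
        (graph_lie_gen (max_chain \<kappa> G) G) t) = eval_bracketing (chain_model (\<kappa> e)) (edge_gen e) t"
  using someI_ex[OF edge_hom_exists[OF assms, where 'k = 'k]] unfolding edge_coords_def by blast+

lemma edge_gen_eval_degree:
  assumes "chain_digraph \<kappa> G" "e \<in> parcs G"
    and "eval_bracketing (chain_model (\<kappa> e)) (edge_gen e) t n \<noteq> (0::'k::field_char_0)"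
  shows "n = 0 \<and> letters t = {#snd e#} \<or>
    1 \<le> n \<and> n \<le> \<kappa> e \<and> letters t = {#fst e#} + replicate_mset (n - 1) (snd e)"
  using assms(3) chain_digraph_edge[OF assms(1,2)]
  by (intro chain_model_eval_degree[OF _ _ edge_gen_def]) auto

text \<open>
  The labels of the standard basis of a rooted tree: \<open>Some (e, l)\<close> stands for $w_e^l$ and
  \<open>None\<close> for the root. Since every other vertex is the tail of exactly one edge, the vertices
  other than the root are labelled as $w_e^1$.
\<close>

definition chain_index ::
    "('v \<times> 'v \<Rightarrow> nat) \<Rightarrow> ('v \<times> 'v) set \<Rightarrow> (('v \<times> 'v) \<times> nat) option set" where
  "chain_index \<kappa> E = insert None (Some ` Sigma E (\<lambda>e. {1..\<kappa> e}))"

definition index_bracketing :: "'v \<Rightarrow> (('v \<times> 'v) \<times> nat) option \<Rightarrow> 'v bracketing" where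
  "index_bracketing r i = (case i of None \<Rightarrow> Letter r | Some (e, l) \<Rightarrow> chain_bracketing e (l - 1))"

text \<open>
  The functional dual to a label. The root is the head of $e_0$, so its coefficient is the one of
  index \<open>0\<close> in the chain model of $e_0$.
\<close>

definition index_coord ::
    "('v \<times> 'v \<Rightarrow> 'a \<Rightarrow> nat \<Rightarrow> 'k) \<Rightarrow> 'v \<times> 'v \<Rightarrow> (('v \<times> 'v) \<times> nat) option \<Rightarrow> 'a \<Rightarrow> 'k" where
  "index_coord \<Phi> e\<^sub>0 i x = (case i of None \<Rightarrow> \<Phi> e\<^sub>0 x 0 | Some (e, l) \<Rightarrow> \<Phi> e x l)"

lemma chain_index_cases:
  assumes "i \<in> chain_index \<kappa> E"
  obtains "i = None" | e l where "i = Some (e, l)" "e \<in> E" "1 \<le> l" "l \<le> \<kappa> e"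
  using assms by (auto simp: chain_index_def)

text \<open>
  The span of the iterated brackets of the multidegrees that $I_\kappa$ is supposed to collect. It
  equals $I_\kappa$, but the inclusions are proved one at a time.
\<close>

definition chain_remainder ::
    "('v \<times> 'v \<Rightarrow> nat) \<Rightarrow> 'v pair_pre_digraph \<Rightarrow> ('v bracketing \<Rightarrow> 'k::field_char_0) set set set set" where
  "chain_remainder \<kappa> G = vs_span (graph_lie (max_chain \<kappa> G) G)
     {eval_bracketing (graph_lie (max_chain \<kappa> G) G) (graph_lie_gen (max_chain \<kappa> G) G) t | t.
       set_mset (letters t) \<subseteq> pverts G \<and> 3 \<le> size (letters t) \<and> size (letters t) \<le> max_chain \<kappa> G \<and>
       (\<forall>e\<in>parcs G. \<forall>l. 1 \<le> l \<longrightarrow> l \<le> \<kappa> e \<longrightarrow>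
         letters t \<noteq> {#fst e#} + replicate_mset (l - 1) (snd e))}"

section \<open>The defining ideal as a joint kernel\<close>

lemma graph_lie_eval_closed:
  assumes "set_mset (letters t) \<subseteq> pverts G"
  shows "eval_bracketing (graph_lie k G) (graph_lie_gen k G) t \<in> carrier (graph_lie k G)"
proof (rule bilinear_algebra.eval_closed[OF lie_bilinear[OF graph_lie_lie_algebra]])
  fix v assume "v \<in># letters t"
  then show "graph_lie_gen k G v \<in> carrier (graph_lie k G)"
    using assms by (intro bracket_generated_closed[OF graph_lie_generated]) auto
qed

lemma multihom_submodule:
  "LinearCombinations.submodule class_ring (multihom k G D) (graph_lie k G)"
proof -
  interpret lie_algebra "graph_lie k G" by (rule graph_lie_lie_algebra)
  show ?thesis
    unfolding multihom_def using graph_lie_eval_closed by (intro span_is_submodule) blast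
qed

lemma multihom_subset: "multihom k G D \<subseteq> carrier (graph_lie k G)"
  using multihom_submodule by (rule LinearCombinations.submodule.subset)

lemma eval_in_multihom:
  assumes "set_mset (letters t) \<subseteq> pverts G"
  shows "eval_bracketing (graph_lie k G) (graph_lie_gen k G) t \<in> multihom k G (letters t)"
proof -
  interpret lie_algebra "graph_lie k G" by (rule graph_lie_lie_algebra)
  show ?thesis
    unfolding multihom_def using graph_lie_eval_closed assms
    by (intro subsetD[OF in_own_span]) blast+
qed

lemma total_degree_submodule:
  "LinearCombinations.submodule class_ring (total_degree_part k G d) (graph_lie k G)"
proof -
  interpret lie_algebra "graph_lie k G" by (rule graph_lie_lie_algebra)
  show ?thesis
    unfolding total_degree_part_def using multihom_subset by (intro span_is_submodule) blast
qed

lemma eval_in_total_degree: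
  assumes "set_mset (letters t) \<subseteq> pverts G"
  shows "eval_bracketing (graph_lie k G) (graph_lie_gen k G) t \<in> total_degree_part k G (size (letters t))"
proof -
  interpret lie_algebra "graph_lie k G" by (rule graph_lie_lie_algebra)
  have "(\<Union>D\<in>{D. set_mset D \<subseteq> pverts G \<and> size D = size (letters t)}. multihom k G D)
      \<subseteq> carrier (graph_lie k G)"
    using multihom_subset by blast
  from in_own_span[OF this] show ?thesis
    unfolding total_degree_part_def using eval_in_multihom[OF assms] assms by blast
qed

lemma edge_ideal_submodule:
  "LinearCombinations.submodule class_ring (edge_ideal k G c i j) (graph_lie k G)"
proof -
  interpret lie_algebra "graph_lie k G" by (rule graph_lie_lie_algebra)
  show ?thesis
    unfolding edge_ideal_def using multihom_subset by (intro span_is_submodule) blast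
qed

lemma eval_in_edge_ideal:
  assumes t: "set_mset (letters t) \<subseteq> pverts G"
    and deg: "letters t \<noteq> {#j#}" "\<And>l. 1 \<le> l \<Longrightarrow> l \<le> c \<Longrightarrow> letters t \<noteq> {#i#} + replicate_mset (l - 1) j"
  shows "eval_bracketing (graph_lie k G) (graph_lie_gen k G) t \<in> edge_ideal k G c i j"
proof -
  interpret lie_algebra "graph_lie k G" by (rule graph_lie_lie_algebra)
  let ?D = "{D. set_mset D \<subseteq> pverts G \<and>
    D \<notin> {{#j#}} \<union> {{#i#} + replicate_mset (l - 1) j | l. 1 \<le> l \<and> l \<le> c}}"
  have "(\<Union>D\<in>?D. multihom k G D) \<subseteq> carrier (graph_lie k G)"
    using multihom_subset by blast
  from in_own_span[OF this] show ?thesis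
    unfolding edge_ideal_def using eval_in_multihom[OF t] t deg by blast
qed

lemma chain_remainder_subset: "chain_remainder \<kappa> G \<subseteq> chain_ideal \<kappa> G"
proof -
  let ?k = "max_chain \<kappa> G"
  interpret lie_algebra "graph_lie ?k G" by (rule graph_lie_lie_algebra)
  have tot: "(\<Union>d\<in>{3..?k}. total_degree_part ?k G d) \<subseteq> carrier (graph_lie ?k G)"
    using LinearCombinations.submodule.subset[OF total_degree_submodule] by blast
  have "chain_remainder \<kappa> G \<subseteq> edge_ideal ?k G (\<kappa> (i, j)) i j" if e: "(i, j) \<in> parcs G" for i j
    unfolding chain_remainder_def
  proof (rule span_minimal[OF edge_ideal_submodule], clarify)
    fix t :: "'a bracketing"
    assume t: "set_mset (letters t) \<subseteq> pverts G" "3 \<le> size (letters t)"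
      and deg: "\<forall>e\<in>parcs G. \<forall>l. 1 \<le> l \<longrightarrow> l \<le> \<kappa> e \<longrightarrow>
        letters t \<noteq> {#fst e#} + replicate_mset (l - 1) (snd e)"
    have "letters t \<noteq> {#j#}"
      using t(2) by auto
    moreover have "letters t \<noteq> {#i#} + replicate_mset (l - 1) j" if "1 \<le> l" "l \<le> \<kappa> (i, j)" for l
      using deg e that by (metis fst_conv snd_conv)
    ultimately show "eval_bracketing (graph_lie ?k G) (graph_lie_gen ?k G) t \<in> edge_ideal ?k G (\<kappa> (i, j)) i j"
      by (intro eval_in_edge_ideal[OF t(1)])
  qed
  moreover have "chain_remainder \<kappa> G \<subseteq> vs_span (graph_lie ?k G) (\<Union>d\<in>{3..?k}. total_degree_part ?k G d)"
    unfolding chain_remainder_def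
  proof (rule span_minimal[OF span_is_submodule[OF tot]], clarify)
    fix t :: "'a bracketing"
    assume t: "set_mset (letters t) \<subseteq> pverts G" "3 \<le> size (letters t)" "size (letters t) \<le> ?k"
    show "eval_bracketing (graph_lie ?k G) (graph_lie_gen ?k G) t
        \<in> vs_span (graph_lie ?k G) (\<Union>d\<in>{3..?k}. total_degree_part ?k G d)"
    proof (rule subsetD[OF in_own_span[OF tot]], rule UN_I)
      show "size (letters t) \<in> {3..?k}"
        using t by simp
    qed (rule eval_in_total_degree[OF t(1)])
  qed
  ultimately show ?thesis
    unfolding chain_ideal_def Let_def by blast
qed

text \<open>
  By \<open>edge_gen_eval_degree\<close> the homomorphism of \<open>e\<close> sees exactly the multidegrees that
  the definition of $I_{i,j}^{\kappa_{i,j}}$ excludes.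
\<close>

lemma edge_ideal_kernel:
  assumes chain: "chain_digraph \<kappa> G" and e: "e \<in> parcs G"
    and x: "x \<in> edge_ideal (max_chain \<kappa> G) G (\<kappa> e) (fst e) (snd e)"
  shows "edge_coords \<kappa> G e x = (\<lambda>n. 0::'k::field_char_0)"
proof -
  let ?k = "max_chain \<kappa> G"
  let ?L = "graph_lie ?k G :: ('k, _) module"
  interpret lie_algebra ?L by (rule graph_lie_lie_algebra)
  let ?N = "{x \<in> carrier ?L. edge_coords \<kappa> G e x = \<zero>\<^bsub>chain_model (\<kappa> e)\<^esub>}"
  have N: "LinearCombinations.submodule class_ring ?N ?L"
    by (rule alg_hom_kernel_submodule[OF bilinear_algebra_axioms lie_bilinear[OF chain_model_lie_algebra]
          edge_coords_hom[OF chain e]])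
  have "multihom ?k G D \<subseteq> ?N"
    if D: "D \<notin> {{#snd e#}} \<union> {{#fst e#} + replicate_mset (l - 1) (snd e) | l. 1 \<le> l \<and> l \<le> \<kappa> e}" for D
    unfolding multihom_def
  proof (rule span_minimal[OF N], clarify)
    fix t assume t: "set_mset (letters t) \<subseteq> pverts G" "D = letters t"
    have "eval_bracketing (chain_model (\<kappa> e)) (edge_gen e) t = (\<lambda>n. 0::'k)"
      using edge_gen_eval_degree[OF chain e, of t] D t(2) by (intro ext) blast
    moreover have "edge_coords \<kappa> G e (eval_bracketing ?L (graph_lie_gen ?k G) t) =
        eval_bracketing (chain_model (\<kappa> e)) (edge_gen e) t"
      by (rule edge_coords_eval[OF chain e t(1)])
    ultimately show "eval_bracketing ?L (graph_lie_gen ?k G) t \<in> carrier ?L \<and>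
        edge_coords \<kappa> G e (eval_bracketing ?L (graph_lie_gen ?k G) t) = \<zero>\<^bsub>chain_model (\<kappa> e)\<^esub>"
      using graph_lie_eval_closed[OF t(1)] by auto
  qed
  then have "edge_ideal ?k G (\<kappa> e) (fst e) (snd e) \<subseteq> ?N"
    unfolding edge_ideal_def by (intro span_minimal[OF N]) blast
  then show ?thesis
    using x by auto
qed

context
  fixes \<kappa> :: "'v \<times> 'v \<Rightarrow> nat" and G :: "'v pair_pre_digraph" and r :: 'v and e\<^sub>0 :: "'v \<times> 'v"
  assumes chain: "chain_digraph \<kappa> G" and root: "directed_to_root G r"
    and e\<^sub>0: "e\<^sub>0 \<in> parcs G" "snd e\<^sub>0 = r"
begin

lemma index_letters:
  assumes "i \<in> chain_index \<kappa> (parcs G)"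
  shows "set_mset (letters (index_bracketing r i)) \<subseteq> pverts G"
  using assms
proof (cases rule: chain_index_cases)
  case 1
  then show ?thesis
    using root by (simp add: index_bracketing_def directed_to_root_def)
next
  case (2 e l)
  then show ?thesis
    using chain_digraph_edge[OF chain]
    by (auto simp: index_bracketing_def letters_chain_bracketing split: if_splits)
qed

lemma edge_gen_root: "e \<in> parcs G \<Longrightarrow> 1 \<le> l \<Longrightarrow> edge_gen e r l = 0"
  using root_no_exit[OF chain root] chain_digraph_edge(3)[OF chain] by (cases e) (auto simp: edge_gen_def)

text \<open>
  A nonzero coefficient forces the multidegrees of $w_{e}^{l}$ and $w_{e'}^{l'}$ to agree. Then
  the edges have the same tail, and so are equal, or each one is the reverse of the other.
\<close>

lemma edge_gen_chain:
  assumes e: "e \<in> parcs G" "1 \<le> l" "l \<le> \<kappa> e" and e': "e' \<in> parcs G" "1 \<le> l'" "l' \<le> \<kappa> e'"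
  shows "eval_bracketing (chain_model (\<kappa> e)) (edge_gen e) (chain_bracketing e' (l' - 1)) l =
    (if (e, l) = (e', l') then 1 else (0::'k::field_char_0))"
proof (cases "e = e'")
  case True
  have "eval_bracketing (chain_model (\<kappa> e)) (edge_gen e) (chain_bracketing (fst e, snd e) (l' - 1)) =
      (\<lambda>n. if n = Suc (l' - 1) then 1 else (0::'k))"
    using chain_digraph_edge(3)[OF chain e(1)] e' True
    by (intro chain_model_eval_chain[OF _ _ edge_gen_def]) auto
  then show ?thesis
    using True e' by auto
next
  case False
  have "eval_bracketing (chain_model (\<kappa> e)) (edge_gen e) (chain_bracketing e' (l' - 1)) l = (0::'k)"
  proof (rule ccontr)
    assume "\<not> ?thesis"
    from edge_gen_eval_degree[OF chain e(1) this] e(2)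
    have deg: "{#fst e'#} + replicate_mset (l' - 1) (snd e') = {#fst e#} + replicate_mset (l - 1) (snd e)"
      by (auto simp: letters_chain_bracketing)
    have ne: "fst e \<noteq> fst e'"
      using unique_exit[OF chain root, of "fst e" "snd e" "snd e'"] e(1) e'(1) False
      by (auto simp: prod_eq_iff)
    have "fst e' \<in># {#fst e#} + replicate_mset (l - 1) (snd e)"
      unfolding deg[symmetric] by simp
    then have "fst e' = snd e"
      using ne by (auto split: if_splits)
    moreover have "fst e \<in># {#fst e'#} + replicate_mset (l' - 1) (snd e')"
      unfolding deg by simp
    then have "fst e = snd e'"
      using ne by (auto split: if_splits)
    ultimately have "e' = (snd e, fst e)"
      by (simp add: prod_eq_iff)
    then show False
      using chain e(1) e'(1) by (cases e) (auto simp: chain_digraph_def)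
  qed
  then show ?thesis
    using False by simp
qed

lemma edge_gen_chain_root:
  assumes e: "e \<in> parcs G"
  shows "eval_bracketing (chain_model (\<kappa> e\<^sub>0)) (edge_gen e\<^sub>0) (chain_bracketing e l) 0 = (0::'k::field_char_0)"
proof (rule ccontr)
  assume "\<not> ?thesis"
  from edge_gen_eval_degree[OF chain e\<^sub>0(1) this]
  have "{#fst e#} + replicate_mset l (snd e) = {#r#}"
    using e\<^sub>0(2) by (auto simp: letters_chain_bracketing)
  then have "fst e = r"
    by (simp add: union_is_single)
  then show False
    using root_no_exit[OF chain root, of "snd e"] e by (cases e) auto
qed

lemma index_coord_dual:
  assumes i: "i \<in> chain_index \<kappa> (parcs G)" and j: "j \<in> chain_index \<kappa> (parcs G)"
  shows "index_coord (\<lambda>e t. eval_bracketing (chain_model (\<kappa> e)) (edge_gen e) t) e\<^sub>0 i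
    (index_bracketing r j) = (if i = j then 1 else (0::'k::field_char_0))"
  using i
proof (cases rule: chain_index_cases)
  case i: 1
  from j show ?thesis
  proof (cases rule: chain_index_cases)
    case 1
    then show ?thesis
      using i e\<^sub>0 chain_digraph_edge(3)[OF chain e\<^sub>0(1)]
      by (simp add: index_coord_def index_bracketing_def edge_gen_def)
  next
    case (2 e l)
    then show ?thesis
      using i edge_gen_chain_root by (simp add: index_coord_def index_bracketing_def)
  qed
next
  case i: (2 e l)
  from j show ?thesis
  proof (cases rule: chain_index_cases)
    case 1
    then show ?thesis
      using i edge_gen_root by (simp add: index_coord_def index_bracketing_def)
  next
    case (2 e' l')
    then show ?thesis
      using i edge_gen_chain[of e l e' l'] by (simp add: index_coord_def index_bracketing_def)
  qed
qed

lemma chain_index_finite: "finite (chain_index \<kappa> (parcs G))"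
  using chain by (auto simp: chain_index_def chain_digraph_def pair_fin_digraph_def
      pair_fin_digraph_axioms_def)

lemma graph_lie_dual_family:
  "dual_family (graph_lie (max_chain \<kappa> G) G :: ('k::field_char_0, _) module) (chain_index \<kappa> (parcs G))
    (\<lambda>i. eval_bracketing (graph_lie (max_chain \<kappa> G) G) (graph_lie_gen (max_chain \<kappa> G) G) (index_bracketing r i))
    (index_coord (edge_coords \<kappa> G) e\<^sub>0)"
proof -
  let ?k = "max_chain \<kappa> G"
  let ?L = "graph_lie ?k G :: ('k, _) module"
  interpret lie_algebra ?L by (rule graph_lie_lie_algebra)
  note lin = chain_hom_functional[OF edge_coords_hom[OF chain, where 'k = 'k]]
  show ?thesis
  proof
    show "finite (chain_index \<kappa> (parcs G))"
      by (rule chain_index_finite)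
  next
    fix i assume i: "i \<in> chain_index \<kappa> (parcs G)"
    show "eval_bracketing ?L (graph_lie_gen ?k G) (index_bracketing r i) \<in> carrier ?L"
      by (rule graph_lie_eval_closed[OF index_letters[OF i]])
    show "linear_functional ?L (index_coord (edge_coords \<kappa> G) e\<^sub>0 i)"
      using i by (cases rule: chain_index_cases) (auto simp: index_coord_def[abs_def] lin e\<^sub>0)
    fix j assume j: "j \<in> chain_index \<kappa> (parcs G)"
    have "index_coord (edge_coords \<kappa> G) e\<^sub>0 i (eval_bracketing ?L (graph_lie_gen ?k G) (index_bracketing r j)) =
      index_coord (\<lambda>e t. eval_bracketing (chain_model (\<kappa> e)) (edge_gen e) t) e\<^sub>0 i (index_bracketing r j)"
      using i edge_coords_eval[OF chain _ index_letters[OF j], where 'k = 'k]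
      by (cases rule: chain_index_cases) (auto simp: index_coord_def e\<^sub>0)
    then show "index_coord (edge_coords \<kappa> G) e\<^sub>0 i
        (eval_bracketing ?L (graph_lie_gen ?k G) (index_bracketing r j)) = (if i = j then 1 else 0)"
      by (simp only: index_coord_dual[OF i j])
  qed
qed

text \<open>
  Case distinction on the multidegree. In the degrees of a chain, \<open>eval_chain_degree\<close> leaves
  only multiples of $w_e^l$; a single letter is the root or some $w_e^1$; a bracket of two letters
  that is not of chain degree has nonadjacent factors; with more than \<open>k\<close> letters the value is
  zero; everything else belongs to the remainder.
\<close>

lemma bracketing_decomposition:
  fixes t :: "'v bracketing"
  defines "k \<equiv> max_chain \<kappa> G"
  assumes t: "set_mset (letters t) \<subseteq> pverts G"
  shows "eval_bracketing (graph_lie k G :: ('k::field_char_0, _) module) (graph_lie_gen k G) t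
      \<in> vs_span (graph_lie k G) ((\<lambda>i. eval_bracketing (graph_lie k G) (graph_lie_gen k G)
          (index_bracketing r i)) ` chain_index \<kappa> (parcs G)) \<union> chain_remainder \<kappa> G"
proof -
  let ?L = "graph_lie k G :: ('k, _) module"
  let ?ev = "eval_bracketing ?L (graph_lie_gen k G)"
  let ?B = "(\<lambda>i. ?ev (index_bracketing r i)) ` chain_index \<kappa> (parcs G)"
  interpret lie_algebra ?L by (rule graph_lie_lie_algebra)
  have B: "?B \<subseteq> carrier ?L"
    using graph_lie_eval_closed[OF index_letters] by blast
  interpret S: LinearCombinations.submodule class_ring "vs_span ?L ?B" ?L
    by (rule span_is_submodule[OF B])
  have base: "?ev (index_bracketing r i) \<in> vs_span ?L ?B" if "i \<in> chain_index \<kappa> (parcs G)" for i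
    using in_own_span[OF B] that by blast
  have gen: "graph_lie_gen k G v \<in> carrier ?L" if "v \<in> pverts G" for v
    by (rule bracket_generated_closed[OF graph_lie_generated that])
  show ?thesis
  proof (cases "\<exists>e\<in>parcs G. \<exists>l. 1 \<le> l \<and> l \<le> \<kappa> e \<and> letters t = {#fst e#} + replicate_mset (l - 1) (snd e)")
    case True
    then obtain e l where e: "e \<in> parcs G" "1 \<le> l" "l \<le> \<kappa> e"
      "letters t = {#fst e#} + replicate_mset (l - 1) (snd e)"
      by blast
    note edge = chain_digraph_edge[OF chain e(1)]
    obtain a where "?ev t = a \<odot>\<^bsub>?L\<^esub> ?ev (chain_bracketing (fst e, snd e) (l - 1))"
      using eval_chain_degree[OF gen[OF edge(1)] gen[OF edge(2)] edge(3) e(4)] by blast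
    moreover have "Some (e, l) \<in> chain_index \<kappa> (parcs G)"
      using e by (auto simp: chain_index_def)
    from base[OF this] have "?ev (chain_bracketing (fst e, snd e) (l - 1)) \<in> vs_span ?L ?B"
      by (simp add: index_bracketing_def)
    then have "a \<odot>\<^bsub>?L\<^esub> ?ev (chain_bracketing (fst e, snd e) (l - 1)) \<in> vs_span ?L ?B"
      by (intro S.smult_closed) auto
    ultimately show ?thesis
      by simp
  next
    case False
    note pos = size_letters_pos
    consider "size (letters t) = 1" | "size (letters t) = 2" | "3 \<le> size (letters t)"
      using pos[of t] by linarith
    then show ?thesis
    proof cases
      case 1
      then obtain v where v: "letters t = {#v#}"
        by (meson size_1_singleton_mset)
      have "v = r"
      proof (rule ccontr)
        assume "v \<noteq> r"
        moreover have "v \<in> pverts G"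
          using t v by simp
        ultimately obtain u where "(v, u) \<in> parcs G"
          using exit_exists[OF chain root] by blast
        moreover have "1 \<le> \<kappa> (v, u)"
          using chain_digraph_edge(4)[OF chain calculation] by simp
        ultimately show False
          using False v by (auto dest!: bspec[of _ _ "(v, u)"] spec[of _ 1])
      qed
      then have "t = Letter r"
        using v by (auto dest: letters_singleton)
      then show ?thesis
        using base[of None] by (simp add: chain_index_def index_bracketing_def)
    next
      case 2
      then obtain s u where su: "t = Brack s u"
        by (cases t) auto
      have "size (letters s) = 1" "size (letters u) = 1"
        using 2 pos[of s] pos[of u] su by auto
      then obtain a b where "letters s = {#a#}" "letters u = {#b#}"
        by (meson size_1_singleton_mset)
      then have t': "t = Brack (Letter a) (Letter b)" and ab: "letters t = {#a, b#}"
        using su by (auto dest!: letters_singleton)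
      have "(x, y) \<notin> parcs G" if "{#a, b#} = {#x, y#}" for x y
      proof
        assume xy: "(x, y) \<in> parcs G"
        have "letters t = {#fst (x, y)#} + replicate_mset (2 - 1) (snd (x, y))"
          using that ab by simp
        moreover have "2 \<le> \<kappa> (x, y)"
          using chain_digraph_edge(4)[OF chain xy] .
        ultimately show False
          using False xy one_le_numeral by blast
      qed
      then have "(a, b) \<notin> parcs G" "(b, a) \<notin> parcs G"
        by (auto simp: add_mset_commute)
      moreover have "a \<in> pverts G" "b \<in> pverts G"
        using t ab by auto
      ultimately have "?ev t = \<zero>\<^bsub>?L\<^esub>"
        unfolding t' by (simp add: graph_lie_nonadjacent)
      then show ?thesis
        by simp
    next
      case 3
      show ?thesis
      proof (cases "k < size (letters t)")
        case True
        then show ?thesis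
          using graph_lie_eval_zero[OF t True] S.zero_closed by (metis UnI1)
      next
        case le: False
        let ?R = "{?ev t | t. set_mset (letters t) \<subseteq> pverts G \<and> 3 \<le> size (letters t) \<and>
          size (letters t) \<le> k \<and> (\<forall>e\<in>parcs G. \<forall>l. 1 \<le> l \<longrightarrow> l \<le> \<kappa> e \<longrightarrow>
            letters t \<noteq> {#fst e#} + replicate_mset (l - 1) (snd e))}"
        have "?R \<subseteq> carrier ?L"
          using graph_lie_eval_closed by blast
        moreover have "?ev t \<in> ?R"
          using t 3 le False by (auto simp: not_less)
        ultimately have "?ev t \<in> vs_span ?L ?R"
          using in_own_span by blast
        then show ?thesis
          by (simp add: chain_remainder_def k_def)
      qed
    qed
  qed
qed

lemma graph_lie_decomposition:
  fixes x :: "('v bracketing \<Rightarrow> 'k::field_char_0) set set set"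
  defines "k \<equiv> max_chain \<kappa> G"
  assumes x: "x \<in> carrier (graph_lie k G)"
  obtains y z where "y \<in> vs_span (graph_lie k G) ((\<lambda>i. eval_bracketing (graph_lie k G) (graph_lie_gen k G)
      (index_bracketing r i)) ` chain_index \<kappa> (parcs G))"
    "z \<in> chain_remainder \<kappa> G" "x = y \<oplus>\<^bsub>graph_lie k G\<^esub> z"
proof -
  let ?L = "graph_lie k G :: ('k, _) module"
  let ?B = "(\<lambda>i. eval_bracketing ?L (graph_lie_gen k G) (index_bracketing r i)) ` chain_index \<kappa> (parcs G)"
  interpret lie_algebra ?L by (rule graph_lie_lie_algebra)
  have "?B \<subseteq> carrier ?L"
    using graph_lie_eval_closed[OF index_letters] by blast
  then interpret S: LinearCombinations.submodule class_ring "vs_span ?L ?B" ?L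
    by (rule span_is_submodule)
  have "LinearCombinations.submodule class_ring (chain_remainder \<kappa> G) ?L"
    unfolding chain_remainder_def k_def[symmetric]
    using graph_lie_eval_closed by (intro span_is_submodule) blast
  then interpret R: LinearCombinations.submodule class_ring "chain_remainder \<kappa> G" ?L .
  have "carrier ?L \<subseteq> submodule_sum (vs_span ?L ?B) (chain_remainder \<kappa> G)"
  proof (rule bracket_generated_induct[OF graph_lie_generated])
    show "LinearCombinations.submodule class_ring (submodule_sum (vs_span ?L ?B) (chain_remainder \<kappa> G)) ?L"
      by (intro sum_is_submodule S.submodule_axioms R.submodule_axioms)
  next
    fix t :: "'v bracketing" assume t: "set_mset (letters t) \<subseteq> pverts G"
    let ?x = "eval_bracketing ?L (graph_lie_gen k G) t"
    have xc: "?x \<in> carrier ?L"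
      by (rule graph_lie_eval_closed[OF t])
    have "?x \<in> vs_span ?L ?B \<union> chain_remainder \<kappa> G"
      unfolding k_def by (rule bracketing_decomposition[OF t])
    then show "?x \<in> submodule_sum (vs_span ?L ?B) (chain_remainder \<kappa> G)"
    proof
      assume "?x \<in> vs_span ?L ?B"
      then have "(?x, \<zero>\<^bsub>?L\<^esub>) \<in> {(x, y). x \<in> vs_span ?L ?B \<and> y \<in> chain_remainder \<kappa> G}"
        by simp
      then show ?thesis
        unfolding submodule_sum_def by (rule rev_image_eqI) (simp add: xc)
    next
      assume "?x \<in> chain_remainder \<kappa> G"
      then have "(\<zero>\<^bsub>?L\<^esub>, ?x) \<in> {(x, y). x \<in> vs_span ?L ?B \<and> y \<in> chain_remainder \<kappa> G}"
        by simp
      then show ?thesis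
        unfolding submodule_sum_def by (rule rev_image_eqI) (simp add: xc)
    qed
  qed
  then have "x \<in> submodule_sum (vs_span ?L ?B) (chain_remainder \<kappa> G)"
    using x by (rule subsetD)
  then show thesis
    using that unfolding submodule_sum_def by auto
qed

text \<open>
  The ideal $I_\kappa$ is squeezed between the remainder and the joint kernel of the
  homomorphisms of the edges. The two ends agree: an element of the kernel has no component along
  the family of \<open>graph_lie_dual_family\<close>, because the functionals of that family are coordinates of
  these homomorphisms, and so it lies in the remainder.
\<close>

lemma chain_ideal_eq:
  "chain_ideal \<kappa> G = {x \<in> carrier (graph_lie (max_chain \<kappa> G) G).
     \<forall>e\<in>parcs G. edge_coords \<kappa> G e x = (\<lambda>n. 0::'k::field_char_0)}"
proof (intro equalityI subsetI)
  let ?k = "max_chain \<kappa> G"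
  let ?L = "graph_lie ?k G :: ('k, _) module"
  have in_edge: "x \<in> edge_ideal ?k G (\<kappa> e) (fst e) (snd e)"
    if "x \<in> chain_ideal \<kappa> G" "e \<in> parcs G" for e and x :: "('v bracketing \<Rightarrow> 'k) set set set"
    using that by (cases e) (auto simp: chain_ideal_def Let_def)
  have kernel: "edge_coords \<kappa> G e x = (\<lambda>n. 0)"
    if "x \<in> chain_ideal \<kappa> G" "e \<in> parcs G" for e and x :: "('v bracketing \<Rightarrow> 'k) set set set"
    by (rule edge_ideal_kernel[OF chain that(2) in_edge[OF that]])
  fix x :: "('v bracketing \<Rightarrow> 'k) set set set"
  {
    assume x: "x \<in> chain_ideal \<kappa> G"
    have "x \<in> carrier ?L"
      using LinearCombinations.submodule.subset[OF edge_ideal_submodule] in_edge[OF x e\<^sub>0(1)] by (rule subsetD)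
    then show "x \<in> {x \<in> carrier ?L. \<forall>e\<in>parcs G. edge_coords \<kappa> G e x = (\<lambda>n. 0)}"
      using kernel[OF x] by simp
  }
  assume x: "x \<in> {x \<in> carrier ?L. \<forall>e\<in>parcs G. edge_coords \<kappa> G e x = (\<lambda>n. 0)}"
  let ?b = "\<lambda>i. eval_bracketing ?L (graph_lie_gen ?k G) (index_bracketing r i)"
  let ?\<phi> = "index_coord (edge_coords \<kappa> G) e\<^sub>0"
  interpret dual_family ?L "chain_index \<kappa> (parcs G)" ?b ?\<phi>
    by (rule graph_lie_dual_family)
  have "x \<in> carrier ?L"
    using x by simp
  then obtain y z where yz: "y \<in> vs_span ?L (?b ` chain_index \<kappa> (parcs G))" "z \<in> chain_remainder \<kappa> G"
    "x = y \<oplus>\<^bsub>?L\<^esub> z"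
    by (rule graph_lie_decomposition)
  have z: "z \<in> chain_ideal \<kappa> G"
    using yz(2) chain_remainder_subset by blast
  have "?b ` chain_index \<kappa> (parcs G) \<subseteq> carrier ?L"
    using family_closed by (rule image_subsetI)
  from subsetD[OF span_is_subset2[OF this] yz(1)]
  have c: "y \<in> carrier ?L" "z \<in> carrier ?L"
    using subsetD[OF LinearCombinations.submodule.subset[OF edge_ideal_submodule] in_edge[OF z e\<^sub>0(1)]]
    by simp_all
  have "?\<phi> i y = 0" if i: "i \<in> chain_index \<kappa> (parcs G)" for i
  proof -
    have "?\<phi> i x = 0" "?\<phi> i z = 0"
      using i x kernel[OF z] e\<^sub>0(1) by (cases rule: chain_index_cases; simp add: index_coord_def)+
    moreover have "?\<phi> i x = ?\<phi> i y + ?\<phi> i z"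
      using family_linear[OF i] c yz(3) by (simp add: linear_functional_def)
    ultimately show ?thesis by simp
  qed
  then have "y = \<zero>\<^bsub>?L\<^esub>"
    by (rule span_zero[OF yz(1)])
  then show "x \<in> chain_ideal \<kappa> G"
    using yz(3) z c by simp
qed

text \<open>
  A joint kernel coincides with the ideal that it generates, since this ideal is contained in
  each of the kernels.
\<close>

lemma chain_ideal_is_ideal:
  "alg_ideal (graph_lie (max_chain \<kappa> G) G) (chain_ideal \<kappa> G :: ('v bracketing \<Rightarrow> 'k::field_char_0) set set set set)"
proof -
  let ?L = "graph_lie (max_chain \<kappa> G) G :: ('k, _) module"
  interpret lie_algebra ?L by (rule graph_lie_lie_algebra)
  let ?K = "\<lambda>e. {x \<in> carrier ?L. edge_coords \<kappa> G e x = \<zero>\<^bsub>chain_model (\<kappa> e)\<^esub>}"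
  have K: "alg_ideal ?L (?K e)" if "e \<in> parcs G" for e
    by (rule alg_hom_kernel_ideal[OF bilinear_algebra_axioms lie_bilinear[OF chain_model_lie_algebra]
          edge_coords_hom[OF chain that]])
  have sub: "chain_ideal \<kappa> G \<subseteq> carrier ?L"
    unfolding chain_ideal_eq by blast
  have sub_K: "gen_ideal ?L (chain_ideal \<kappa> G) \<subseteq> ?K e" if "e \<in> parcs G" for e
    using that by (intro gen_ideal_minimal[OF K[OF that]]) (auto simp: chain_ideal_eq)
  have "gen_ideal ?L (chain_ideal \<kappa> G) \<subseteq> chain_ideal \<kappa> G"
  proof
    fix x assume x: "x \<in> gen_ideal ?L (chain_ideal \<kappa> G)"
    have xK: "x \<in> ?K e" if "e \<in> parcs G" for e
      by (rule subsetD[OF sub_K[OF that] x])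
    then have "\<forall>e\<in>parcs G. edge_coords \<kappa> G e x = (\<lambda>n. 0)"
      by simp
    moreover have "x \<in> carrier ?L"
      using xK[OF e\<^sub>0(1)] by simp
    ultimately show "x \<in> chain_ideal \<kappa> G"
      unfolding chain_ideal_eq by simp
  qed
  then have "gen_ideal ?L (chain_ideal \<kappa> G) = chain_ideal \<kappa> G"
    by (intro equalityI gen_ideal_superset)
  then show ?thesis
    using gen_ideal_ideal[OF bilinear_algebra_axioms sub] by simp
qed

section \<open>The standard basis\<close>

lemma chain_lie_lie_algebra: "lie_algebra (chain_lie \<kappa> G)"
  unfolding chain_lie_def by (intro lie_quot_lie_algebra graph_lie_lie_algebra chain_ideal_is_ideal)

definition chain_coords ::
    "'v \<times> 'v \<Rightarrow> ('v bracketing \<Rightarrow> 'k::field_char_0) set set set set \<Rightarrow> nat \<Rightarrow> 'k" where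
  "chain_coords e = coset_lift (edge_coords \<kappa> G e)"

lemma
  assumes e: "e \<in> parcs G"
  shows chain_coords_hom: "alg_hom (chain_lie \<kappa> G :: ('k::field_char_0, _) module) (chain_model (\<kappa> e)) (chain_coords e)"
    and chain_coords_coset: "x \<in> carrier (graph_lie (max_chain \<kappa> G) G :: ('k, _) module) \<Longrightarrow>
      chain_coords e (chain_ideal \<kappa> G +>\<^bsub>graph_lie (max_chain \<kappa> G) G :: ('k, _) module\<^esub> x) = edge_coords \<kappa> G e x"
proof -
  let ?L = "graph_lie (max_chain \<kappa> G) G :: ('k, _) module"
  have kill: "edge_coords \<kappa> G e x = \<zero>\<^bsub>chain_model (\<kappa> e)\<^esub>"
    if "x \<in> chain_ideal \<kappa> G" for x :: "('v bracketing \<Rightarrow> 'k) set set set"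
    using that e by (simp add: chain_ideal_eq)
  note bil = lie_bilinear[OF graph_lie_lie_algebra] lie_bilinear[OF chain_model_lie_algebra]
  show "alg_hom (chain_lie \<kappa> G :: ('k, _) module) (chain_model (\<kappa> e)) (chain_coords e)"
    unfolding chain_lie_def chain_coords_def
    by (rule coset_lift_hom[OF bil edge_coords_hom[OF chain e] chain_ideal_is_ideal kill])
  show "chain_coords e (chain_ideal \<kappa> G +>\<^bsub>?L\<^esub> x) = edge_coords \<kappa> G e x" if "x \<in> carrier ?L"
    unfolding chain_coords_def
    by (rule coset_lift_coset[OF bil edge_coords_hom[OF chain e] chain_ideal_is_ideal kill that])
qed

lemma chain_lie_eval:
  assumes "set_mset (letters t) \<subseteq> pverts G"
  shows "eval_bracketing (chain_lie \<kappa> G :: ('k::field_char_0, _) module) (chain_gen \<kappa> G) t =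
    chain_ideal \<kappa> G +>\<^bsub>graph_lie (max_chain \<kappa> G) G :: ('k, _) module\<^esub>
      eval_bracketing (graph_lie (max_chain \<kappa> G) G) (graph_lie_gen (max_chain \<kappa> G) G) t"
  unfolding chain_lie_def chain_gen_def
proof (rule eval_quot[OF lie_bilinear[OF graph_lie_lie_algebra] chain_ideal_is_ideal])
  fix v assume "v \<in># letters t"
  then show "graph_lie_gen (max_chain \<kappa> G) G v \<in> carrier (graph_lie (max_chain \<kappa> G) G)"
    using assms by (intro bracket_generated_closed[OF graph_lie_generated]) auto
qed

text \<open>
  The family of \<open>graph_lie_dual_family\<close> stays independent in the quotient because its functionals
  vanish on $I_\kappa$, and it becomes spanning because the remainder is killed.
\<close>

lemma chain_lie_dual_basis:
  "dual_basis (chain_lie \<kappa> G :: ('k::field_char_0, _) module) (chain_index \<kappa> (parcs G))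
    (\<lambda>i. eval_bracketing (chain_lie \<kappa> G) (chain_gen \<kappa> G) (index_bracketing r i)) (index_coord chain_coords e\<^sub>0)"
proof -
  let ?k = "max_chain \<kappa> G"
  let ?L = "graph_lie ?k G :: ('k, _) module" and ?C = "chain_lie \<kappa> G :: ('k, _) module"
  let ?J = "chain_index \<kappa> (parcs G)" and ?I = "chain_ideal \<kappa> G :: ('v bracketing \<Rightarrow> 'k) set set set set"
  let ?b = "\<lambda>i. eval_bracketing ?L (graph_lie_gen ?k G) (index_bracketing r i)"
  let ?c = "\<lambda>i. eval_bracketing ?C (chain_gen \<kappa> G) (index_bracketing r i)"
  interpret L: dual_family ?L ?J ?b "index_coord (edge_coords \<kappa> G) e\<^sub>0"
    by (rule graph_lie_dual_family)
  interpret C: lie_algebra ?C by (rule chain_lie_lie_algebra)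
  have c: "?c i = ?I +>\<^bsub>?L\<^esub> ?b i" if "i \<in> ?J" for i
    by (rule chain_lie_eval[OF index_letters[OF that]])
  have carr: "carrier ?C = (\<lambda>x. ?I +>\<^bsub>?L\<^esub> x) ` carrier ?L"
    unfolding chain_lie_def by (rule L.quot_carrier)
  have coord: "index_coord chain_coords e\<^sub>0 i (?I +>\<^bsub>?L\<^esub> x) = index_coord (edge_coords \<kappa> G) e\<^sub>0 i x"
    if "i \<in> ?J" "x \<in> carrier ?L" for i x
    using that(1) chain_coords_coset[OF _ that(2)] e\<^sub>0(1)
    by (cases rule: chain_index_cases) (auto simp: index_coord_def)
  have cc: "?c i \<in> carrier ?C" if "i \<in> ?J" for i
    using L.family_closed[OF that] unfolding c[OF that] carr by blast
  have lin: "linear_functional ?C (\<lambda>x. chain_coords e x n)" if "e \<in> parcs G" for e n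
    by (rule chain_hom_functional[OF chain_coords_hom[OF that]])
  show ?thesis
  proof
    show "finite ?J"
      by (rule chain_index_finite)
  next
    fix i assume i: "i \<in> ?J"
    show "?c i \<in> carrier ?C"
      by (rule cc[OF i])
    show "linear_functional ?C (index_coord chain_coords e\<^sub>0 i)"
      using i by (cases rule: chain_index_cases) (auto simp: index_coord_def[abs_def] lin e\<^sub>0)
    fix j assume j: "j \<in> ?J"
    show "index_coord chain_coords e\<^sub>0 i (?c j) = (if i = j then 1 else 0)"
      unfolding c[OF j] coord[OF i L.family_closed[OF j]] by (rule L.family_dual[OF i j])
  next
    have cJ: "?c ` ?J \<subseteq> carrier ?C"
      using cc by blast
    interpret S: LinearCombinations.submodule class_ring "vs_span ?C (?c ` ?J)" ?C
      by (rule C.span_is_submodule[OF cJ])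
    have hom: "alg_hom ?L ?C (\<lambda>x. ?I +>\<^bsub>?L\<^esub> x)"
      unfolding chain_lie_def by (rule L.coset_hom[OF chain_ideal_is_ideal])
    have "vs_span ?L (?b ` ?J) \<subseteq> {x \<in> carrier ?L. ?I +>\<^bsub>?L\<^esub> x \<in> vs_span ?C (?c ` ?J)}"
    proof (rule L.span_minimal)
      show "LinearCombinations.submodule class_ring
          {x \<in> carrier ?L. ?I +>\<^bsub>?L\<^esub> x \<in> vs_span ?C (?c ` ?J)} ?L"
        by (rule preimage_submodule[OF L.bilinear_algebra_axioms C.bilinear_algebra_axioms hom
              S.submodule_axioms])
      show "?b ` ?J \<subseteq> {x \<in> carrier ?L. ?I +>\<^bsub>?L\<^esub> x \<in> vs_span ?C (?c ` ?J)}"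
      proof clarify
        fix i assume i: "i \<in> ?J"
        have "?c i \<in> vs_span ?C (?c ` ?J)"
          by (rule subsetD[OF C.in_own_span[OF cJ] imageI[OF i]])
        then show "?b i \<in> carrier ?L \<and> ?I +>\<^bsub>?L\<^esub> ?b i \<in> vs_span ?C (?c ` ?J)"
          using L.family_closed[OF i] c[OF i] by simp
      qed
    qed
    from subsetD[OF this]
    have span: "?I +>\<^bsub>?L\<^esub> y \<in> vs_span ?C (?c ` ?J)" "y \<in> carrier ?L" if "y \<in> vs_span ?L (?b ` ?J)" for y
      using that by simp_all
    have "carrier ?C \<subseteq> vs_span ?C (?c ` ?J)"
      unfolding carr
    proof clarify
      fix x assume "x \<in> carrier ?L"
      then obtain y z where yz: "y \<in> vs_span ?L (?b ` ?J)" "z \<in> chain_remainder \<kappa> G"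
        "x = y \<oplus>\<^bsub>?L\<^esub> z"
        by (rule graph_lie_decomposition)
      have z: "z \<in> ?I"
        using yz(2) chain_remainder_subset by blast
      then have zc: "z \<in> carrier ?L"
        using alg_ideal_subset[OF chain_ideal_is_ideal] by blast
      have "?I +>\<^bsub>?L\<^esub> x = ?I +>\<^bsub>?L\<^esub> y"
        unfolding yz(3) L.a_comm[OF span(2)[OF yz(1)] zc]
        by (rule L.coset_absorb[OF chain_ideal_is_ideal z span(2)[OF yz(1)]])
      then show "?I +>\<^bsub>?L\<^esub> x \<in> vs_span ?C (?c ` ?J)"
        using span(1)[OF yz(1)] by simp
    qed
    then show "vs_span ?C (?c ` ?J) = carrier ?C"
      using S.subset by blast
  qed
qed

lemma chain_w_eval:
  "chain_w \<kappa> G e (Suc l) = eval_bracketing (chain_lie \<kappa> G :: ('k::field_char_0, _) module) (chain_gen \<kappa> G)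
    (chain_bracketing e l)"
  by (cases e, induction l) auto

lemma std_basis_eq:
  "std_basis \<kappa> G = (\<lambda>i. eval_bracketing (chain_lie \<kappa> G :: ('k::field_char_0, _) module) (chain_gen \<kappa> G)
    (index_bracketing r i)) ` chain_index \<kappa> (parcs G)"
  (is "_ = ?c ` ?J")
proof (intro equalityI subsetI)
  have w: "chain_w \<kappa> G e l = ?c (Some (e, l))" if "1 \<le> l" for e l
    using that chain_w_eval[of e "l - 1"] by (simp add: index_bracketing_def)
  fix x :: "('v bracketing \<Rightarrow> 'k) set set set set"
  {
    assume "x \<in> std_basis \<kappa> G"
    then consider v where "v \<in> pverts G" "x = chain_gen \<kappa> G v"
      | e l where "e \<in> parcs G" "2 \<le> l" "l \<le> \<kappa> e" "x = chain_w \<kappa> G e l"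
      unfolding std_basis_def by blast
    then show "x \<in> ?c ` ?J"
    proof cases
      case (1 v)
      show ?thesis
      proof (cases "v = r")
        case True
        then have "x = ?c None"
          using 1 by (simp add: index_bracketing_def)
        moreover have "None \<in> ?J"
          by (simp add: chain_index_def)
        ultimately show ?thesis by blast
      next
        case False
        then obtain u where vu: "(v, u) \<in> parcs G"
          using exit_exists[OF chain root 1(1)] by blast
        have "x = ?c (Some ((v, u), 1))"
          using 1 by (simp add: index_bracketing_def)
        moreover have "Some ((v, u), 1) \<in> ?J"
          using vu chain_digraph_edge(4)[OF chain vu] by (auto simp: chain_index_def)
        ultimately show ?thesis by blast
      qed
    next
      case (2 e l)
      then have "x = ?c (Some (e, l))"
        using w[of l e] by simp
      moreover have "Some (e, l) \<in> ?J"
        using 2 by (auto simp: chain_index_def)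
      ultimately show ?thesis by blast
    qed
  }
  assume "x \<in> ?c ` ?J"
  then obtain i where i: "i \<in> ?J" "x = ?c i"
    by blast
  from i(1) show "x \<in> std_basis \<kappa> G"
  proof (cases rule: chain_index_cases)
    case 1
    then show ?thesis
      using i(2) root by (auto simp: std_basis_def index_bracketing_def directed_to_root_def)
  next
    case (2 e l)
    show ?thesis
    proof (cases "l = 1")
      case True
      then have "x = chain_gen \<kappa> G (fst e)"
        using i(2) 2 by (simp add: index_bracketing_def)
      then show ?thesis
        using chain_digraph_edge(1)[OF chain 2(2)] by (auto simp: std_basis_def)
    next
      case False
      then have "x = chain_w \<kappa> G e l" "2 \<le> l"
        using i(2) 2 w[of l e] by auto
      then show ?thesis
        using 2 unfolding std_basis_def by blast
    qed
  qed
qed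

end

section \<open>Two-forms\<close>

lemma d2_rel_add:
  assumes "d2_rel L \<omega> \<eta>" "d2_rel L \<omega>' \<eta>'"
  shows "d2_rel L (\<lambda>xs. \<omega> xs + \<omega>' xs) (\<lambda>xs. \<eta> xs + \<eta>' xs)"
  using assms(2)
proof (induction rule: d2_rel.induct)
  case zero
  then show ?case using assms(1) by simp
next
  case (add \<omega>' \<eta>' \<alpha> \<beta>)
  from d2_rel.add[OF add.IH add.hyps(2,3)] show ?case
    by (simp only: add.assoc)
qed

lemma two_forms_zero: "(\<lambda>xs. 0) \<in> two_forms L"
  using d2_rel.zero by (auto simp: two_forms_def)

lemma two_forms_add: "\<omega> \<in> two_forms L \<Longrightarrow> \<omega>' \<in> two_forms L \<Longrightarrow> (\<lambda>xs. \<omega> xs + \<omega>' xs) \<in> two_forms L"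
  using d2_rel_add by (fastforce simp: two_forms_def)

lemma two_forms_sum:
  assumes "\<And>i. i \<in> A \<Longrightarrow> \<omega> i \<in> two_forms L"
  shows "(\<lambda>xs. \<Sum>i\<in>A. \<omega> i xs) \<in> two_forms L"
  using assms
  by (induction A rule: infinite_finite_induct) (auto simp: two_forms_zero intro: two_forms_add)

lemma two_forms_scaled_wedge:
  assumes "\<alpha> \<in> dual_space L" "\<beta> \<in> dual_space L"
  shows "(\<lambda>xs. c * (form1 \<alpha> \<and>\<^sub>f form1 \<beta>) xs) \<in> two_forms L"
proof -
  have "(\<lambda>x. c * \<alpha> x) \<in> dual_space L"
    using assms(1) by (auto simp: dual_space_def distrib_left)
  from d2_rel.add[OF d2_rel.zero this assms(2)]
  have "(\<lambda>xs. (form1 (\<lambda>x. c * \<alpha> x) \<and>\<^sub>f form1 \<beta>) xs) \<in> two_forms L"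
    by (auto simp: two_forms_def)
  moreover have "form1 (\<lambda>x. c * \<alpha> x) ys = c * form1 \<alpha> ys" for ys
    by (simp add: form1_def split: list.split)
  ultimately show ?thesis
    by (simp add: wedge_def sum_distrib_left mult_ac)
qed

lemma two_forms_length:
  assumes "\<omega> \<in> two_forms L" "length xs \<noteq> 2"
  shows "\<omega> xs = 0"
proof -
  obtain \<eta> where "d2_rel L \<omega> \<eta>"
    using assms(1) by (auto simp: two_forms_def)
  then show ?thesis
  proof (induction rule: d2_rel.induct)
    case (add \<omega> \<eta> \<alpha> \<beta>)
    have "(form1 \<alpha> \<and>\<^sub>f form1 \<beta>) xs = 0"
      using assms(2) by (intro wedge_length_neq[where p = 1 and q = 1]) (auto simp: form1_length_neq)
    then show ?case using add.IH by simp
  qed simp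
qed

text \<open>
  The condition is the value of $d \omega$ on three vectors.
\<close>

lemma two_form_closedI:
  assumes "\<omega> \<in> two_forms L"
    and "\<And>x y z. x \<in> carrier L \<Longrightarrow> y \<in> carrier L \<Longrightarrow> z \<in> carrier L \<Longrightarrow>
      \<omega> [x \<otimes>\<^bsub>L\<^esub> y, z] - \<omega> [x \<otimes>\<^bsub>L\<^esub> z, y] + \<omega> [y \<otimes>\<^bsub>L\<^esub> z, x] = 0"
  shows "d2 L \<omega> = (\<lambda>_. 0)"
proof -
  obtain \<eta> where \<eta>: "d2_rel L \<omega> \<eta>"
    using assms(1) by (auto simp: two_forms_def)
  have "\<eta> = (\<lambda>_. 0)"
    unfolding d2_rel_formula[OF \<eta>] using assms(2) by (auto simp: fun_eq_iff split: list.split)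
  then show ?thesis
    using d2_eqI[OF \<eta>] by simp
qed

section \<open>Powers of a form on hyperbolic pairs\<close>

lemma nths_pair:
  assumes "p < q" "q < length xs"
  shows "nths xs {p, q} = [xs ! p, xs ! q]"
proof -
  have "nths xs {p, q} = map (\<lambda>i. xs ! i) (filter (\<lambda>i. i \<in> {p, q}) [0..<length xs])"
  proof -
    have "zip xs [0..<length xs] = map (\<lambda>i. (xs ! i, i)) [0..<length xs]"
      by (intro nth_equalityI) auto
    then show ?thesis
      by (simp add: nths_def filter_map comp_def)
  qed
  also have "filter (\<lambda>i. i \<in> {p, q}) [0..<length xs] = [p, q]"
    by (rule sorted_distinct_set_unique) (use assms in \<open>auto intro: sorted_wrt_filter\<close>)
  finally show ?thesis by simp
qed

lemma length_concat_pairs: "length (concat (map (\<lambda>i. [u i, v i]) is)) = 2 * length is"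
  by (induction "is") auto

lemma nth_concat_pairs:
  assumes "m < length is"
  shows "concat (map (\<lambda>i. [u i, v i]) is) ! (2 * m) = u (is ! m)"
    and "concat (map (\<lambda>i. [u i, v i]) is) ! Suc (2 * m) = v (is ! m)"
  using assms
proof (induction "is" arbitrary: m)
  case (Cons a "is")
  {
    case 1
    then show ?case using Cons.IH(1)[of "m - 1"] by (cases m) auto
  next
    case 2
    then show ?case using Cons.IH(2)[of "m - 1"] by (cases m) auto
  }
qed auto

lemma nths_pair_complement:
  assumes "length as = 2 * m"
  shows "nths (as @ [x, y] @ bs) (- {2 * m, Suc (2 * m)}) = as @ bs"
proof -
  have "nths as (- {2 * m, Suc (2 * m)}) = as"
    using assms by (intro nths_all) auto
  moreover have "nths bs {j. Suc (Suc (j + 2 * m)) \<in> - {2 * m, Suc (2 * m)}} = bs"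
    by (intro nths_all) auto
  ultimately show ?thesis
    using assms by (simp add: nths_append nths_Cons)
qed

text \<open>
  Each entry before the pair contributes two inversions.
\<close>

lemma shuffle_sign_pair:
  assumes "Suc (2 * m) < n"
  shows "shuffle_sign n {2 * m, Suc (2 * m)} = 1"
proof -
  have "{(i, j). i < j \<and> j < n \<and> i \<notin> {2 * m, Suc (2 * m)} \<and> j \<in> {2 * m, Suc (2 * m)}} =
      {..<2 * m} \<times> {2 * m, Suc (2 * m)}"
    using assms by auto
  then show ?thesis
    by (simp add: shuffle_sign_def card_cartesian_product power_mult)
qed

text \<open>
  The value of $\omega^n$ on $n$ mutually orthogonal pairs is $n!$ times the product of the values on
  the pairs. In the shuffle sum for $\omega \wedge \omega^{n-1}$ only those shuffles contribute that send one
  of the $n$ pairs to the first factor.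
\<close>

lemma wedge_power_pairs:
  fixes \<omega> :: "('k::field_char_0, 'a) form" and u v :: "'i \<Rightarrow> 'a"
  assumes len: "\<And>ys. length ys \<noteq> 2 \<Longrightarrow> \<omega> ys = 0"
    and "distinct is"
    and "\<And>i j x y. i \<in> set is \<Longrightarrow> j \<in> set is \<Longrightarrow> i \<noteq> j \<Longrightarrow> x \<in> {u i, v i} \<Longrightarrow> y \<in> {u j, v j} \<Longrightarrow>
      \<omega> [x, y] = 0"
  shows "wedge_power \<omega> (length is) (concat (map (\<lambda>i. [u i, v i]) is)) =
    fact (length is) * (\<Prod>i\<leftarrow>is. \<omega> [u i, v i])"
  using assms(2,3)
proof (induction "length is" arbitrary: "is")
  case 0
  then show ?case by simp
next
  case (Suc n)
  let ?flat = "\<lambda>is. concat (map (\<lambda>i. [u i, v i]) is)"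
  let ?zs = "?flat is" and ?\<psi> = "wedge_power \<omega> n"
  let ?F = "\<lambda>S. shuffle_sign (length ?zs) S * \<omega> (nths ?zs S) * ?\<psi> (nths ?zs (- S))"
  let ?g = "\<lambda>m. {2 * m, Suc (2 * m)}"
  let ?P = "\<Prod>i\<leftarrow>is. \<omega> [u i, v i]"
  have lz: "length ?zs = 2 * Suc n"
    unfolding length_concat_pairs Suc.hyps(2) ..
  (* A set of two positions from different pairs gives two orthogonal vectors; a set with another
     number of elements gives a list of the wrong length. *)
  have zero: "?F S = 0" if S: "S \<in> Pow {..<length ?zs} - ?g ` {..<Suc n}" for S
  proof (cases "card S = 2")
    case False
    have "{i. i < length ?zs \<and> i \<in> S} = S"
      using S by auto
    then have "length (nths ?zs S) \<noteq> 2"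
      using False by (simp add: length_nths)
    then show ?thesis
      using len by simp
  next
    case True
    then obtain p q where pq: "S = {p, q}" "p < q"
      by (metis card_2_iff insert_commute linorder_neqE_nat)
    have q: "q < length ?zs"
      using S pq by simp
    define a c where "a = p div 2" and "c = q div 2"
    have ac: "a < length is" "c < length is"
      using q pq(2) lz Suc.hyps(2) by (auto simp: a_def c_def)
    have p_cases: "p = 2 * a \<or> p = Suc (2 * a)" and q_cases: "q = 2 * c \<or> q = Suc (2 * c)"
      by (auto simp: a_def c_def)
    have "a \<noteq> c"
    proof
      assume "a = c"
      then have "S = ?g a"
        using p_cases q_cases pq by auto
      then show False
        using S ac(1) Suc.hyps(2) by auto
    qed
    then have "is ! a \<noteq> is ! c"
      using Suc.prems(1) ac by (simp add: nth_eq_iff_index_eq)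
    moreover have "?zs ! p \<in> {u (is ! a), v (is ! a)}" "?zs ! q \<in> {u (is ! c), v (is ! c)}"
      using p_cases q_cases nth_concat_pairs[OF ac(1), of u v] nth_concat_pairs[OF ac(2), of u v] by auto
    ultimately have "\<omega> [?zs ! p, ?zs ! q] = 0"
      using ac by (intro Suc.prems(2)[of "is ! a" "is ! c"]) auto
    then show ?thesis
      using nths_pair[OF pq(2) q] pq(1) by simp
  qed
  have summand: "?F (?g m) = fact n * ?P" if m: "m < Suc n" for m
  proof -
    have mi: "m < length is"
      using m Suc.hyps(2) by simp
    let ?as = "take m is" and ?bs = "drop (Suc m) is"
    have split: "is = ?as @ is ! m # ?bs"
      by (rule id_take_nth_drop[OF mi])
    have zs: "?zs = ?flat ?as @ [u (is ! m), v (is ! m)] @ ?flat ?bs"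
      by (subst split) simp
    have la: "length (?flat ?as) = 2 * m"
      unfolding length_concat_pairs using mi by simp
    have "nths ?zs (?g m) = [u (is ! m), v (is ! m)]"
      using nths_pair[of "2 * m" "Suc (2 * m)" ?zs] m lz nth_concat_pairs[OF mi, of u v] by simp
    moreover have "nths ?zs (- ?g m) = ?flat (?as @ ?bs)"
      unfolding zs nths_pair_complement[OF la] by simp
    moreover have "shuffle_sign (length ?zs) (?g m) = (1::'k)"
      using m lz by (intro shuffle_sign_pair) simp
    moreover have "?\<psi> (?flat (?as @ ?bs)) = fact n * (\<Prod>i\<leftarrow>?as @ ?bs. \<omega> [u i, v i])"
    proof -
      have ln: "n = length (?as @ ?bs)"
        using mi Suc.hyps(2) by simp
      have dist: "distinct (?as @ ?bs)"
        using Suc.prems(1) by (subst (asm) split) simp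
      have sub: "set (?as @ ?bs) \<subseteq> set is"
        using set_take_subset[of m "is"] set_drop_subset[of "Suc m" "is"] by auto
      have "wedge_power \<omega> (length (?as @ ?bs)) (?flat (?as @ ?bs)) =
          fact (length (?as @ ?bs)) * (\<Prod>i\<leftarrow>?as @ ?bs. \<omega> [u i, v i])"
      proof (rule Suc.hyps(1)[OF ln dist])
        fix i j x y assume "i \<in> set (?as @ ?bs)" "j \<in> set (?as @ ?bs)" "i \<noteq> j"
          "x \<in> {u i, v i}" "y \<in> {u j, v j}"
        then show "\<omega> [x, y] = 0"
          using sub by (intro Suc.prems(2)[of i j x y]) auto
      qed
      then show ?thesis
        by (simp only: ln[symmetric])
    qed
    moreover have "?P = (\<Prod>i\<leftarrow>?as @ ?bs. \<omega> [u i, v i]) * \<omega> [u (is ! m), v (is ! m)]"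
      by (subst split) (simp add: mult_ac)
    ultimately show ?thesis
      by (simp add: mult_ac)
  qed
  have "wedge_power \<omega> (length is) ?zs = (\<Sum>S\<in>Pow {..<length ?zs}. ?F S)"
    unfolding Suc.hyps(2)[symmetric] wedge_power.simps wedge_def ..
  also have "\<dots> = (\<Sum>S\<in>?g ` {..<Suc n}. ?F S)"
    using zero lz by (intro sum.mono_neutral_right) auto
  also have "\<dots> = (\<Sum>m<Suc n. ?F (?g m))"
  proof (subst sum.reindex)
    show "inj_on ?g {..<Suc n}"
      by (rule inj_onI) (auto simp: doubleton_eq_iff)
  qed simp
  also have "\<dots> = (\<Sum>m<Suc n. fact n * ?P)"
    by (intro sum.cong refl summand) simp
  also have "\<dots> = fact (length is) * ?P"
    unfolding Suc.hyps(2)[symmetric] by (simp add: algebra_simps)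
  finally show ?case .
qed

section \<open>The alternating pairing on the chain model\<close>

text \<open>
  The 2-form of a chain of even length \<open>n\<close>, evaluated on coefficient functions.
\<close>

definition alternating_pairing :: "nat \<Rightarrow> (nat \<Rightarrow> 'k::field_char_0) \<Rightarrow> (nat \<Rightarrow> 'k) \<Rightarrow> 'k" where
  "alternating_pairing n x y =
     (\<Sum>l = 1..n div 2. (- 1) ^ (l + 1) * (x l * y (n + 1 - l) - x (n + 1 - l) * y l))"

text \<open>
  Since \<open>n\<close> is even, the substitution $l \mapsto n + 1 - l$ reverses the sign $(-1)^{l+1}$, so
  the subtracted products are the terms of the second half of the sum.
\<close>

lemma alternating_pairing_full:
  assumes "even n"
  shows "alternating_pairing n x y = (\<Sum>l = 1..n. (- 1) ^ (l + 1) * x l * y (n + 1 - l))"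
proof -
  obtain h where h: "n = 2 * h"
    using assms by blast
  let ?f = "\<lambda>l. (- 1) ^ (l + 1) * x l * y (n + 1 - l)"
  have "(\<Sum>l = 1..n. ?f l) = (\<Sum>l = 1..h. ?f l) + (\<Sum>l = Suc h..n. ?f l)"
  proof -
    have "{1..n} = {1..h} \<union> {Suc h..n}"
      using h by auto
    then show ?thesis
      by (simp add: sum.union_disjoint)
  qed
  also have "(\<Sum>l = Suc h..n. ?f l) = (\<Sum>l = 1..h. - ((- 1) ^ (l + 1) * x (n + 1 - l) * y l))"
  proof (rule sum.reindex_bij_witness[where i = "\<lambda>l. n + 1 - l" and j = "\<lambda>l. n + 1 - l"])
    fix l assume l: "l \<in> {Suc h..n}"
    then obtain d where d: "n = l + d" by (metis atLeastAtMost_iff le_Suc_ex)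
    have "(- 1 :: 'a) ^ (l + 1) = - ((- 1) ^ (n + 1 - l + 1))"
    proof -
      have "(- 1 :: 'a) ^ l * (- 1) ^ d = 1"
        using assms d by (simp flip: power_add)
      then have "(- 1 :: 'a) ^ l = (- 1) ^ d"
        by (cases "even l"; cases "even d") auto
      then show ?thesis
        using d by simp
    qed
    then show "- ((- 1) ^ (n + 1 - l + 1) * x (n + 1 - (n + 1 - l)) * y (n + 1 - l)) = ?f l"
      using l by auto
  qed (use h in auto)
  finally show ?thesis
    unfolding alternating_pairing_def using h
    by (simp add: sum.distrib[symmetric] sum_negf algebra_simps flip: sum_subtractf)
qed

text \<open>
  Let $X$ be the shift $w^l \mapsto w^{l+1}$, so that $[x, y] = y_0 X x - x_0 X y$. The form
  $S(x, z)$, which is the pairing of $X x$ with $z$, is symmetric because the signs alternate and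
  \<open>n\<close> is even. In the cyclic sum each coefficient $x_0$, $y_0$, $z_0$ multiplies a difference of
  two values of $S$ that cancel.
\<close>

lemma alternating_pairing_closed:
  fixes x y z :: "nat \<Rightarrow> 'k::field_char_0"
  assumes n: "even n" "n \<le> c"
  defines "br \<equiv> \<lambda>x y. x \<otimes>\<^bsub>chain_model c\<^esub> y"
  shows "alternating_pairing n (br x y) z - alternating_pairing n (br x z) y +
    alternating_pairing n (br y z) x = 0"
proof (cases "n = 0")
  case False
  then obtain m where m: "n = Suc m"
    by (cases n) auto
  define S where "S = (\<lambda>x z :: nat \<Rightarrow> 'k. \<Sum>l = 1..m. (- 1) ^ l * (x l * z (n - l)))"
  have shift: "alternating_pairing n (br x y) z = y 0 * S x z - x 0 * S y z" for x y z
  proof -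
    let ?f = "\<lambda>l. (- 1) ^ (l + 1) * br x y l * z (n + 1 - l)"
    have "alternating_pairing n (br x y) z = (\<Sum>l = 1..n. ?f l)"
      by (rule alternating_pairing_full[OF n(1)])
    also have "\<dots> = ?f 1 + (\<Sum>l = Suc 1..Suc m. ?f l)"
      unfolding m by (rule sum.atLeast_Suc_atMost) simp
    also have "(\<Sum>l = Suc 1..Suc m. ?f l) = (\<Sum>l = 1..m. ?f (Suc l))"
      by (rule sum.shift_bounds_cl_Suc_ivl)
    also have "\<dots> = (\<Sum>l = 1..m. y 0 * ((- 1) ^ l * (x l * z (n - l))) - x 0 * ((- 1) ^ l * (y l * z (n - l))))"
      using n(2) m by (intro sum.cong refl) (auto simp: br_def algebra_simps)
    finally show ?thesis
      by (simp add: S_def br_def sum_subtractf sum_distrib_left)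
  qed
  have sym: "S x z = S z x" for x z
    unfolding S_def
  proof (rule sum.reindex_bij_witness[where i = "\<lambda>l. n - l" and j = "\<lambda>l. n - l"])
    fix l assume l: "l \<in> {1..m}"
    have "(- 1 :: 'k) ^ (n - l) = (- 1) ^ l"
      using n(1) l m by (auto simp: minus_one_power_iff)
    then show "(- 1) ^ (n - l) * (z (n - l) * x (n - (n - l))) = (- 1) ^ l * (x l * z (n - l))"
      using l m by (simp add: mult_ac)
  qed (use m in auto)
  show ?thesis
    unfolding shift using sym[of x y] sym[of x z] sym[of y z] by (simp add: algebra_simps)
qed (simp add: alternating_pairing_def)

section \<open>The symplectic form\<close>

text \<open>
  What the construction of the symplectic form uses of $\mathfrak g(\kappa, G)$: the standard basis
  with its labels, and the homomorphisms \<open>\<Phi> e\<close> whose coordinates form the dual basis.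
\<close>

locale chain_coordinates = lie_algebra L + dual_basis L "chain_index \<kappa> E" b "index_coord \<Phi> e\<^sub>0"
  for L :: "('k::field_char_0, 'a) module" (structure) and E :: "('v \<times> 'v) set"
    and \<kappa> :: "'v \<times> 'v \<Rightarrow> nat" and e\<^sub>0 :: "'v \<times> 'v"
    and b :: "(('v \<times> 'v) \<times> nat) option \<Rightarrow> 'a" and \<Phi> :: "'v \<times> 'v \<Rightarrow> 'a \<Rightarrow> nat \<Rightarrow> 'k" +
  assumes finite_E: "finite E"
    and coords_hom: "e \<in> E \<Longrightarrow> alg_hom L (chain_model (\<kappa> e)) (\<Phi> e)"
    and length_ge: "e \<in> E \<Longrightarrow> 2 \<le> \<kappa> e"
    and odd_edge: "e\<^sub>0 \<in> E" "odd (\<kappa> e\<^sub>0)"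
    and even_edge: "e \<in> E \<Longrightarrow> e \<noteq> e\<^sub>0 \<Longrightarrow> even (\<kappa> e)"
begin

abbreviation "J \<equiv> chain_index \<kappa> E"

definition dual_form :: "(('v \<times> 'v) \<times> nat) option \<Rightarrow> ('k, 'a) form" where
  "dual_form i = form1 (dual_basis_elem L (b ` J) (b i))"

definition alternating_form :: "'v \<times> 'v \<Rightarrow> nat \<Rightarrow> ('k, 'a) form" where
  "alternating_form e n xs = (\<Sum>l = 1..n div 2. (- 1) ^ (l + 1) *
     (dual_form (Some (e, l)) \<and>\<^sub>f dual_form (Some (e, n + 1 - l))) xs)"

definition edge_form :: "'v \<times> 'v \<Rightarrow> ('k, 'a) form" where
  "edge_form e xs = (if even (\<kappa> e) then alternating_form e (\<kappa> e) xs
     else (dual_form None \<and>\<^sub>f dual_form (Some (e, \<kappa> e))) xs + alternating_form e (\<kappa> e - 1) xs)"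

definition total_form :: "('k, 'a) form" where
  "total_form xs = (\<Sum>e\<in>E. edge_form e xs)"

lemma None_index: "None \<in> J"
  by (simp add: chain_index_def)

lemma Some_index: "e \<in> E \<Longrightarrow> 1 \<le> l \<Longrightarrow> l \<le> \<kappa> e \<Longrightarrow> Some (e, l) \<in> J"
  by (auto simp: chain_index_def)

lemma wedge_two_form: "i \<in> J \<Longrightarrow> j \<in> J \<Longrightarrow> (\<lambda>xs. c * (dual_form i \<and>\<^sub>f dual_form j) xs) \<in> two_forms L"
  unfolding dual_form_def
  by (intro two_forms_scaled_wedge) (simp_all add: dual_basis_elem_eq functional_dual_space)

lemma alternating_two_form:
  assumes "e \<in> E" "n \<le> \<kappa> e"
  shows "alternating_form e n \<in> two_forms L"
  unfolding alternating_form_def[abs_def] using assms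
  by (intro two_forms_sum wedge_two_form Some_index) auto

lemma edge_two_form:
  assumes "e \<in> E"
  shows "edge_form e \<in> two_forms L"
proof (cases "even (\<kappa> e)")
  case True
  then show ?thesis
    using alternating_two_form[OF assms, of "\<kappa> e"] by (simp add: edge_form_def[abs_def])
next
  case False
  have "(\<lambda>xs. 1 * (dual_form None \<and>\<^sub>f dual_form (Some (e, \<kappa> e))) xs) \<in> two_forms L"
    using length_ge[OF assms] by (intro wedge_two_form None_index Some_index assms) auto
  from two_forms_add[OF this alternating_two_form[OF assms, of "\<kappa> e - 1"]] show ?thesis
    using False by (simp add: edge_form_def[abs_def])
qed

lemma total_two_form: "total_form \<in> two_forms L"
  unfolding total_form_def[abs_def] by (intro two_forms_sum edge_two_form)

text \<open>
  The 2-form on the chain model of which $\sigma_e$ is the pullback along \<open>\<Phi> e\<close>.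
\<close>

definition edge_pairing :: "'v \<times> 'v \<Rightarrow> (nat \<Rightarrow> 'k) \<Rightarrow> (nat \<Rightarrow> 'k) \<Rightarrow> 'k" where
  "edge_pairing e x y = (if even (\<kappa> e) then alternating_pairing (\<kappa> e) x y
     else x 0 * y (\<kappa> e) - x (\<kappa> e) * y 0 + alternating_pairing (\<kappa> e - 1) x y)"

lemma wedge_dual_form:
  assumes "i \<in> J" "j \<in> J" "x \<in> carrier L" "y \<in> carrier L"
  shows "(dual_form i \<and>\<^sub>f dual_form j) [x, y] =
    index_coord \<Phi> e\<^sub>0 i x * index_coord \<Phi> e\<^sub>0 j y - index_coord \<Phi> e\<^sub>0 i y * index_coord \<Phi> e\<^sub>0 j x"
  using assms by (simp add: dual_form_def dual_basis_elem_eq wedge_form1)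

lemma alternating_form_eval:
  assumes "e \<in> E" "n \<le> \<kappa> e" "x \<in> carrier L" "y \<in> carrier L"
  shows "alternating_form e n [x, y] = alternating_pairing n (\<Phi> e x) (\<Phi> e y)"
  unfolding alternating_form_def alternating_pairing_def
proof (intro sum.cong refl)
  fix l assume "l \<in> {1..n div 2}"
  then have "Some (e, l) \<in> J" "Some (e, n + 1 - l) \<in> J"
    using assms(1,2) by (auto intro!: Some_index)
  from wedge_dual_form[OF this assms(3,4)]
  show "(- 1) ^ (l + 1) * (dual_form (Some (e, l)) \<and>\<^sub>f dual_form (Some (e, n + 1 - l))) [x, y] =
      (- 1) ^ (l + 1) * (\<Phi> e x l * \<Phi> e y (n + 1 - l) - \<Phi> e x (n + 1 - l) * \<Phi> e y l)"
    by (simp add: index_coord_def mult.commute)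
qed

lemma edge_form_eval:
  assumes "e \<in> E" "x \<in> carrier L" "y \<in> carrier L"
  shows "edge_form e [x, y] = edge_pairing e (\<Phi> e x) (\<Phi> e y)"
proof (cases "even (\<kappa> e)")
  case True
  then show ?thesis
    using alternating_form_eval[of e "\<kappa> e"] assms by (simp add: edge_form_def edge_pairing_def)
next
  case False
  then have e: "e = e\<^sub>0"
    using even_edge assms(1) by blast
  have "Some (e, \<kappa> e) \<in> J"
    using length_ge[OF assms(1)] assms(1) by (intro Some_index) auto
  from wedge_dual_form[OF None_index this assms(2,3)] show ?thesis
    using alternating_form_eval[of e "\<kappa> e - 1"] assms False
    by (simp add: edge_form_def edge_pairing_def index_coord_def e mult.commute)
qed

lemma total_form_eval:
  assumes "x \<in> carrier L" "y \<in> carrier L"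
  shows "total_form [x, y] = (\<Sum>e\<in>E. edge_pairing e (\<Phi> e x) (\<Phi> e y))"
  unfolding total_form_def using assms by (intro sum.cong refl edge_form_eval)

text \<open>
  On the odd edge the extra term $v_j^* \wedge (w^\kappa)^*$ is closed by itself:
  $d (w^\kappa)^* = (w^{\kappa-1})^* \wedge v_j^*$, and the product with $v_j^*$ vanishes.
\<close>

lemma edge_pairing_closed:
  fixes x y z :: "nat \<Rightarrow> 'k"
  assumes "e \<in> E"
  defines "br \<equiv> \<lambda>x y. x \<otimes>\<^bsub>chain_model (\<kappa> e)\<^esub> y"
  shows "edge_pairing e (br x y) z - edge_pairing e (br x z) y + edge_pairing e (br y z) x = 0"
proof (cases "even (\<kappa> e)")
  case True
  then show ?thesis
    using alternating_pairing_closed[of "\<kappa> e" "\<kappa> e" x y z] by (simp only: edge_pairing_def br_def if_True)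
next
  case False
  have "alternating_pairing (\<kappa> e - 1) (br x y) z - alternating_pairing (\<kappa> e - 1) (br x z) y +
      alternating_pairing (\<kappa> e - 1) (br y z) x = 0"
    unfolding br_def using False by (intro alternating_pairing_closed) auto
  moreover have br0: "br x y 0 = 0" for x y
    by (simp add: br_def)
  have "edge_pairing e (br x y) z - edge_pairing e (br x z) y + edge_pairing e (br y z) x =
      (alternating_pairing (\<kappa> e - 1) (br x y) z - alternating_pairing (\<kappa> e - 1) (br x z) y +
        alternating_pairing (\<kappa> e - 1) (br y z) x) -
      (br x y (\<kappa> e) * z 0 - br x z (\<kappa> e) * y 0 + br y z (\<kappa> e) * x 0)"
    using False br0 by (simp add: edge_pairing_def algebra_simps)
  moreover have br_top: "br x y (\<kappa> e) = x (\<kappa> e - 1) * y 0 - x 0 * y (\<kappa> e - 1)" for x y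
    using length_ge[OF assms(1)] by (auto simp: br_def)
  have "br x y (\<kappa> e) * z 0 - br x z (\<kappa> e) * y 0 + br y z (\<kappa> e) * x 0 = 0"
    unfolding br_top by (simp add: algebra_simps)
  ultimately show ?thesis
    by simp
qed

text \<open>
  Pullbacks of closed forms along homomorphisms are closed, so the edges can be treated separately.
\<close>

lemma total_form_closed: "d2 L total_form = (\<lambda>_. 0)"
proof (rule two_form_closedI[OF total_two_form])
  fix x y z assume c: "x \<in> carrier L" "y \<in> carrier L" "z \<in> carrier L"
  have hom: "\<Phi> e (x \<otimes> y) = \<Phi> e x \<otimes>\<^bsub>chain_model (\<kappa> e)\<^esub> \<Phi> e y"
    if "e \<in> E" "x \<in> carrier L" "y \<in> carrier L" for e x y
    using alg_homD(4)[OF coords_hom] that by blast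
  have "total_form [x \<otimes> y, z] - total_form [x \<otimes> z, y] + total_form [y \<otimes> z, x] =
      (\<Sum>e\<in>E. edge_pairing e (\<Phi> e (x \<otimes> y)) (\<Phi> e z) - edge_pairing e (\<Phi> e (x \<otimes> z)) (\<Phi> e y) +
        edge_pairing e (\<Phi> e (y \<otimes> z)) (\<Phi> e x))"
    using c by (simp add: total_form_eval bracket_closed sum.distrib sum_subtractf)
  also have "\<dots> = 0"
  proof (rule sum.neutral, rule ballI)
    fix e assume e: "e \<in> E"
    show "edge_pairing e (\<Phi> e (x \<otimes> y)) (\<Phi> e z) - edge_pairing e (\<Phi> e (x \<otimes> z)) (\<Phi> e y) +
        edge_pairing e (\<Phi> e (y \<otimes> z)) (\<Phi> e x) = 0"
      unfolding hom[OF e c(1,2)] hom[OF e c(1,3)] hom[OF e c(2,3)] by (rule edge_pairing_closed[OF e])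
  qed
  finally show "total_form [x \<otimes> y, z] - total_form [x \<otimes> z, y] + total_form [y \<otimes> z, x] = 0" .
qed

definition even_length :: "'v \<times> 'v \<Rightarrow> nat" where
  "even_length e = (if even (\<kappa> e) then \<kappa> e else \<kappa> e - 1)"

lemma even_length: "even (even_length e)" "even_length e \<le> \<kappa> e" "even_length e div 2 = \<kappa> e div 2"
  by (auto simp: even_length_def elim: oddE)

lemma even_length_eq: "e \<in> E \<Longrightarrow> even_length e = (if e = e\<^sub>0 then \<kappa> e - 1 else \<kappa> e)"
  using even_edge odd_edge by (auto simp: even_length_def)

text \<open>
  The label of the basis element that \<open>total_form\<close> pairs with the given one: a chain is folded in
  the middle, and on the odd edge the last element is left over and paired with the root.
\<close>

definition partner :: "(('v \<times> 'v) \<times> nat) option \<Rightarrow> (('v \<times> 'v) \<times> nat) option" where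
  "partner i = (case i of None \<Rightarrow> Some (e\<^sub>0, \<kappa> e\<^sub>0)
     | Some (e, l) \<Rightarrow> if e = e\<^sub>0 \<and> l = \<kappa> e\<^sub>0 then None else Some (e, even_length e + 1 - l))"

text \<open>
  One label from each pair of partners.
\<close>

definition half :: "(('v \<times> 'v) \<times> nat) option set" where
  "half = insert None (Some ` Sigma E (\<lambda>e. {1..\<kappa> e div 2}))"

lemma partner_None: "partner None = Some (e\<^sub>0, \<kappa> e\<^sub>0)"
  by (simp add: partner_def)

lemma partner_last: "partner (Some (e\<^sub>0, \<kappa> e\<^sub>0)) = None"
  by (simp add: partner_def)

lemma half_Some: "Some (e, l) \<in> half \<longleftrightarrow> e \<in> E \<and> 1 \<le> l \<and> l \<le> \<kappa> e div 2"
  by (auto simp: half_def)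

lemma index_Some: "Some (e, l) \<in> J \<longleftrightarrow> e \<in> E \<and> 1 \<le> l \<and> l \<le> \<kappa> e"
  by (auto simp: chain_index_def)

lemma partner_Some:
  assumes "e \<in> E" "1 \<le> l" "l \<le> even_length e"
  shows "partner (Some (e, l)) = Some (e, even_length e + 1 - l)"
  using assms length_ge[OF assms(1)] even_length_eq[OF assms(1)] by (auto simp: partner_def split: if_splits)

lemma index_cases:
  assumes "i \<in> J"
  obtains "i = None" | "i = Some (e\<^sub>0, \<kappa> e\<^sub>0)" | e l where "i = Some (e, l)" "e \<in> E" "1 \<le> l" "l \<le> even_length e"
  using assms
proof (cases rule: chain_index_cases)
  case (2 e l)
  then show ?thesis
    using that even_length_eq[OF 2(2)] by (cases "e = e\<^sub>0 \<and> l = \<kappa> e\<^sub>0") (auto split: if_splits)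
qed (use that in blast)

lemma half_subset: "half \<subseteq> J"
  by (auto simp: half_def chain_index_def)

lemma partner_partner:
  assumes "i \<in> J"
  shows "partner (partner i) = i"
  using assms
proof (cases rule: index_cases)
  case (3 e l)
  then have "partner (Some (e, even_length e + 1 - l)) = Some (e, even_length e + 1 - (even_length e + 1 - l))"
    by (intro partner_Some) auto
  then show ?thesis
    using 3 by (simp add: partner_Some)
qed (auto simp: partner_def)

lemma even_length_half: "even_length e = 2 * (\<kappa> e div 2)"
  using even_length(1,3)[of e] by (metis dvd_mult_div_cancel)

lemma partner_half:
  assumes "i \<in> half"
  shows "partner i \<in> J - half"
proof (cases i)
  case None
  then show ?thesis
    using odd_edge length_ge[OF odd_edge(1)] by (auto simp: partner_None index_Some half_Some)
next
  case (Some p)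
  obtain e l where p: "p = (e, l)"
    by (cases p)
  then have l: "e \<in> E" "1 \<le> l" "l \<le> \<kappa> e div 2"
    using assms Some by (auto simp: half_Some)
  have "partner i = Some (e, even_length e + 1 - l)"
    unfolding Some p using l even_length_half[of e] by (intro partner_Some) auto
  then show ?thesis
    using l even_length_half[of e] even_length(2)[of e] by (auto simp: index_Some half_Some)
qed

lemma partner_surj:
  assumes "i \<in> J - half"
  shows "partner i \<in> half"
proof -
  have "i \<in> J"
    using assms by simp
  then show ?thesis
  proof (cases rule: index_cases)
    case 1
    then show ?thesis using assms by (simp add: half_def)
  next
    case 2
    then show ?thesis by (simp add: partner_last half_def)
  next
    case (3 e l)
    then have "\<not> l \<le> \<kappa> e div 2"
      using assms by (auto simp: half_Some)
    then show ?thesis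
      using 3 even_length_half[of e] by (auto simp: partner_Some half_Some)
  qed
qed

lemma partner_inj: "inj_on partner J"
  by (metis inj_onI partner_partner)

text \<open>
  The labels consist of \<open>half\<close> and its partners; this gives the dimension without summing \<open>\<kappa>\<close>.
\<close>

lemma card_index: "card J = 2 * card half"
proof -
  have "J = half \<union> partner ` half"
    using partner_half partner_surj partner_partner half_subset by (auto simp: image_iff) (metis DiffI)
  moreover have "half \<inter> partner ` half = {}"
    using partner_half by auto
  moreover have "finite half"
    using half_subset family_finite by (rule finite_subset)
  moreover have "card (partner ` half) = card half"
    using inj_on_subset[OF partner_inj half_subset] by (rule card_image)
  ultimately show ?thesis
    by (simp add: card_Un_disjoint)
qed

lemma coords_basis:
  assumes "i \<in> J" "e \<in> E" "1 \<le> l" "l \<le> \<kappa> e"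
  shows "\<Phi> e (b i) l = (if i = Some (e, l) then 1 else 0)"
  using family_dual[OF Some_index[OF assms(2-4)] assms(1)] by (auto simp: index_coord_def)

lemma coords_basis_root: "i \<in> J \<Longrightarrow> \<Phi> e\<^sub>0 (b i) 0 = (if i = None then 1 else 0)"
  using family_dual[OF None_index, of i] by (auto simp: index_coord_def)

lemma edge_pairing_basis:
  assumes e: "e \<in> E" and i: "i \<in> J" and j: "j \<in> J"
  shows "edge_pairing e (\<Phi> e (b i)) (\<Phi> e (b j)) =
    (if e = e\<^sub>0 then of_bool (i = None \<and> j = Some (e\<^sub>0, \<kappa> e\<^sub>0)) - of_bool (i = Some (e\<^sub>0, \<kappa> e\<^sub>0) \<and> j = None) else 0) +
    (\<Sum>l = 1..even_length e. if i = Some (e, l) \<and> j = Some (e, even_length e + 1 - l) then (- 1) ^ (l + 1) else 0)"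
proof -
  have "alternating_pairing (even_length e) (\<Phi> e (b i)) (\<Phi> e (b j)) =
    (\<Sum>l = 1..even_length e. if i = Some (e, l) \<and> j = Some (e, even_length e + 1 - l) then (- 1) ^ (l + 1) else 0)"
    unfolding alternating_pairing_full[OF even_length(1)]
  proof (intro sum.cong refl)
    fix l assume "l \<in> {1..even_length e}"
    then have l: "1 \<le> l" "l \<le> \<kappa> e" "1 \<le> even_length e + 1 - l" "even_length e + 1 - l \<le> \<kappa> e"
      using even_length(2)[of e] by auto
    show "(- 1) ^ (l + 1) * \<Phi> e (b i) l * \<Phi> e (b j) (even_length e + 1 - l) =
        (if i = Some (e, l) \<and> j = Some (e, even_length e + 1 - l) then (- 1) ^ (l + 1) else 0)"
      unfolding coords_basis[OF i e l(1,2)] coords_basis[OF j e l(3,4)] by simp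
  qed
  moreover have "edge_pairing e x y = (if e = e\<^sub>0 then x 0 * y (\<kappa> e) - x (\<kappa> e) * y 0 else 0) +
      alternating_pairing (even_length e) x y" for x y
    using even_edge[OF e] odd_edge by (auto simp: edge_pairing_def even_length_def)
  moreover have "\<Phi> e\<^sub>0 (b i') (\<kappa> e\<^sub>0) = (if i' = Some (e\<^sub>0, \<kappa> e\<^sub>0) then 1 else 0)" if "i' \<in> J" for i'
    using length_ge[OF odd_edge(1)] by (intro coords_basis[OF that odd_edge(1)]) auto
  ultimately show ?thesis
    using i j by (simp add: coords_basis_root of_bool_def)
qed

lemma total_form_basis:
  assumes i: "i \<in> J" and j: "j \<in> J"
  shows "total_form [b i, b j] = (\<Sum>e\<in>E. edge_pairing e (\<Phi> e (b i)) (\<Phi> e (b j)))"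
  using family_closed i j by (intro total_form_eval) auto

lemma total_form_orthogonal:
  assumes i: "i \<in> J" and j: "j \<in> J" and ne: "j \<noteq> partner i"
  shows "total_form [b i, b j] = 0"
  unfolding total_form_basis[OF i j]
proof (rule sum.neutral, rule ballI)
  fix e assume e: "e \<in> E"
  have "(\<Sum>l = 1..even_length e. if i = Some (e, l) \<and> j = Some (e, even_length e + 1 - l)
      then (- 1) ^ (l + 1) else (0::'k)) = 0"
    using ne partner_Some[OF e] by (intro sum.neutral) auto
  moreover have "\<not> (i = None \<and> j = Some (e\<^sub>0, \<kappa> e\<^sub>0))"
    using ne by (metis partner_None)
  moreover have "\<not> (i = Some (e\<^sub>0, \<kappa> e\<^sub>0) \<and> j = None)"
    using ne by (metis partner_last)
  ultimately show "edge_pairing e (\<Phi> e (b i)) (\<Phi> e (b j)) = 0"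
    unfolding edge_pairing_basis[OF e i j] by (simp only: of_bool_eq diff_self if_cancel add_0_left)
qed

lemma total_form_partner:
  assumes i: "i \<in> half"
  shows "total_form [b i, b (partner i)] \<noteq> 0"
proof -
  have iJ: "i \<in> J" and pJ: "partner i \<in> J"
    using i half_subset partner_half by auto
  have sum_single: "total_form [b i, b (partner i)] = edge_pairing e (\<Phi> e (b i)) (\<Phi> e (b (partner i)))"
    if e: "e \<in> E" and other: "\<And>e'. e' \<in> E \<Longrightarrow> e' \<noteq> e \<Longrightarrow>
      edge_pairing e' (\<Phi> e' (b i)) (\<Phi> e' (b (partner i))) = 0" for e
    unfolding total_form_basis[OF iJ pJ] using finite_E e other
    by (subst sum.remove[OF finite_E e]) (simp add: sum.neutral)
  from i consider "i = None" | e l where "i = Some (e, l)" "e \<in> E" "1 \<le> l" "l \<le> \<kappa> e div 2"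
    by (auto simp: half_def)
  then show ?thesis
  proof cases
    case 1
    have "total_form [b i, b (partner i)] = edge_pairing e\<^sub>0 (\<Phi> e\<^sub>0 (b i)) (\<Phi> e\<^sub>0 (b (partner i)))"
    proof (rule sum_single[OF odd_edge(1)])
      fix e' assume "e' \<in> E" "e' \<noteq> e\<^sub>0"
      then show "edge_pairing e' (\<Phi> e' (b i)) (\<Phi> e' (b (partner i))) = 0"
        using 1 edge_pairing_basis[OF _ iJ pJ] by simp
    qed
    also have "\<dots> = 1"
      unfolding edge_pairing_basis[OF odd_edge(1) iJ pJ] by (simp add: 1 partner_def)
    finally show ?thesis by simp
  next
    case (2 e l)
    have l: "l \<le> even_length e"
      using 2(4) even_length(1)[of e] even_length(3)[of e] by linarith
    have p: "partner i = Some (e, even_length e + 1 - l)"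
      unfolding 2(1) by (rule partner_Some[OF 2(2,3) l])
    have "total_form [b i, b (partner i)] = edge_pairing e (\<Phi> e (b i)) (\<Phi> e (b (partner i)))"
    proof (rule sum_single[OF 2(2)])
      fix e' assume "e' \<in> E" "e' \<noteq> e"
      then show "edge_pairing e' (\<Phi> e' (b i)) (\<Phi> e' (b (partner i))) = 0"
        using 2(1) p edge_pairing_basis[OF _ iJ pJ] by simp
    qed
    also have "\<dots> = (\<Sum>l' = 1..even_length e. if l' = l then (- 1) ^ (l' + 1) else 0)"
      unfolding edge_pairing_basis[OF 2(2) iJ pJ] unfolding p by (simp add: 2(1) cong: if_cong conj_cong)
    also have "\<dots> = (- 1) ^ (l + 1)"
      using 2(3) l by simp
    finally show ?thesis by simp
  qed
qed

text \<open>
  The form pairs each basis element with its partner and with no other one, so by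
  \<open>wedge_power_pairs\<close> its top power is nonzero on the list of all pairs; $n!$ is invertible in
  characteristic zero.
\<close>

lemma total_form_symplectic: "symplectic_form L total_form"
  unfolding symplectic_form_def
proof (intro conjI exI)
  show "lie_algebra L"
    by (rule lie_algebra_axioms)
  show fin_dim
    by (rule family_fin_dim)
  show "total_form \<in> two_forms L"
    by (rule total_two_form)
  show "d2 L total_form = (\<lambda>_. 0)"
    by (rule total_form_closed)
  have fin: "finite half"
    using half_subset family_finite by (rule finite_subset)
  show "dim = 2 * card half"
    using family_dim card_index by simp
  obtain "is" where "is": "set is = half" "distinct is"
    using finite_distinct_list[OF fin] by blast
  then have len: "length is = card half"
    using distinct_card by fastforce
  have "wedge_power total_form (length is) (concat (map (\<lambda>i. [b i, b (partner i)]) is)) =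
      fact (length is) * (\<Prod>i\<leftarrow>is. total_form [b i, b (partner i)])"
  proof (rule wedge_power_pairs[OF two_forms_length[OF total_two_form] "is"(2)])
    fix i j x y
    assume "i \<in> set is" "j \<in> set is" and ne: "i \<noteq> j"
      and xy: "x \<in> {b i, b (partner i)}" "y \<in> {b j, b (partner j)}"
    then have ij: "i \<in> half" "j \<in> half"
      using "is"(1) by auto
    then have J: "i \<in> J" "j \<in> J" "partner i \<in> J" "partner j \<in> J"
      and p: "partner i \<notin> half" "partner j \<notin> half"
      using half_subset partner_half by auto
    have "j \<noteq> partner i" "partner j \<noteq> partner i" "j \<noteq> partner (partner i)" "partner j \<noteq> partner (partner i)"
      using ij p ne partner_partner[OF J(1)] inj_onD[OF partner_inj _ J(2,1)] by auto
    then show "total_form [x, y] = 0"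
      using xy J by (auto intro: total_form_orthogonal)
  qed
  also have "\<dots> \<noteq> 0"
    using total_form_partner "is"(1) by (simp add: prod_list_zero_iff image_iff)
  finally show "wedge_power total_form (card half) \<noteq> (\<lambda>_. 0)"
    unfolding len by metis
qed

end

theorem theorem4p10:
  fixes G :: "'v pair_pre_digraph" and \<kappa> :: "'v \<times> 'v \<Rightarrow> nat"
  assumes "family_F3 \<kappa> G"
  shows "symplectic (chain_lie \<kappa> G :: ('k::field_char_0, _) module) \<and>
    symplectic_form (chain_lie \<kappa> G :: ('k, _) module) (sigma_form \<kappa> G)"
proof -
  obtain r where chain: "chain_digraph \<kappa> G" and root: "directed_to_root G r" and ae: "almost_even \<kappa> G r"
    using assms unfolding family_F3_def by blast
  obtain e\<^sub>0 where e\<^sub>0: "e\<^sub>0 \<in> parcs G" "snd e\<^sub>0 = r" "odd (\<kappa> e\<^sub>0)"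
    and even: "\<And>e. e \<in> parcs G \<Longrightarrow> e \<noteq> e\<^sub>0 \<Longrightarrow> even (\<kappa> e)"
    using ae unfolding almost_even_def by blast
  let ?L = "chain_lie \<kappa> G :: ('k, _) module"
  let ?b = "\<lambda>i. eval_bracketing ?L (chain_gen \<kappa> G) (index_bracketing r i)"
  interpret L: lie_algebra ?L
    by (rule chain_lie_lie_algebra[OF chain root e\<^sub>0(1,2)])
  interpret B: dual_basis ?L "chain_index \<kappa> (parcs G)" ?b "index_coord (chain_coords \<kappa> G) e\<^sub>0"
    by (rule chain_lie_dual_basis[OF chain root e\<^sub>0(1,2)])
  interpret C: chain_coordinates ?L "parcs G" \<kappa> e\<^sub>0 ?b "chain_coords \<kappa> G"
  proof
    show "finite (parcs G)"
      using chain by (simp add: chain_digraph_def pair_fin_digraph_def pair_fin_digraph_axioms_def)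
    show "alg_hom ?L (chain_model (\<kappa> e)) (chain_coords \<kappa> G e)" if "e \<in> parcs G" for e
      by (rule chain_coords_hom[OF chain root e\<^sub>0(1,2) that])
    show "2 \<le> \<kappa> e" if "e \<in> parcs G" for e
      by (rule chain_digraph_edge(4)[OF chain that])
  qed (use e\<^sub>0 even in auto)
  have dual: "std_dual \<kappa> G (?b i) = C.dual_form i" for i
    unfolding std_dual_def C.dual_form_def std_basis_eq[OF chain root e\<^sub>0(1,2), where 'k = 'k] ..
  have w: "chain_w \<kappa> G e l = ?b (Some (e, l))" if "1 \<le> l" for e l
    using that chain_w_eval[OF chain root e\<^sub>0(1,2), of e "l - 1", where 'k = 'k]
    by (simp add: index_bracketing_def)
  have alt: "alternating_chain \<kappa> G e n = C.alternating_form e n" for e n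
  proof
    fix xs
    have "std_dual \<kappa> G (chain_w \<kappa> G e l) = C.dual_form (Some (e, l)) \<and>
        std_dual \<kappa> G (chain_w \<kappa> G e (n + 1 - l)) = C.dual_form (Some (e, n + 1 - l))"
      if "l \<in> {1..n div 2}" for l
    proof -
      have "1 \<le> l" "1 \<le> n + 1 - l"
        using that by auto
      then show ?thesis
        by (simp only: w dual)
    qed
    then show "alternating_chain \<kappa> G e n xs = C.alternating_form e n xs"
      unfolding alternating_chain_def C.alternating_form_def by (intro sum.cong refl) simp
  qed
  have "sigma_edge \<kappa> G e = C.edge_form e" if e: "e \<in> parcs G" for e
  proof
    fix xs
    have "std_dual \<kappa> G (chain_w \<kappa> G e (\<kappa> e)) = C.dual_form (Some (e, \<kappa> e))"
      using C.length_ge[OF e] by (simp add: w dual)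
    moreover have "std_dual \<kappa> G (chain_gen \<kappa> G (snd e)) = C.dual_form None" if "odd (\<kappa> e)"
      using even[OF e] that e\<^sub>0(2) dual[of None] by (auto simp: index_bracketing_def)
    ultimately show "sigma_edge \<kappa> G e xs = C.edge_form e xs"
      by (simp add: sigma_edge_def C.edge_form_def alt)
  qed
  then have "sigma_form \<kappa> G = C.total_form"
    by (simp add: fun_eq_iff sigma_form_def C.total_form_def)
  then have "symplectic_form ?L (sigma_form \<kappa> G)"
    using C.total_form_symplectic by simp
  then show ?thesis
    unfolding symplectic_def by blast
qed

end
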